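(* Let $\mathcal S$ be an ISSIFS with associated set of matrices $\mathcal B=\{\mathbf B_0,\dots,\mathbf B_{L-1}\}$, and assume that $\mathcal B$ is good with respect to the uniform measure $\left(\frac1L,\dots,\frac1L\right)^{\mathbb N}$ on $\Sigma=[L]^{\mathbb N}$. Let $P$ be the pressure function of $\mathcal B$. If the restriction of $P$ to $(-\infty,0]$ is not a straight line (i.e. is not affine), then there exists a non-empty open parameter interval $(p_0,p_1)\subset[0,1]$ such that for every $p_0<p<p_1$ the random attractor $\Lambda_{\mathcal S,p}$ has positive Lebesgue measure almost surely conditioned on non-extinction, but almost surely does not contain an interior point.
   Context: Notation: $[k]=\{0,\dots,k-1\}$; $\mathbb N$ includes $0$ when used as a set of values. ISSIFS: a finite list $\mathcal S=\{S_i(x)=\frac1Lx+t_i\}_{i=0}^{M-1}$ of maps of $\mathbb R$, with $L\ge2$ an integer, $t_i\in\mathbb N$, $0=t_0\le\cdots\le t_{M-1}$, and $L-1$ dividing $t_{M-1}$. Write $S_{i_1\dots i_n}=S_{i_1}\circ\cdots\circ S_{i_n}$. On $\Sigma_M=[M]^{\mathbb N}$ put $\Pi(\mathbf i)=\lim_{n\to\infty}S_{i_1\dots i_n}(0)$. Let $\eta=\Pi_*\mu$, where $\mu=(\frac1M,\dots,\frac1M)^{\mathbb N}$. The basic intervals are those intervals of the form $[(i-1)L,iL]$, $i\in\mathbb Z$, having positive $\eta$-measure; there are finitely many, say $N$, written $J^{(U)}=[b_UL,(b_U+1)L]$, $U\in[N]$, $b_U\in\mathbb N$, $b_0<b_1<\dots<b_{N-1}$.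 For $\theta\in[L]$ let $J^{(U)}_\theta=[b_UL+\theta,\,b_UL+\theta+1]$. The $N\times N$ matrix $\mathbf B_\theta$ is $\mathbf B_\theta(i,k)=\#\{\ell\in[M]:S_\ell(J^{(k)})=J^{(i)}_\theta\}$, $i,k\in[N]$. Random set: to each nonempty finite word $i_1\dots i_n$ over $[M]$ assign independent Bernoulli variables $X_{i_1\dots i_n}$ with $\mathbb P(X_{i_1\dots i_n}=1)=p$. Let $\mathcal E_\infty=\{\mathbf i\in\Sigma_M:X_{i_1\dots i_n}=1\ \forall n\ge1\}$. The coin tossing integer self-similar set (random attractor) is $\Lambda_{\mathcal S,p}=\Pi(\mathcal E_\infty)$. Non-extinction is the event $\mathcal E_\infty\ne\emptyset$. Good (with respect to a shift-ergodic probability measure $\nu$ on $\Sigma$): every element of $\mathcal B$ is non-negative, every element is allowable (every row and every column contains a strictly positive entry), and there is $(\theta_1,\dots,\theta_n)$ whose cylinder set in $\Sigma$ has positive $\nu$-measure such that $\mathbf B_{\theta_1}\cdots\mathbf B_{\theta_n}$ is strictly positive (all entries). Pressure function: for $q\in\mathbb R$, $P(q)=\lim_{n\to\infty}\frac1n\log\sum_{\boldsymbol\theta\in[L]^n}\|\mathbf B_{\boldsymbol\theta}\|_*^q$, where $\mathbf B_{\boldsymbol\theta}=\mathbf B_{\theta_1}\cdots\mathbf B_{\theta_n}$ and $\|\cdot\|_*$ is a submultiplicative matrix norm (the limit exists for all $q\in\mathbb R$). *)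

theory Defs
  imports "HOL-Probability.Probability" "Jordan_Normal_Form.Matrix"
begin
text \<open>The alphabet $[K]$ is \<open>{..<K}\<close>.\<close>

definition words :: "nat \<Rightarrow> nat \<Rightarrow> nat list set" where
  "words K n = {w. length w = n \<and> set w \<subseteq> {..<K}}"

definition symb_space :: "nat \<Rightarrow> (nat \<Rightarrow> nat) set" where
  "symb_space K = UNIV \<rightarrow> {..<K}"

text \<open>The sequence is indexed from 0: \<open>i k\<close> is the letter written $i_{k+1}$ in the mathematics.\<close>

definition prefix_word :: "(nat \<Rightarrow> nat) \<Rightarrow> nat \<Rightarrow> nat list" where
  "prefix_word i n = map i [0..<n]"

definition cylinder :: "nat \<Rightarrow> nat list \<Rightarrow> (nat \<Rightarrow> nat) set" where
  "cylinder K w = {i \<in> symb_space K. prefix_word i (length w) = w}"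

definition uniform_symb_measure :: "nat \<Rightarrow> (nat \<Rightarrow> nat) measure" where
  "uniform_symb_measure K = PiM UNIV (\<lambda>_. uniform_count_measure {..<K})"

text \<open>A system is given by \<open>L\<close> and its list \<open>ts\<close> of translations, so $M$ is \<open>length ts\<close>.
  Repeated translations are allowed, and maps are counted with multiplicity.\<close>

definition issifs :: "nat \<Rightarrow> nat list \<Rightarrow> bool" where
  "issifs L ts \<longleftrightarrow> 2 \<le> L \<and> ts \<noteq> [] \<and> ts ! 0 = 0 \<and> sorted ts \<and> (L - 1) dvd last ts"

definition ifs_map :: "nat \<Rightarrow> nat list \<Rightarrow> nat \<Rightarrow> real \<Rightarrow> real" where
  "ifs_map L ts l x = x / real L + real (ts ! l)"

definition ifs_word_map :: "nat \<Rightarrow> nat list \<Rightarrow> nat list \<Rightarrow> real \<Rightarrow> real" where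
  "ifs_word_map L ts w = foldr (\<lambda>l g. ifs_map L ts l \<circ> g) w id"

definition nat_proj :: "nat \<Rightarrow> nat list \<Rightarrow> (nat \<Rightarrow> nat) \<Rightarrow> real" where
  "nat_proj L ts i = lim (\<lambda>n. ifs_word_map L ts (prefix_word i n) 0)"

definition nat_measure :: "nat \<Rightarrow> nat list \<Rightarrow> real measure" where
  "nat_measure L ts = distr (uniform_symb_measure (length ts)) borel (nat_proj L ts)"

definition grid_interval :: "nat \<Rightarrow> int \<Rightarrow> real set" where
  "grid_interval L b = {of_int b * real L .. (of_int b + 1) * real L}"

definition basic_indices :: "nat \<Rightarrow> nat list \<Rightarrow> int set" where
  "basic_indices L ts = {b. measure (nat_measure L ts) (grid_interval L b) > 0}"

definition num_basic :: "nat \<Rightarrow> nat list \<Rightarrow> nat" where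
  "num_basic L ts = card (basic_indices L ts)"

text \<open>The indices are sorted increasingly. The set of indices is finite, and it lies in the
  naturals unless all translations vanish, when the matrices are not allowable anyway.\<close>

definition basic_index :: "nat \<Rightarrow> nat list \<Rightarrow> nat \<Rightarrow> int" where
  "basic_index L ts U = sorted_list_of_set (basic_indices L ts) ! U"

definition basic_interval :: "nat \<Rightarrow> nat list \<Rightarrow> nat \<Rightarrow> real set" where
  "basic_interval L ts U = grid_interval L (basic_index L ts U)"

definition basic_subinterval :: "nat \<Rightarrow> nat list \<Rightarrow> nat \<Rightarrow> nat \<Rightarrow> real set" where
  "basic_subinterval L ts U \<theta> =
     {of_int (basic_index L ts U) * real L + real \<theta> ..
      of_int (basic_index L ts U) * real L + real \<theta> + 1}"

definition assoc_mat :: "nat \<Rightarrow> nat list \<Rightarrow> nat \<Rightarrow> real mat" where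
  "assoc_mat L ts \<theta> = Matrix.mat (num_basic L ts) (num_basic L ts)
     (\<lambda>(i, k). real (card {l \<in> {..<length ts}.
        ifs_map L ts l ` basic_interval L ts k = basic_subinterval L ts i \<theta>}))"

definition mat_word_prod :: "nat \<Rightarrow> (nat \<Rightarrow> real mat) \<Rightarrow> nat list \<Rightarrow> real mat" where
  "mat_word_prod N B w = foldr (\<lambda>\<theta> A. B \<theta> * A) w (1\<^sub>m N)"

definition nonneg_mat :: "real mat \<Rightarrow> bool" where
  "nonneg_mat A \<longleftrightarrow> (\<forall>i<dim_row A. \<forall>k<dim_col A. 0 \<le> A $$ (i, k))"

definition strictly_pos_mat :: "real mat \<Rightarrow> bool" where
  "strictly_pos_mat A \<longleftrightarrow> (\<forall>i<dim_row A. \<forall>k<dim_col A. 0 < A $$ (i, k))"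

definition allowable_mat :: "real mat \<Rightarrow> bool" where
  "allowable_mat A \<longleftrightarrow>
     (\<forall>i<dim_row A. \<exists>k<dim_col A. 0 < A $$ (i, k)) \<and>
     (\<forall>k<dim_col A. \<exists>i<dim_row A. 0 < A $$ (i, k))"

definition good_family :: "(nat \<Rightarrow> nat) measure \<Rightarrow> nat \<Rightarrow> nat \<Rightarrow> (nat \<Rightarrow> real mat) \<Rightarrow> bool" where
  "good_family \<nu> N L B \<longleftrightarrow>
     (\<forall>\<theta><L. nonneg_mat (B \<theta>) \<and> allowable_mat (B \<theta>)) \<and>
     (\<exists>n\<ge>1. \<exists>w\<in>words L n. measure \<nu> (cylinder L w) > 0 \<and>
        strictly_pos_mat (mat_word_prod N B w))"

definition submult_mat_norm :: "nat \<Rightarrow> (real mat \<Rightarrow> real) \<Rightarrow> bool" where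
  "submult_mat_norm N nrm \<longleftrightarrow>
     (\<forall>A\<in>carrier_mat N N. 0 \<le> nrm A \<and> (nrm A = 0 \<longleftrightarrow> A = 0\<^sub>m N N)) \<and>
     (\<forall>A\<in>carrier_mat N N. \<forall>c. nrm (c \<cdot>\<^sub>m A) = \<bar>c\<bar> * nrm A) \<and>
     (\<forall>A\<in>carrier_mat N N. \<forall>C\<in>carrier_mat N N. nrm (A + C) \<le> nrm A + nrm C) \<and>
     (\<forall>A\<in>carrier_mat N N. \<forall>C\<in>carrier_mat N N. nrm (A * C) \<le> nrm A * nrm C)"

text \<open>For a good family every product of its members is non-zero, so the real power
  below is always taken at a positive base.\<close>

definition pressure ::
    "(real mat \<Rightarrow> real) \<Rightarrow> nat \<Rightarrow> nat \<Rightarrow> (nat \<Rightarrow> real mat) \<Rightarrow> real \<Rightarrow> real" where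
  "pressure nrm N L B q =
     lim (\<lambda>n. 1 / real n * ln (\<Sum>w\<in>words L n. nrm (mat_word_prod N B w) powr q))"

text \<open>The independent Bernoulli variables $X_w$ are realised as the coordinates \<open>\<omega> w\<close> of the
  product space over all non-empty words. Any other realisation on a probability space maps to
  this one by a measure-preserving map, which carries almost sure statements over.\<close>

definition coin_space :: "nat \<Rightarrow> real \<Rightarrow> (nat list \<Rightarrow> bool) measure" where
  "coin_space M p = PiM (\<Union>n\<in>{1..}. words M n) (\<lambda>_. measure_pmf (bernoulli_pmf p))"

definition surviving :: "nat \<Rightarrow> (nat list \<Rightarrow> bool) \<Rightarrow> (nat \<Rightarrow> nat) set" where
  "surviving M \<omega> = {i \<in> symb_space M. \<forall>n\<ge>1. \<omega> (prefix_word i n)}"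

definition random_attractor :: "nat \<Rightarrow> nat list \<Rightarrow> (nat list \<Rightarrow> bool) \<Rightarrow> real set" where
  "random_attractor L ts \<omega> = nat_proj L ts ` surviving (length ts) \<omega>"

text \<open>Conditioning on \<open>E\<close> presupposes that \<open>E\<close> has positive probability; the bare implication
  under \<open>AE\<close> would hold vacuously for a null event.\<close>

definition almost_surely_given :: "'a measure \<Rightarrow> ('a \<Rightarrow> bool) \<Rightarrow> ('a \<Rightarrow> bool) \<Rightarrow> bool" where
  "almost_surely_given Q A E \<longleftrightarrow>
     measure Q {\<omega> \<in> space Q. E \<omega>} > 0 \<and> (AE \<omega> in Q. E \<omega> \<longrightarrow> A \<omega>)"

end

theory Submission
  imports Defs
begin

text \<open>
  Cut a point \<open>x\<close> into the grid cell \<open>[bL, (b+1)L)\<close> that contains it and the sequence of base-\<open>L\<close>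
  digits \<open>\<theta>\<close> of its offset there. Undoing the map with translation \<open>t\<close> sends \<open>x\<close> to the cell
  \<open>bL + \<theta>\<^sub>1 - t\<close> and shifts the digits. So, up to the countably many grid points, \<open>x\<close> lies in the
  random attractor exactly when a branching process on the basic cells, run in the deterministic
  environment \<open>\<theta>\<close>, survives. The product \<open>B\<close> of the matrices of the first \<open>n\<close> digits counts the words
  of length \<open>n\<close> that lead to \<open>x\<close>, by initial and final cell, and \<open>p\<^sup>n B\<close> is the mean number of
  survivors. Everything below compares \<open>p\<close> with the growth of these products, measured by the sum of
  entries \<open>|B|\<close>. Under Lebesgue measure the digits are independent and uniform, and the growth rate
  is the Lyapunov exponent \<open>\<lambda>\<close>, the limit of the averages of \<open>ln |B\<^sub>w| / n\<close> over the words \<open>w\<close> of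
  length \<open>n\<close>.

  Positive measure when \<open>ln p + \<lambda> > 0\<close>. Let \<open>Q v\<close> be the smallest survival probability, over the
  starting cells, in the environment \<open>v\<close>. Prefixing a block \<open>u\<close> of length \<open>m\<close> changes \<open>1/Q\<close> by at
  most a factor \<open>1/(p\<^sup>m R u)\<close> and an additive constant, where \<open>R u\<close> is the smallest row sum of \<open>B\<^sub>u\<close>.
  The average of \<open>ln R\<close> has the same rate \<open>\<lambda>\<close> as that of \<open>ln |B|\<close>, because a positive product occurs
  after a random time of bounded mean (\<open>exists_gap_bound\<close>). Hence for large \<open>m\<close> the factor is below
  1 on logarithmic average, a small positive power of it is below 1 on average, and the averages
  of \<open>(1/Q)\<^sup>s\<close> stay bounded (\<open>mean_alive_prob_bounded_below\<close>). So the expected Lebesgue measure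
  is positive. Being negligible is inherited by the subtrees, its probability is a fixed point of
  the offspring generating function, and such a fixed point below 1 is the extinction probability
  (\<open>zero_one_law\<close>).

  Empty interior when \<open>p\<^sup>n |B\<^sub>w| < 1\<close> for some word \<open>w\<close> of length \<open>n\<close>. The points whose digits end in
  repetitions of \<open>w\<close> are dense and countably many, and the first moment bound shows that almost
  surely none of them lies in the attractor (\<open>AE_interior_empty\<close>). The repeated word is
  modified so that its digits are not constant, which keeps these points off the grid.

  The two ranges of \<open>p\<close> overlap as soon as \<open>|B\<^sub>w| < exp(\<lambda> n)\<close> for some \<open>w\<close>. Otherwise the pressure at
  \<open>q \<le> 0\<close> is at most \<open>ln L + \<lambda> q\<close> by the assumed lower bound on \<open>|B\<^sub>w|\<close>, and at least that by
  convexity of the exponential, so it is affine on \<open>(-\<infinity>, 0]\<close> (\<open>pressure_line\<close>). The entries are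
  integers and no product vanishes, so \<open>|B\<^sub>w| \<ge> 1\<close> and the inequality also forces \<open>\<lambda> > 0\<close>: the
  interval lies below 1.
\<close>

section \<open>Coin tossing trees\<close>

definition nonempty_words :: "nat \<Rightarrow> nat list set" where
  "nonempty_words M = (\<Union>n\<in>{1..}. words M n)"

text \<open>The restriction makes the subtree of a sample point of \<open>coin_space\<close> extensional, hence again a
  sample point.\<close>
definition subtree :: "nat \<Rightarrow> nat \<Rightarrow> (nat list \<Rightarrow> bool) \<Rightarrow> nat list \<Rightarrow> bool" where
  "subtree M l \<omega> = (\<lambda>w\<in>nonempty_words M. \<omega> (l # w))"

lemma nonempty_words_iff: "w \<in> nonempty_words M \<longleftrightarrow> w \<noteq> [] \<and> set w \<subseteq> {..<M}"
  by (auto simp: nonempty_words_def words_def Suc_le_eq)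

lemma coin_space_eq:
  "coin_space M p = PiM (nonempty_words M) (\<lambda>_. measure_pmf (bernoulli_pmf p))"
  by (simp add: coin_space_def nonempty_words_def)

lemma prob_space_coin: "prob_space (coin_space M p)"
  unfolding coin_space_eq by (intro prob_space_PiM measure_pmf.prob_space_axioms)

lemma space_coin: "space (coin_space M p) = nonempty_words M \<rightarrow>\<^sub>E UNIV"
  by (simp add: coin_space_eq space_PiM)

lemma PiM_blocks_independent:
  fixes Q :: "'i \<Rightarrow> 'a measure"
  assumes Q: "\<And>i. i \<in> I \<Longrightarrow> prob_space (Q i)"
    and J: "finite J" "J \<noteq> {}" "disjoint_family_on K J" "\<And>j. j \<in> J \<Longrightarrow> K j \<subseteq> I"
    and E: "\<And>j. j \<in> J \<Longrightarrow> E j \<in> sets (PiM (K j) Q)"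
    and I: "I \<noteq> {}"
  shows "measure (PiM I Q) {\<omega>\<in>space (PiM I Q). \<forall>j\<in>J. restrict \<omega> (K j) \<in> E j}
    = (\<Prod>j\<in>J. measure (PiM I Q) {\<omega>\<in>space (PiM I Q). restrict \<omega> (K j) \<in> E j})"
proof -
  interpret P: prob_space "PiM I Q"
    by (intro prob_space_PiM Q)
  have rv: "(\<lambda>\<omega>. \<omega> i) \<in> PiM I Q \<rightarrow>\<^sub>M Q i" if "i \<in> I" for i
    using that by (rule measurable_component_singleton)
  have "distr (PiM I Q) (PiM I Q) (\<lambda>x. \<lambda>i\<in>I. x i) = distr (PiM I Q) (PiM I Q) (\<lambda>x. x)"
    by (intro distr_cong) (auto simp: space_PiM)
  also have "\<dots> = PiM I (\<lambda>i. distr (PiM I Q) (Q i) (\<lambda>x. x i))"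
    using Q by (auto simp: distr_PiM_component intro!: PiM_cong)
  finally have "P.indep_vars Q (\<lambda>i \<omega>. \<omega> i) I"
    using P.indep_vars_iff_distr_eq_PiM'[OF I, where M' = Q and X = "\<lambda>i \<omega>. \<omega> i"] rv by auto
  from P.indep_vars_restrict[OF this, of J K] J
  have "P.indep_vars (\<lambda>j. PiM (K j) Q) (\<lambda>j \<omega>. restrict \<omega> (K j)) J"
    by auto
  from P.indep_varsD_finite[OF this J(2,1), of E] E
  have "P.prob (\<Inter>j\<in>J. (\<lambda>\<omega>. restrict \<omega> (K j)) -` E j \<inter> space (PiM I Q))
     = (\<Prod>j\<in>J. P.prob ((\<lambda>\<omega>. restrict \<omega> (K j)) -` E j \<inter> space (PiM I Q)))"
    by auto
  also have "(\<Inter>j\<in>J. (\<lambda>\<omega>. restrict \<omega> (K j)) -` E j \<inter> space (PiM I Q))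
     = {\<omega>\<in>space (PiM I Q). \<forall>j\<in>J. restrict \<omega> (K j) \<in> E j}"
    using J(2) by auto
  also have "(\<lambda>j. (\<lambda>\<omega>. restrict \<omega> (K j)) -` E j \<inter> space (PiM I Q)) =
     (\<lambda>j. {\<omega>\<in>space (PiM I Q). restrict \<omega> (K j) \<in> E j})"
    by auto
  finally show ?thesis .
qed

lemma measurable_subtree:
  assumes "l < M"
  shows "subtree M l \<in> coin_space M p \<rightarrow>\<^sub>M coin_space M p"
  unfolding coin_space_eq subtree_def using assms
  by (intro measurable_restrict measurable_component_singleton) (auto simp: nonempty_words_iff)

lemma coin_sets_coordinate:
  assumes "l < M"
  shows "{\<omega>\<in>space (coin_space M p). \<omega> [l]} \<in> sets (coin_space M p)"
proof -
  have "(\<lambda>\<omega>. \<omega> [l]) \<in> coin_space M p \<rightarrow>\<^sub>M measure_pmf (bernoulli_pmf p)"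
    unfolding coin_space_eq using assms
    by (intro measurable_component_singleton) (auto simp: nonempty_words_iff)
  from measurable_sets[OF this, of "{True}"] show ?thesis
    by (auto simp: vimage_def Collect_conj_eq Int_commute)
qed

lemma measure_coin_coordinate:
  assumes "l < M" "0 \<le> p" "p \<le> 1"
  shows "measure (coin_space M p) {\<omega>\<in>space (coin_space M p). \<omega> [l]} = p"
proof -
  have l: "[l] \<in> nonempty_words M" using assms by (auto simp: nonempty_words_iff)
  have m: "(\<lambda>\<omega>. \<omega> [l]) \<in> coin_space M p \<rightarrow>\<^sub>M measure_pmf (bernoulli_pmf p)"
    unfolding coin_space_eq by (rule measurable_component_singleton[OF l])
  have "distr (coin_space M p) (measure_pmf (bernoulli_pmf p)) (\<lambda>\<omega>. \<omega> [l])
      = measure_pmf (bernoulli_pmf p)"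
    unfolding coin_space_eq by (rule distr_PiM_component[OF _ l])
      (rule measure_pmf.prob_space_axioms)
  then have "measure (measure_pmf (bernoulli_pmf p)) {True} =
     measure (distr (coin_space M p) (measure_pmf (bernoulli_pmf p)) (\<lambda>\<omega>. \<omega> [l])) {True}"
    by simp
  also have "\<dots> = measure (coin_space M p) {\<omega>\<in>space (coin_space M p). \<omega> [l]}"
    by (subst measure_distr[OF m]) (auto intro!: arg_cong[where f="measure _"])
  finally show ?thesis
    using assms by (simp add: measure_pmf_single)
qed

lemma measure_coin_subtree:
  assumes "l < M" "A \<in> sets (coin_space M p)"
  shows "measure (coin_space M p) {\<omega>\<in>space (coin_space M p). subtree M l \<omega> \<in> A}
    = measure (coin_space M p) A"
proof -
  have "distr (coin_space M p) (coin_space M p) (subtree M l) = coin_space M p"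
    unfolding coin_space_eq subtree_def using assms(1)
    by (intro distr_PiM_reindex measure_pmf.prob_space_axioms)
      (auto simp: inj_on_def nonempty_words_iff)
  then have "measure (coin_space M p) A =
    measure (distr (coin_space M p) (coin_space M p) (subtree M l)) A" by simp
  also have "\<dots> = measure (coin_space M p) {\<omega>\<in>space (coin_space M p). subtree M l \<omega> \<in> A}"
    by (subst measure_distr[OF measurable_subtree[OF assms(1)] assms(2)])
      (auto intro!: arg_cong[where f="measure _"])
  finally show ?thesis by simp
qed

lemma sets_coin_branch:
  assumes "l < M" "A \<in> sets (coin_space M p)"
  shows "{\<omega>\<in>space (coin_space M p). \<omega> [l] \<and> subtree M l \<omega> \<in> A} \<in> sets (coin_space M p)"
proof -
  have "{\<omega>\<in>space (coin_space M p). \<omega> [l] \<and> subtree M l \<omega> \<in> A} =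
    {\<omega>\<in>space (coin_space M p). \<omega> [l]} \<inter> (subtree M l -` A \<inter> space (coin_space M p))"
    by auto
  then show ?thesis
    using coin_sets_coordinate[OF assms(1)] measurable_sets[OF measurable_subtree[OF assms(1)] assms(2)]
    by auto
qed

text \<open>The words with first letter \<open>l\<close> form disjoint blocks of coordinates. In each of them the coin of the
  one-letter word is independent of the rest, which is a copy of the whole tree. The recursions
  for survival, extinction and negligibility are all instances.\<close>
lemma coin_branching:
  assumes p: "0 \<le> p" "p \<le> 1" and M: "0 < M"
    and A: "\<And>l. l < M \<Longrightarrow> A l \<in> sets (coin_space M p)"
  shows "measure (coin_space M p)
      {\<omega>\<in>space (coin_space M p). \<forall>l<M. \<omega> [l] \<longrightarrow> subtree M l \<omega> \<notin> A l}
    = (\<Prod>l<M. 1 - p * measure (coin_space M p) (A l))"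
proof -
  let ?C = "coin_space M p" and ?b = "\<lambda>_::nat list. measure_pmf (bernoulli_pmf p)"
  let ?N = "nonempty_words M"
  interpret P: prob_space ?C by (rule prob_space_coin)
  define K where "K l = {l # w | w. set w \<subseteq> {..<M}}" for l
  define K' where "K' l = (\<lambda>c. if c then {[l]} else {l # w | w. w \<in> ?N})" for l
  have KN: "K l \<subseteq> ?N" if "l < M" for l
    using that by (auto simp: K_def nonempty_words_iff)
  have K'N: "K' l c \<subseteq> ?N" if "l < M" for l c
    using that by (auto simp: K'_def nonempty_words_iff)
  have "[0] \<in> ?N" using M by (simp add: nonempty_words_iff)
  then have Nne: "?N \<noteq> {}" by blast
  have coordm: "{y\<in>space (PiM S ?b). y [l]} \<in> sets (PiM S ?b)" if "[l] \<in> S" for S l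
    using measurable_sets[OF measurable_component_singleton[OF that, of ?b], of "{True}"]
    by (auto simp: vimage_def Collect_conj_eq Int_commute)
  have subm: "{y\<in>space (PiM S ?b). (\<lambda>w\<in>?N. y (l # w)) \<in> A l} \<in> sets (PiM S ?b)"
    if S: "(#) l ` ?N \<subseteq> S" and l: "l < M" for S l
  proof -
    have "(\<lambda>y. \<lambda>w\<in>?N. y (l # w)) \<in> PiM S ?b \<rightarrow>\<^sub>M coin_space M p"
      unfolding coin_space_eq using S
      by (intro measurable_restrict measurable_component_singleton) auto
    moreover have "{y\<in>space (PiM S ?b). (\<lambda>w\<in>?N. y (l # w)) \<in> A l} =
        (\<lambda>y. \<lambda>w\<in>?N. y (l # w)) -` A l \<inter> space (PiM S ?b)"
      by blast
    ultimately show ?thesis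
      using measurable_sets[OF _ A[OF l]] by simp
  qed
  have G: "P.prob {\<omega>\<in>space ?C. \<omega> [l] \<and> subtree M l \<omega> \<in> A l} = p * P.prob (A l)" if l: "l < M" for l
  proof -
    define E where "E = (\<lambda>c. if c then {y\<in>space (PiM (K' l c) ?b). y [l]}
       else {y\<in>space (PiM (K' l c) ?b). (\<lambda>w\<in>?N. y (l # w)) \<in> A l})"
    have E: "E c \<in> sets (PiM (K' l c) ?b)" for c
      using coordm[of l "K' l True"] subm[of l "K' l False"] l
      by (cases c) (auto simp: E_def K'_def image_def)
    have E1: "restrict \<omega> (K' l True) \<in> E True \<longleftrightarrow> \<omega> [l]" for \<omega>
      by (auto simp: E_def K'_def space_PiM)
    have E2: "restrict \<omega> (K' l False) \<in> E False \<longleftrightarrow> subtree M l \<omega> \<in> A l" for \<omega>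
    proof -
      have "(\<lambda>w\<in>?N. restrict \<omega> (K' l False) (l # w)) = subtree M l \<omega>"
        by (auto simp: K'_def subtree_def fun_eq_iff restrict_def)
      then show ?thesis by (auto simp: E_def space_PiM)
    qed
    have "P.prob {\<omega>\<in>space ?C. \<forall>c\<in>UNIV. restrict \<omega> (K' l c) \<in> E c}
      = (\<Prod>c\<in>UNIV. P.prob {\<omega>\<in>space ?C. restrict \<omega> (K' l c) \<in> E c})"
      unfolding coin_space_eq
      by (rule PiM_blocks_independent)
        (use E K'N[OF l] Nne in \<open>auto simp: disjoint_family_on_def K'_def nonempty_words_iff
            intro: measure_pmf.prob_space_axioms\<close>)
    moreover have "{\<omega>\<in>space ?C. \<forall>c\<in>UNIV. restrict \<omega> (K' l c) \<in> E c} =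
        {\<omega>\<in>space ?C. \<omega> [l] \<and> subtree M l \<omega> \<in> A l}"
      unfolding UNIV_bool by (auto simp: E1 E2)
    ultimately show ?thesis
      using measure_coin_coordinate[OF l p] measure_coin_subtree[OF l A[OF l]]
      by (simp add: UNIV_bool E1 E2)
  qed
  define E where "E l = {y\<in>space (PiM (K l) ?b). \<not> (y [l] \<and> (\<lambda>w\<in>?N. y (l # w)) \<in> A l)}" for l
  have E: "E l \<in> sets (PiM (K l) ?b)" if l: "l < M" for l
  proof -
    have "E l = space (PiM (K l) ?b) -
      ({y\<in>space (PiM (K l) ?b). y [l]} \<inter> {y\<in>space (PiM (K l) ?b). (\<lambda>w\<in>?N. y (l # w)) \<in> A l})"
      by (auto simp: E_def)
    moreover have "[l] \<in> K l" "(#) l ` ?N \<subseteq> K l"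
      by (auto simp: K_def nonempty_words_iff)
    ultimately show ?thesis
      using coordm[of l "K l"] subm[OF _ l, of "K l"]
      by (simp only: sets.Diff sets.top sets.Int)
  qed
  have E1: "restrict \<omega> (K l) \<in> E l \<longleftrightarrow> (\<omega> [l] \<longrightarrow> subtree M l \<omega> \<notin> A l)" for \<omega> l
  proof -
    have "(\<lambda>w\<in>?N. restrict \<omega> (K l) (l # w)) = subtree M l \<omega>"
      by (auto simp: K_def subtree_def fun_eq_iff restrict_def nonempty_words_iff)
    moreover have "restrict \<omega> (K l) [l] = \<omega> [l]" by (auto simp: K_def)
    ultimately show ?thesis by (auto simp: E_def space_PiM)
  qed
  have "P.prob {\<omega>\<in>space ?C. \<forall>l\<in>{..<M}. restrict \<omega> (K l) \<in> E l}
      = (\<Prod>l\<in>{..<M}. P.prob {\<omega>\<in>space ?C. restrict \<omega> (K l) \<in> E l})"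
    unfolding coin_space_eq
    by (rule PiM_blocks_independent)
      (use E KN Nne M in \<open>auto simp: disjoint_family_on_def K_def
          intro: measure_pmf.prob_space_axioms\<close>)
  also have "\<dots> = (\<Prod>l<M. 1 - p * P.prob (A l))"
  proof (rule prod.cong[OF refl])
    fix l assume "l \<in> {..<M}"
    then have l: "l < M" by simp
    have "{\<omega>\<in>space ?C. restrict \<omega> (K l) \<in> E l} =
      space ?C - {\<omega>\<in>space ?C. \<omega> [l] \<and> subtree M l \<omega> \<in> A l}"
      unfolding E1 by auto
    then show "P.prob {\<omega>\<in>space ?C. restrict \<omega> (K l) \<in> E l} = 1 - p * P.prob (A l)"
      using G[OF l] P.prob_compl[OF sets_coin_branch[OF l A[OF l]]] by simp
  qed
  finally show ?thesis by (simp only: E1 Ball_def lessThan_iff)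
qed

section \<open>The branching process of cells\<close>

lemma surviving_Cons:
  "i \<in> surviving M \<omega> \<longleftrightarrow>
     i 0 < M \<and> \<omega> [i 0] \<and> (\<lambda>n. i (Suc n)) \<in> surviving M (subtree M (i 0) \<omega>)"
proof -
  have split: "(\<forall>n. Q n) \<longleftrightarrow> Q 0 \<and> (\<forall>n. Q (Suc n))" for Q :: "nat \<Rightarrow> bool"
    by (metis not0_implies_Suc)
  have pre: "prefix_word i (Suc n) = i 0 # prefix_word (\<lambda>n. i (Suc n)) n" for n
    by (simp add: prefix_word_def map_upt_Suc del: upt_Suc)
  have symb: "i \<in> symb_space M \<longleftrightarrow> i 0 < M \<and> (\<lambda>n. i (Suc n)) \<in> symb_space M"
    unfolding symb_space_def Pi_def using split[of "\<lambda>n. i n < M"] by auto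
  have nw: "prefix_word j n \<in> nonempty_words M" if "j \<in> symb_space M" "1 \<le> n" for j n
    using that by (auto simp: nonempty_words_iff prefix_word_def symb_space_def)
  have "(\<forall>n\<ge>1. \<omega> (prefix_word i n)) \<longleftrightarrow> (\<forall>n. \<omega> (prefix_word i (Suc n)))"
    by (metis One_nat_def Suc_le_D Suc_le_mono le0)
  also have "\<dots> \<longleftrightarrow> \<omega> [i 0] \<and> (\<forall>n\<ge>1. \<omega> (i 0 # prefix_word (\<lambda>n. i (Suc n)) n))"
    unfolding pre
    by (subst split) (metis One_nat_def Suc_le_D Suc_le_mono le0 list.simps(8) prefix_word_def upt_0)
  finally show ?thesis
    unfolding surviving_def mem_Collect_eq symb
    by (auto simp: subtree_def nw)
qed

text \<open>The pigeonhole step of Koenig's lemma.\<close>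
lemma nested_finite_choice:
  fixes P :: "nat \<Rightarrow> nat \<Rightarrow> bool"
  assumes ex: "\<And>n. \<exists>l<M. P l n" and anti: "\<And>l m n. m \<le> n \<Longrightarrow> P l n \<Longrightarrow> P l m"
  shows "\<exists>l<M. \<forall>n. P l n"
proof (rule ccontr)
  assume "\<not> ?thesis"
  then obtain f where f: "\<And>l. l < M \<Longrightarrow> \<not> P l (f l)" by metis
  obtain l where l: "l < M" "P l (\<Sum>k<M. f k)" using ex by blast
  have "f l \<le> (\<Sum>k<M. f k)" using l(1) by (intro member_le_sum) auto
  then show False using anti l f by blast
qed

locale integer_ifs =
  fixes L :: nat and ts :: "nat list"
  assumes sys: "issifs L ts"
begin

abbreviation "M \<equiv> length ts"

lemma L2: "2 \<le> L" and Mpos: "0 < M"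
  using sys by (auto simp: issifs_def)

text \<open>The cell that the inverse of map \<open>l\<close> reaches from a point of cell \<open>b\<close> with first digit \<open>\<theta>\<close>.\<close>
definition cell_step :: "nat \<Rightarrow> int \<Rightarrow> nat \<Rightarrow> int" where
  "cell_step \<theta> b l = b * int L + int \<theta> - int (ts ! l)"

text \<open>Survival for \<open>length v\<close> generations of the branching process started in cell \<open>b\<close> in which every
  open letter moves the cell by \<open>cell_step\<close> and a cell outside \<open>A\<close> dies. For \<open>A = UNIV\<close> this is
  survival of the coin tossing tree itself.\<close>
primrec alive :: "int set \<Rightarrow> nat list \<Rightarrow> int \<Rightarrow> (nat list \<Rightarrow> bool) \<Rightarrow> bool" where
  "alive A [] b \<omega> = True"
| "alive A (\<theta> # v) b \<omega> = (\<exists>l<M. \<omega> [l] \<and> cell_step \<theta> b l \<in> A \<and>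
     alive A v (cell_step \<theta> b l) (subtree M l \<omega>))"

definition alive_prob :: "real \<Rightarrow> int set \<Rightarrow> nat list \<Rightarrow> int \<Rightarrow> real" where
  "alive_prob p A v b = measure (coin_space M p) {\<omega>\<in>space (coin_space M p). alive A v b \<omega>}"

lemma alive_append: "alive A (u @ v) b \<omega> \<Longrightarrow> alive A u b \<omega>"
  by (induction u arbitrary: b \<omega>) auto

lemma subtree_in_space: "\<omega> \<in> space (coin_space M p) \<Longrightarrow> subtree M l \<omega> \<in> space (coin_space M p)"
  by (auto simp: space_coin subtree_def)

lemma sets_alive: "{\<omega>\<in>space (coin_space M p). alive A v b \<omega>} \<in> sets (coin_space M p)"
proof (induction v arbitrary: b)
  case (Cons \<theta> v)
  have "{\<omega>\<in>space (coin_space M p). alive A (\<theta> # v) b \<omega>} =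
    (\<Union>l\<in>{l. l < M \<and> cell_step \<theta> b l \<in> A}. {\<omega>\<in>space (coin_space M p). \<omega> [l] \<and>
        subtree M l \<omega> \<in> {\<omega>\<in>space (coin_space M p). alive A v (cell_step \<theta> b l) \<omega>}})"
    by (auto simp: subtree_in_space)
  also have "\<dots> \<in> sets (coin_space M p)"
    using Cons by (intro sets.finite_UN sets_coin_branch) auto
  finally show ?case .
qed simp

lemma alive_prob_Nil [simp]: "alive_prob p A [] b = 1"
  using prob_space.prob_space[OF prob_space_coin] by (simp add: alive_prob_def)

lemma alive_prob_bounds: "0 \<le> alive_prob p A v b" "alive_prob p A v b \<le> 1"
  using prob_space.prob_le_1[OF prob_space_coin] by (auto simp: alive_prob_def)

text \<open>The children are independent, so the process dies iff all its branches do.\<close>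
lemma alive_prob_Cons:
  assumes "0 \<le> p" "p \<le> 1"
  shows "alive_prob p A (\<theta> # v) b = 1 - (\<Prod>l<M. 1 - p *
     (if cell_step \<theta> b l \<in> A then alive_prob p A v (cell_step \<theta> b l) else 0))"
proof -
  let ?C = "coin_space M p"
  interpret P: prob_space ?C by (rule prob_space_coin)
  define S where "S l = (if cell_step \<theta> b l \<in> A
     then {\<omega>\<in>space ?C. alive A v (cell_step \<theta> b l) \<omega>} else {})" for l
  have S: "S l \<in> sets ?C" for l
    using sets_alive by (auto simp: S_def)
  have "{\<omega>\<in>space ?C. alive A (\<theta> # v) b \<omega>} =
      space ?C - {\<omega>\<in>space ?C. \<forall>l<M. \<omega> [l] \<longrightarrow> subtree M l \<omega> \<notin> S l}"
    by (auto simp: S_def subtree_in_space split: if_splits)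
  moreover have "{\<omega>\<in>space ?C. \<forall>l<M. \<omega> [l] \<longrightarrow> subtree M l \<omega> \<notin> S l} =
      space ?C - (\<Union>l\<in>{..<M}. {\<omega>\<in>space ?C. \<omega> [l] \<and> subtree M l \<omega> \<in> S l})"
    by auto
  then have "{\<omega>\<in>space ?C. \<forall>l<M. \<omega> [l] \<longrightarrow> subtree M l \<omega> \<notin> S l} \<in> sets ?C"
    using S by (auto intro!: sets.Diff sets.finite_UN sets_coin_branch)
  ultimately have "alive_prob p A (\<theta> # v) b = 1 - (\<Prod>l<M. 1 - p * P.prob (S l))"
    unfolding alive_prob_def using coin_branching[OF assms Mpos S]
    by (simp only: P.prob_compl)
  also have "(\<lambda>l. P.prob (S l)) =
      (\<lambda>l. if cell_step \<theta> b l \<in> A then alive_prob p A v (cell_step \<theta> b l) else 0)"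
    by (auto simp: S_def alive_prob_def)
  finally show ?thesis .
qed

primrec cell_orbit :: "(nat \<Rightarrow> nat) \<Rightarrow> (nat \<Rightarrow> nat) \<Rightarrow> int \<Rightarrow> nat \<Rightarrow> int" where
  "cell_orbit \<theta> i b 0 = b"
| "cell_orbit \<theta> i b (Suc n) = cell_step (\<theta> n) (cell_orbit \<theta> i b n) (i n)"

lemma cell_orbit_shift:
  "cell_orbit \<theta> i b (Suc n) =
     cell_orbit (\<lambda>n. \<theta> (Suc n)) (\<lambda>n. i (Suc n)) (cell_step (\<theta> 0) b (i 0)) n"
  by (induction n) auto

lemma alive_if_path:
  assumes "i \<in> surviving M \<omega>" "\<And>n. cell_orbit \<theta> i b (Suc n) \<in> A"
  shows "alive A (map \<theta> [0..<n]) b \<omega>"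
  using assms
proof (induction n arbitrary: \<theta> i b \<omega>)
  case (Suc n)
  have "alive A (map (\<lambda>n. \<theta> (Suc n)) [0..<n]) (cell_step (\<theta> 0) b (i 0)) (subtree M (i 0) \<omega>)"
    using Suc.prems surviving_Cons[of i M \<omega>]
    by (intro Suc.IH[of "\<lambda>n. i (Suc n)"]) (auto simp: cell_orbit_shift[symmetric] simp del: cell_orbit.simps)
  then show ?case
    using Suc.prems(1) Suc.prems(2)[of 0] surviving_Cons[of i M \<omega>]
    by (auto simp: map_upt_Suc simp del: upt_Suc)
qed simp

lemma alive_branch:
  assumes "\<And>n. alive A (map \<theta> [0..<n]) b \<omega>"
  shows "\<exists>l<M. \<omega> [l] \<and> cell_step (\<theta> 0) b l \<in> A \<and>
    (\<forall>n. alive A (map (\<lambda>n. \<theta> (Suc n)) [0..<n]) (cell_step (\<theta> 0) b l) (subtree M l \<omega>))"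
proof -
  let ?P = "\<lambda>l n. \<omega> [l] \<and> cell_step (\<theta> 0) b l \<in> A \<and>
    alive A (map (\<lambda>n. \<theta> (Suc n)) [0..<n]) (cell_step (\<theta> 0) b l) (subtree M l \<omega>)"
  have "\<exists>l<M. \<forall>n. ?P l n"
  proof (rule nested_finite_choice)
    fix n show "\<exists>l<M. ?P l n"
      using assms[of "Suc n"] by (auto simp: map_upt_Suc simp del: upt_Suc)
  next
    fix l m n :: nat assume "m \<le> n" "?P l n"
    moreover obtain k where "n = m + k" using \<open>m \<le> n\<close> by (metis le_Suc_ex)
    then have "map f [0..<n] = map f [0..<m] @ map f [m..<n]" for f :: "nat \<Rightarrow> nat"
      using upt_add_eq_append[of 0 m k] by simp
    ultimately show "?P l m"
      using alive_append by metis
  qed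
  then show ?thesis by blast
qed

text \<open>Koenig's lemma: choosing at each step a letter whose subtree survives all finite times gives an
  infinite path.\<close>
lemma path_if_alive:
  assumes "\<And>n. alive A (map \<theta> [0..<n]) b \<omega>"
  shows "\<exists>i\<in>surviving M \<omega>. \<forall>n. cell_orbit \<theta> i b (Suc n) \<in> A"
proof -
  define live where "live k x \<longleftrightarrow>
     (\<forall>n. alive A (map (\<lambda>n. \<theta> (n + k)) [0..<n]) (fst x) (snd x))" for k x
  define R where "R k x l y \<longleftrightarrow> l < M \<and> snd x [l] \<and> fst y \<in> A \<and>
     fst y = cell_step (\<theta> k) (fst x) l \<and> snd y = subtree M l (snd x)" for k x l y
  \<comment> \<open>A state is a cell and the tree seen from there; the letter leading to the next state is
    chosen afterwards.\<close>
  have "\<exists>f. \<forall>n. (live n (f n) \<and> (n = 0 \<longrightarrow> f n = (b, \<omega>))) \<and> (\<exists>l. R n (f n) l (f (Suc n)))"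
  proof (rule dependent_nat_choice)
    show "\<exists>x. live 0 x \<and> (0 = (0::nat) \<longrightarrow> x = (b, \<omega>))"
      using assms by (auto simp: live_def)
  next
    fix x n assume "live n x \<and> (n = 0 \<longrightarrow> x = (b, \<omega>))"
    then obtain l where "l < M" "snd x [l]" "cell_step (\<theta> n) (fst x) l \<in> A"
      "\<And>m. alive A (map (\<lambda>m. \<theta> (Suc m + n)) [0..<m]) (cell_step (\<theta> n) (fst x) l) (subtree M l (snd x))"
      using alive_branch[of A "\<lambda>m. \<theta> (m + n)" "fst x" "snd x"] by (auto simp: live_def)
    then show "\<exists>y. (live (Suc n) y \<and> (Suc n = 0 \<longrightarrow> y = (b, \<omega>))) \<and> (\<exists>l. R n x l y)"
      by (intro exI[of _ "(cell_step (\<theta> n) (fst x) l, subtree M l (snd x))"])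
        (auto simp: live_def R_def)
  qed
  then obtain f where f: "f 0 = (b, \<omega>)" "\<And>n. \<exists>l. R n (f n) l (f (Suc n))"
    by metis
  then obtain i where i: "\<And>n. R n (f n) (i n) (f (Suc n))" by metis
  have iM: "i \<in> symb_space M" using i by (auto simp: R_def symb_space_def)
  have W: "snd (f k) (map i [k..<Suc k + n])" for k n
  proof (induction n arbitrary: k)
    case 0 show ?case using i[of k] by (simp add: R_def)
  next
    case (Suc n)
    have *: "[k..<Suc k + Suc n] = k # [Suc k..<Suc (Suc k) + n]" by (rule upt_conv_Cons[THEN trans]) simp_all
    have "map i [Suc k..<Suc (Suc k) + n] \<in> nonempty_words M"
      using iM by (auto simp: nonempty_words_iff symb_space_def)
    then show ?case
      using Suc[of "Suc k"] i[of k] unfolding * by (auto simp: R_def subtree_def)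
  qed
  have "i \<in> surviving M \<omega>"
    unfolding surviving_def
  proof (intro CollectI conjI allI impI iM)
    fix n :: nat assume "1 \<le> n"
    then obtain m where "n = Suc m" by (metis Suc_le_D One_nat_def)
    then show "\<omega> (prefix_word i n)" using W[of 0 m] f(1) by (simp add: prefix_word_def)
  qed
  moreover have "cell_orbit \<theta> i b n = fst (f n)" for n
  proof (induction n)
    case (Suc n)
    then show ?case using i[of n] by (simp add: R_def)
  qed (simp add: f(1))
  then have "cell_orbit \<theta> i b (Suc n) \<in> A" for n
    using i[of n] by (auto simp: R_def simp del: cell_orbit.simps)
  ultimately show ?thesis by blast
qed

text \<open>Since every cell is admitted, any environment and starting cell would serve.\<close>
lemma surviving_nonempty_iff:
  "surviving M \<omega> \<noteq> {} \<longleftrightarrow> (\<forall>n. alive UNIV (replicate n 0) 0 \<omega>)"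
proof
  assume "surviving M \<omega> \<noteq> {}"
  then obtain i where "i \<in> surviving M \<omega>" by blast
  from alive_if_path[OF this, of "\<lambda>_. 0" 0 UNIV]
  show "\<forall>n. alive UNIV (replicate n 0) 0 \<omega>" by (simp add: map_replicate_const)
next
  assume "\<forall>n. alive UNIV (replicate n 0) 0 \<omega>"
  then show "surviving M \<omega> \<noteq> {}"
    using path_if_alive[of UNIV "\<lambda>_. 0" 0 \<omega>] by (auto simp: map_replicate_const)
qed

lemma sets_surviving: "{\<omega>\<in>space (coin_space M p). surviving M \<omega> \<noteq> {}} \<in> sets (coin_space M p)"
proof -
  have "{\<omega>\<in>space (coin_space M p). surviving M \<omega> \<noteq> {}} =
    (\<Inter>n. {\<omega>\<in>space (coin_space M p). alive UNIV (replicate n 0) 0 \<omega>})"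
    by (auto simp: surviving_nonempty_iff)
  then show ?thesis using sets_alive by auto
qed

lemma surviving_branch:
  "surviving M \<omega> = (\<Union>l\<in>{l. l < M \<and> \<omega> [l]}. case_nat l ` surviving M (subtree M l \<omega>))"
proof (intro equalityI subsetI)
  fix i assume "i \<in> surviving M \<omega>"
  moreover have "i = case_nat (i 0) (\<lambda>n. i (Suc n))" by (auto split: nat.split)
  ultimately show "i \<in> (\<Union>l\<in>{l. l < M \<and> \<omega> [l]}. case_nat l ` surviving M (subtree M l \<omega>))"
    using surviving_Cons[of i M \<omega>] by blast
next
  fix i assume "i \<in> (\<Union>l\<in>{l. l < M \<and> \<omega> [l]}. case_nat l ` surviving M (subtree M l \<omega>))"
  then obtain l j where "l < M" "\<omega> [l]" "j \<in> surviving M (subtree M l \<omega>)" "i = case_nat l j"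
    by blast
  then show "i \<in> surviving M \<omega>"
    using surviving_Cons[of i M \<omega>] by simp
qed

end

section \<open>Averages over words\<close>

lemma finite_words: "finite (words K n)"
proof -
  have "words K n = {w. set w \<subseteq> {..<K} \<and> length w = n}" by (auto simp: words_def)
  then show ?thesis using finite_lists_length_eq[of "{..<K}" n] by simp
qed

lemma card_words: "card (words K n) = K ^ n"
proof -
  have "words K n = {w. set w \<subseteq> {..<K} \<and> length w = n}" by (auto simp: words_def)
  then show ?thesis using card_lists_length_eq[of "{..<K}" n] by simp
qed

lemma words_append_bij: "bij_betw (\<lambda>(u, v). u @ v) (words K m \<times> words K n) (words K (m + n))"
proof (rule bij_betw_byWitness[where f' = "\<lambda>w. (take m w, drop m w)"])
  show "(\<lambda>w. (take m w, drop m w)) ` words K (m + n) \<subseteq> words K m \<times> words K n"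
    by (auto simp: words_def dest: in_set_takeD in_set_dropD)
qed (auto simp: words_def)

lemma sum_words_append:
  "(\<Sum>w\<in>words K (m + n). f w) = (\<Sum>u\<in>words K m. \<Sum>v\<in>words K n. f (u @ v))"
  by (subst sum.reindex_bij_betw[OF words_append_bij, symmetric])
    (simp add: sum.cartesian_product split_def)

lemma words_0: "words K 0 = {[]}"
  by (auto simp: words_def)

definition word_avg :: "nat \<Rightarrow> nat \<Rightarrow> (nat list \<Rightarrow> real) \<Rightarrow> real" where
  "word_avg K n f = (\<Sum>w\<in>words K n. f w) / real K ^ n"

lemma word_avg_append:
  "word_avg K (m + n) f = word_avg K m (\<lambda>u. word_avg K n (\<lambda>v. f (u @ v)))"
  by (simp add: word_avg_def sum_words_append power_add sum_divide_distrib mult.commute)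

lemma word_avg_mono:
  "(\<And>w. w \<in> words K n \<Longrightarrow> f w \<le> g w) \<Longrightarrow> word_avg K n f \<le> word_avg K n g"
  by (auto simp: word_avg_def intro!: divide_right_mono sum_mono)

lemma word_avg_cong:
  "(\<And>w. w \<in> words K n \<Longrightarrow> f w = g w) \<Longrightarrow> word_avg K n f = word_avg K n g"
  by (auto simp: word_avg_def intro!: sum.cong arg_cong2[where f = divide])

lemma word_avg_const: "0 < K \<Longrightarrow> word_avg K n (\<lambda>_. c) = c"
  by (simp add: word_avg_def card_words)

lemma word_avg_add: "word_avg K n (\<lambda>w. f w + g w) = word_avg K n f + word_avg K n g"
  by (simp add: word_avg_def sum.distrib add_divide_distrib)

lemma word_avg_diff: "word_avg K n (\<lambda>w. f w - g w) = word_avg K n f - word_avg K n g"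
  by (simp add: word_avg_def sum_subtractf diff_divide_distrib)

lemma word_avg_cmult: "word_avg K n (\<lambda>w. c * f w) = c * word_avg K n f"
  by (simp add: word_avg_def sum_distrib_left)

context integer_ifs
begin

section \<open>Transfer operators\<close>

text \<open>The action of the matrix for \<open>\<theta>\<close> on functions of the cell, for the cells in \<open>A\<close>. Working with
  operators keeps the algebra free of matrix dimensions.\<close>
definition transfer :: "int set \<Rightarrow> nat \<Rightarrow> (int \<Rightarrow> real) \<Rightarrow> int \<Rightarrow> real" where
  "transfer A \<theta> f b = (\<Sum>l<M. if cell_step \<theta> b l \<in> A then f (cell_step \<theta> b l) else 0)"

primrec transfers :: "int set \<Rightarrow> nat list \<Rightarrow> (int \<Rightarrow> real) \<Rightarrow> int \<Rightarrow> real" where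
  "transfers A [] f = f"
| "transfers A (\<theta> # v) f = transfer A \<theta> (transfers A v f)"

text \<open>With the basic cells as \<open>A\<close>, these are the row sums of the matrix product along \<open>v\<close>,
  the sum of its entries, and its smallest row sum.\<close>
definition paths :: "int set \<Rightarrow> nat list \<Rightarrow> int \<Rightarrow> real" where
  "paths A v b = transfers A v (\<lambda>_. 1) b"

definition total_paths :: "int set \<Rightarrow> nat list \<Rightarrow> real" where
  "total_paths A v = (\<Sum>b\<in>A. paths A v b)"

definition min_paths :: "int set \<Rightarrow> nat list \<Rightarrow> real" where
  "min_paths A v = Min (paths A v ` A)"

lemma transfer_mono:
  "(\<And>k. k \<in> A \<Longrightarrow> f k \<le> g k) \<Longrightarrow> transfer A \<theta> f b \<le> transfer A \<theta> g b"
  unfolding transfer_def by (intro sum_mono) auto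

lemma transfers_mono:
  assumes "\<And>k. k \<in> A \<Longrightarrow> f k \<le> g k"
  shows "b \<in> A \<Longrightarrow> transfers A v f b \<le> transfers A v g b"
  using assms by (induction v arbitrary: b) (auto intro: transfer_mono)

lemma transfers_cmult: "transfers A v (\<lambda>k. c * f k) = (\<lambda>b. c * transfers A v f b)"
  by (induction v) (auto simp: transfer_def sum_distrib_left fun_eq_iff intro!: sum.cong)

lemma transfers_append: "transfers A (u @ v) f = transfers A u (transfers A v f)"
  by (induction u) auto

lemma paths_append: "paths A (u @ v) b = transfers A u (paths A v) b"
  by (simp add: paths_def[abs_def] transfers_append)

lemma paths_Nil [simp]: "paths A [] b = 1"
  by (simp add: paths_def)

lemma paths_Cons: "paths A (\<theta> # v) b = transfer A \<theta> (paths A v) b"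
  by (simp add: paths_def[abs_def])

lemma paths_nonneg: "0 \<le> paths A v b"
  by (induction v arbitrary: b) (auto simp: paths_Cons transfer_def intro!: sum_nonneg)

lemma transfers_const: "transfers A u (\<lambda>_. c) b = c * paths A u b"
  using transfers_cmult[of A u c "\<lambda>_. 1"] by (simp add: paths_def)

lemma paths_append_le:
  assumes "b \<in> A" "\<And>k. k \<in> A \<Longrightarrow> paths A v k \<le> c"
  shows "paths A (u @ v) b \<le> c * paths A u b"
  unfolding paths_append transfers_const[symmetric]
  using assms by (intro transfers_mono) auto

lemma paths_append_ge:
  assumes "b \<in> A" "\<And>k. k \<in> A \<Longrightarrow> c \<le> paths A v k"
  shows "c * paths A u b \<le> paths A (u @ v) b"
  unfolding paths_append transfers_const[symmetric]
  using assms by (intro transfers_mono) auto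

lemma paths_le: "paths A v b \<le> real M ^ length v"
proof (induction v arbitrary: b)
  case (Cons \<theta> v)
  have "paths A (\<theta> # v) b \<le> (\<Sum>l<M. real M ^ length v)"
    unfolding paths_Cons transfer_def using Cons by (intro sum_mono) auto
  then show ?case by simp
qed simp

end

text \<open>The consequences of goodness that the proof uses. The last assumption says that all entries of the
  product along \<open>w0\<close> are at least 1, which for integer matrices is strict positivity.\<close>
locale positive_ifs = integer_ifs +
  fixes A :: "int set" and w0 :: "nat list"
  assumes finite_A: "finite A" and A_ne: "A \<noteq> {}"
    and row_pos: "\<And>\<theta> b. \<theta> < L \<Longrightarrow> b \<in> A \<Longrightarrow> 1 \<le> paths A [\<theta>] b"
    and w0_word: "set w0 \<subseteq> {..<L}" "w0 \<noteq> []"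
    and w0_pos: "\<And>f b. b \<in> A \<Longrightarrow> (\<And>k. k \<in> A \<Longrightarrow> 0 \<le> f k) \<Longrightarrow> sum f A \<le> transfers A w0 f b"
begin

lemma Lpos: "0 < L"
  using L2 by simp

lemma paths_ge_1:
  assumes "set v \<subseteq> {..<L}" "b \<in> A"
  shows "1 \<le> paths A v b"
  using assms
proof (induction v arbitrary: b)
  case (Cons \<theta> v)
  have "1 * paths A [\<theta>] b \<le> paths A ([\<theta>] @ v) b"
    using Cons by (intro paths_append_ge) auto
  then show ?case using row_pos[of \<theta> b] Cons.prems by simp
qed simp

lemma paths_le_total: "b \<in> A \<Longrightarrow> paths A v b \<le> total_paths A v"
  unfolding total_paths_def using finite_A paths_nonneg by (intro member_le_sum) auto

lemma min_paths_le: "b \<in> A \<Longrightarrow> min_paths A v \<le> paths A v b"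
  unfolding min_paths_def using finite_A by (intro Min_le) auto

lemma min_paths_greatest: "(\<And>b. b \<in> A \<Longrightarrow> c \<le> paths A v b) \<Longrightarrow> c \<le> min_paths A v"
  unfolding min_paths_def using finite_A A_ne by (subst Min_ge_iff) auto

lemma min_paths_ge_1: "set v \<subseteq> {..<L} \<Longrightarrow> 1 \<le> min_paths A v"
  by (intro min_paths_greatest paths_ge_1)

lemma min_le_total: "min_paths A v \<le> total_paths A v"
proof -
  obtain b where "b \<in> A" using A_ne by blast
  then show ?thesis using min_paths_le paths_le_total by (meson order_trans)
qed

lemma total_ge_1: "set v \<subseteq> {..<L} \<Longrightarrow> 1 \<le> total_paths A v"
  using min_le_total min_paths_ge_1 by (meson order_trans)

lemma total_le: "total_paths A v \<le> real (card A) * real M ^ length v"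
  unfolding total_paths_def using sum_mono[of A "paths A v" "\<lambda>_. real M ^ length v"] paths_le
  by simp

lemma total_append: "total_paths A (u @ v) \<le> total_paths A u * total_paths A v"
proof -
  have "total_paths A (u @ v) \<le> (\<Sum>b\<in>A. total_paths A v * paths A u b)"
    unfolding total_paths_def[of A "u @ v"]
    by (intro sum_mono paths_append_le paths_le_total)
  then show ?thesis
    by (simp only: sum_distrib_left[symmetric] total_paths_def[of A u] mult.commute)
qed

lemma min_append:
  assumes "set v \<subseteq> {..<L}"
  shows "min_paths A u * min_paths A v \<le> min_paths A (u @ v)"
proof (rule min_paths_greatest)
  fix b assume b: "b \<in> A"
  have "min_paths A u * min_paths A v \<le> min_paths A v * paths A u b"
    using min_paths_ge_1[OF assms] min_paths_le[OF b] by (simp add: mult.commute mult_left_mono)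
  also have "\<dots> \<le> paths A (u @ v) b"
    using b by (intro paths_append_ge min_paths_le)
  finally show "min_paths A u * min_paths A v \<le> paths A (u @ v) b" .
qed

text \<open>After a positive word every row sum dominates the sum of all entries of what follows. This is
  how the submultiplicative and the supermultiplicative quantity are compared.\<close>
lemma min_w0_append: "total_paths A v \<le> min_paths A (w0 @ v)"
  unfolding total_paths_def
  by (intro min_paths_greatest) (auto simp: paths_append intro: w0_pos paths_nonneg)

definition avg_total :: "nat \<Rightarrow> real" where
  "avg_total n = word_avg L n (\<lambda>v. ln (total_paths A v))"

definition avg_min :: "nat \<Rightarrow> real" where
  "avg_min n = word_avg L n (\<lambda>v. ln (min_paths A v))"

lemma word_set: "v \<in> words L n \<Longrightarrow> set v \<subseteq> {..<L}"
  by (simp add: words_def)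

lemma word_total_pos: "v \<in> words L n \<Longrightarrow> 0 < total_paths A v"
  using total_ge_1[OF word_set, of v n] by simp

lemma word_min_pos: "v \<in> words L n \<Longrightarrow> 0 < min_paths A v"
  using min_paths_ge_1[OF word_set, of v n] by simp

lemma words_append: "u \<in> words K m \<Longrightarrow> v \<in> words K n \<Longrightarrow> u @ v \<in> words K (m + n)"
  by (simp add: words_def)

lemma avg_total_add: "avg_total (m + n) \<le> avg_total m + avg_total n"
proof -
  have "avg_total (m + n) \<le>
      word_avg L m (\<lambda>u. word_avg L n (\<lambda>v. ln (total_paths A u) + ln (total_paths A v)))"
    unfolding avg_total_def word_avg_append
  proof (intro word_avg_mono)
    fix u v assume uv: "u \<in> words L m" "v \<in> words L n"
    have "ln (total_paths A (u @ v)) \<le> ln (total_paths A u * total_paths A v)"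
      using total_append word_total_pos[OF words_append[OF uv]] by (intro ln_mono) auto
    then show "ln (total_paths A (u @ v)) \<le> ln (total_paths A u) + ln (total_paths A v)"
      using word_total_pos[OF uv(1)] word_total_pos[OF uv(2)] by (simp add: ln_mult_pos)
  qed
  then show ?thesis
    using Lpos by (simp add: word_avg_add word_avg_const avg_total_def)
qed

lemma avg_min_add: "avg_min m + avg_min n \<le> avg_min (m + n)"
proof -
  have "word_avg L m (\<lambda>u. word_avg L n (\<lambda>v. ln (min_paths A u) + ln (min_paths A v)))
     \<le> avg_min (m + n)"
    unfolding avg_min_def word_avg_append
  proof (intro word_avg_mono)
    fix u v assume uv: "u \<in> words L m" "v \<in> words L n"
    have "ln (min_paths A u * min_paths A v) \<le> ln (min_paths A (u @ v))"
      using min_append[OF word_set] uv word_min_pos by (intro ln_mono mult_pos_pos) auto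
    then show "ln (min_paths A u) + ln (min_paths A v) \<le> ln (min_paths A (u @ v))"
      using word_min_pos[OF uv(1)] word_min_pos[OF uv(2)] by (simp add: ln_mult_pos)
  qed
  then show ?thesis
    using Lpos by (simp add: word_avg_add word_avg_const avg_min_def)
qed

lemma avg_min_le_total: "avg_min n \<le> avg_total n"
  unfolding avg_min_def avg_total_def
  by (intro word_avg_mono ln_mono min_le_total word_min_pos)

lemma avg_total_mult: "1 \<le> k \<Longrightarrow> avg_total (k * n) \<le> real k * avg_total n"
proof (induction k rule: nat_induct_at_least)
  case (Suc k)
  then show ?case using avg_total_add[of n "k * n"] by (simp add: algebra_simps)
qed simp

lemma avg_min_mult: "1 \<le> k \<Longrightarrow> real k * avg_min n \<le> avg_min (k * n)"
proof (induction k rule: nat_induct_at_least)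
  case (Suc k)
  then show ?case using avg_min_add[of n "k * n"] by (simp add: algebra_simps)
qed simp

text \<open>Read the word in blocks of the length \<open>r\<close> of \<open>w0\<close>. A block costs at most \<open>\<kappa>\<close> in the gap between the
  two logarithms, and the gap is closed once a block equals \<open>w0\<close>, which happens with
  probability \<open>1 / L^r\<close>. The mean gap therefore satisfies
  \<open>gap (r + k) \<le> \<kappa> + (1 - 1 / L^r) * gap k\<close> and stays below the fixed point \<open>\<kappa> * L^r\<close>.\<close>
lemma exists_gap_bound: "\<exists>C. \<forall>n. avg_total n \<le> avg_min n + C"
proof -
  define r where "r = length w0"
  have r: "0 < r" using w0_word by (simp add: r_def)
  define \<kappa> where "\<kappa> = ln (real (card A) * real M ^ r)"
  have cA: "0 < card A" using finite_A A_ne by (simp add: card_gt_0_iff)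
  have "ln (total_paths A u) \<le> \<kappa>" if "u \<in> words L n" "n \<le> r" for u n
  proof -
    have "total_paths A u \<le> real (card A) * real M ^ length u" by (rule total_le)
    also have "\<dots> \<le> real (card A) * real M ^ r"
      using that Mpos by (intro mult_left_mono power_increasing) (auto simp: words_def Suc_le_eq)
    finally show ?thesis unfolding \<kappa>_def using word_total_pos[OF that(1)] by (intro ln_mono) auto
  qed
  note \<kappa> = this
  have "1 \<le> real (card A) * real M ^ r"
    using cA Mpos mult_mono[of 1 "real (card A)" 1 "real M ^ r"] by (simp add: Suc_le_eq)
  then have \<kappa>0: "0 \<le> \<kappa>" by (simp add: \<kappa>_def)
  define gap where "gap v = ln (total_paths A v) - ln (min_paths A v)" for v
  have gap0: "0 \<le> gap v" if "v \<in> words L n" for v n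
    using min_le_total word_min_pos[OF that] by (auto simp: gap_def intro!: ln_mono)
  have w0: "w0 \<in> words L r" using w0_word by (simp add: r_def words_def)
  have "word_avg L n gap \<le> \<kappa> * real L ^ r" for n
  proof (induction n rule: less_induct)
    case (less n)
    have one: "1 \<le> real L ^ r" using Lpos by simp
    show ?case
    proof (cases "n < r")
      case True
      have "word_avg L n gap \<le> word_avg L n (\<lambda>_. \<kappa>)"
      proof (rule word_avg_mono)
        fix v assume v: "v \<in> words L n"
        have "0 \<le> ln (min_paths A v)" using min_paths_ge_1[OF word_set[OF v]] by simp
        then show "gap v \<le> \<kappa>" using \<kappa>[OF v] True by (simp add: gap_def)
      qed
      also have "\<dots> = \<kappa>" using Lpos by (simp add: word_avg_const)
      also have "\<dots> \<le> \<kappa> * real L ^ r" using \<kappa>0 one by (metis mult_left_mono mult.right_neutral)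
      finally show ?thesis .
    next
      case False
      then obtain k where k: "n = r + k" by (metis le_Suc_ex not_less)
      define G where "G = word_avg L k gap"
      have G: "G \<le> \<kappa> * real L ^ r" unfolding G_def using less k r by simp
      have "word_avg L n gap \<le>
          word_avg L r (\<lambda>u. word_avg L k (\<lambda>v. \<kappa> + (if u = w0 then 0 else gap v)))"
        unfolding k word_avg_append
      proof (intro word_avg_mono)
        fix u v assume uv: "u \<in> words L r" "v \<in> words L k"
        have "ln (total_paths A (u @ v)) \<le> ln (total_paths A u * total_paths A v)"
          using total_append word_total_pos[OF words_append[OF uv]] by (intro ln_mono) auto
        then have 1: "ln (total_paths A (u @ v)) \<le> \<kappa> + ln (total_paths A v)"
          using \<kappa>[OF uv(1)] word_total_pos[OF uv(1)] word_total_pos[OF uv(2)] by (simp add: ln_mult_pos)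
        have "ln (total_paths A v) \<le> ln (min_paths A (u @ v))" if "u = w0"
          using that min_w0_append word_total_pos[OF uv(2)] by (intro ln_mono) auto
        moreover have "ln (min_paths A v) \<le> ln (min_paths A (u @ v))"
        proof (rule ln_mono)
          have "1 * min_paths A v \<le> min_paths A u * min_paths A v"
            using min_paths_ge_1[OF word_set[OF uv(1)]] word_min_pos[OF uv(2)]
            by (intro mult_right_mono) auto
          also have "\<dots> \<le> min_paths A (u @ v)" by (rule min_append[OF word_set[OF uv(2)]])
          finally show "min_paths A v \<le> min_paths A (u @ v)" by simp
        qed (rule word_min_pos[OF uv(2)])
        ultimately show "gap (u @ v) \<le> \<kappa> + (if u = w0 then 0 else gap v)"
          using 1 by (auto simp: gap_def)
      qed
      also have "\<dots> = word_avg L r (\<lambda>u. \<kappa> + (if u = w0 then 0 else G))"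
        using Lpos by (intro word_avg_cong) (auto simp: word_avg_add word_avg_const G_def)
      also have "\<dots> = \<kappa> + word_avg L r (\<lambda>u. G - (if u = w0 then G else 0))"
        using Lpos by (auto simp: word_avg_add word_avg_const intro!: word_avg_cong)
      also have "\<dots> = \<kappa> + (G - G / real L ^ r)"
        using Lpos w0 finite_words[of L r]
        by (subst word_avg_diff) (simp add: word_avg_const, simp add: word_avg_def)
      also have "\<dots> = \<kappa> + G * (1 - 1 / real L ^ r)"
        by (simp add: algebra_simps)
      also have "\<dots> \<le> \<kappa> + \<kappa> * real L ^ r * (1 - 1 / real L ^ r)"
        using G one by (intro add_left_mono mult_right_mono) (auto simp: divide_le_eq_1)
      also have "\<dots> = \<kappa> * real L ^ r"
        using Lpos by (simp add: algebra_simps)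
      finally show ?thesis .
    qed
  qed
  then have "avg_total n \<le> avg_min n + \<kappa> * real L ^ r" for n
    unfolding gap_def word_avg_diff avg_total_def avg_min_def by (simp add: algebra_simps)
  then show ?thesis by blast
qed

text \<open>The infimum is the limit of the averages, by \<open>lyapunov_le\<close> and \<open>avg_total_upper\<close>.\<close>
definition lyapunov :: real where
  "lyapunov = Inf ((\<lambda>n. avg_total n / real n) ` {1..})"

lemma avg_total_nonneg: "0 \<le> avg_total n"
proof -
  have "word_avg L n (\<lambda>_. 0) \<le> avg_total n"
    unfolding avg_total_def using total_ge_1 word_set by (intro word_avg_mono) auto
  then show ?thesis using Lpos by (simp add: word_avg_const)
qed

lemma lyapunov_le: "lyapunov * real n \<le> avg_total n"
proof (cases "n = 0")
  case False
  have "bdd_below ((\<lambda>n. avg_total n / real n) ` {1..})"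
    using avg_total_nonneg by (intro bdd_belowI[of _ 0]) auto
  then have "lyapunov \<le> avg_total n / real n"
    unfolding lyapunov_def using False by (intro cInf_lower) auto
  then show ?thesis using False by (simp add: field_simps)
qed (simp add: avg_total_nonneg)

text \<open>Superadditive averages at \<open>n\<close> and subadditive ones at \<open>j\<close> are compared at the common multiple \<open>n * j\<close>.\<close>
lemma lyapunov_ge_min: "avg_min n \<le> lyapunov * real n" if "1 \<le> n"
proof -
  have "avg_min n / real n \<le> lyapunov"
    unfolding lyapunov_def
  proof (rule cInf_greatest)
    fix x assume "x \<in> (\<lambda>n. avg_total n / real n) ` {1..}"
    then obtain j where j: "1 \<le> j" "x = avg_total j / real j" by auto
    have "real j * avg_min n \<le> avg_min (j * n)" by (rule avg_min_mult[OF j(1)])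
    also have "\<dots> \<le> avg_total (n * j)" using avg_min_le_total by (simp add: mult.commute)
    also have "\<dots> \<le> real n * avg_total j" by (rule avg_total_mult[OF that])
    finally have "avg_min n * real j \<le> avg_total j * real n" by (simp only: mult.commute)
    then show "avg_min n / real n \<le> x" using j that by (simp add: divide_le_eq le_divide_eq)
  qed auto
  then show ?thesis using that by (simp add: field_simps)
qed

lemma avg_total_upper: "\<exists>C. \<forall>n\<ge>1. avg_total n \<le> lyapunov * real n + C"
proof -
  obtain C where "\<And>n. avg_total n \<le> avg_min n + C" using exists_gap_bound by blast
  then have "avg_total n \<le> lyapunov * real n + C" if "1 \<le> n" for n
    using lyapunov_ge_min[OF that] by (meson add_right_mono order_trans)
  then show ?thesis by blast
qed

lemma avg_min_lower: "\<exists>C. \<forall>n. lyapunov * real n - C \<le> avg_min n"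
proof -
  obtain C where C: "\<And>n. avg_total n \<le> avg_min n + C" using exists_gap_bound by blast
  have "lyapunov * real n - C \<le> avg_min n" for n
    using C[of n] lyapunov_le[of n] by linarith
  then show ?thesis by blast
qed

end

section \<open>Survival probabilities along a fibre\<close>

lemma one_minus_prod_le_sum:
  fixes x :: "nat \<Rightarrow> real"
  assumes "\<And>l. l < n \<Longrightarrow> 0 \<le> x l" "\<And>l. l < n \<Longrightarrow> x l \<le> 1"
  shows "1 - (\<Prod>l<n. 1 - x l) \<le> (\<Sum>l<n. x l)"
  using assms
proof (induction n)
  case (Suc n)
  define P where "P = (\<Prod>l<n. 1 - x l)"
  have "0 \<le> P" "P \<le> 1" unfolding P_def using Suc.prems by (auto intro!: prod_nonneg prod_le_1)
  moreover have "x n * P \<le> x n * 1"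
    using Suc.prems \<open>P \<le> 1\<close> by (intro mult_left_mono) auto
  moreover have "1 - P \<le> (\<Sum>l<n. x l)" unfolding P_def using Suc by simp
  moreover have "(\<Prod>l<Suc n. 1 - x l) = P - x n * P" by (simp add: P_def algebra_simps)
  ultimately show ?case by simp
qed simp

lemma one_minus_prod_ge:
  fixes x :: "nat \<Rightarrow> real"
  assumes "\<And>l. l < n \<Longrightarrow> x l \<le> 1" "0 \<le> s" "s \<le> (\<Sum>l<n. x l)"
  shows "s / (1 + s) \<le> 1 - (\<Prod>l<n. 1 - x l)"
proof -
  have "(\<Prod>l<n. 1 - x l) \<le> (\<Prod>l<n. exp (- x l))"
    using assms(1) exp_ge_add_one_self[of "- x l" for l] by (intro prod_mono) auto
  also have "\<dots> = exp (- (\<Sum>l<n. x l))"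
    by (simp add: exp_sum[symmetric] sum_negf)
  also have "\<dots> \<le> exp (- s)" using assms by simp
  also have "\<dots> \<le> 1 / (1 + s)"
    using exp_ge_add_one_self[of s] assms(2) by (simp add: exp_minus field_simps)
  finally have "(\<Prod>l<n. 1 - x l) \<le> 1 / (1 + s)" .
  moreover have "s / (1 + s) = 1 - 1 / (1 + s)" using assms(2) by (simp add: field_simps)
  ultimately show ?thesis by simp
qed

text \<open>For \<open>z\<close> in \<open>[0, 1]\<close> one has \<open>z \<le> z powr s\<close>; apply this to the two shares of \<open>x + y\<close>.\<close>
lemma powr_add_le:
  fixes x y s :: real
  assumes "0 < x" "0 \<le> y" "0 < s" "s \<le> 1"
  shows "(x + y) powr s \<le> x powr s + y powr s"
proof -
  have le: "z * (x + y) powr s \<le> (z * (x + y)) powr s" if "0 \<le> z" "z \<le> 1" for z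
  proof (cases "z = 0")
    case False
    have "z powr 1 \<le> z powr s"
      using that False assms by (intro powr_mono') auto
    then show ?thesis using that assms by (simp add: powr_mult mult_right_mono)
  qed simp
  have "x / (x + y) + y / (x + y) = 1"
    using assms by (simp add: add_divide_distrib[symmetric])
  then have "(x + y) powr s = x / (x + y) * (x + y) powr s + y / (x + y) * (x + y) powr s"
    by (metis distrib_right mult_1)
  also have "\<dots> \<le> (x / (x + y) * (x + y)) powr s + (y / (x + y) * (x + y)) powr s"
    using assms by (intro add_mono le) auto
  finally show ?thesis using assms by simp
qed

context integer_ifs
begin

text \<open>First moment bound: the chance of survival is at most the mean number of survivors.\<close>
lemma alive_prob_le:
  assumes "0 \<le> p" "p \<le> 1"
  shows "alive_prob p A v b \<le> p ^ length v * paths A v b"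
proof (induction v arbitrary: b)
  case (Cons \<theta> v)
  let ?x = "\<lambda>l. p * (if cell_step \<theta> b l \<in> A then alive_prob p A v (cell_step \<theta> b l) else 0)"
  have "alive_prob p A (\<theta> # v) b = 1 - (\<Prod>l<M. 1 - ?x l)"
    by (rule alive_prob_Cons[OF assms])
  also have "\<dots> \<le> (\<Sum>l<M. ?x l)"
    using assms alive_prob_bounds
    by (intro one_minus_prod_le_sum) (auto intro: mult_le_one)
  also have "\<dots> \<le> (\<Sum>l<M. p * (if cell_step \<theta> b l \<in> A
      then p ^ length v * paths A v (cell_step \<theta> b l) else 0))"
    using assms Cons by (intro sum_mono mult_left_mono) auto
  also have "\<dots> = p ^ length (\<theta> # v) * paths A (\<theta> # v) b"
    unfolding paths_Cons transfer_def by (auto simp: sum_distrib_left intro!: sum.cong)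
  finally show ?case .
qed simp

text \<open>If all cells survive \<open>v\<close> with probability at least \<open>a\<close>, then prefixing \<open>u\<close> keeps the first-order
  term \<open>a * p^n * paths A u b\<close> up to a loss of relative order \<open>a\<close>. The denominator grows by at most
  \<open>a * M^m\<close> per letter, since \<open>1 - (\<Prod>l. 1 - x l) \<ge> s / (1 + s)\<close> for \<open>x l \<le> 1\<close> and
  \<open>0 \<le> s \<le> (\<Sum>l. x l)\<close>.\<close>
lemma alive_prob_append_ge:
  assumes p: "0 \<le> p" "p \<le> 1" and a: "0 \<le> a" "\<And>k. k \<in> A \<Longrightarrow> a \<le> alive_prob p A v k"
    and "b \<in> A" "length u \<le> m"
  shows "a * p ^ length u * paths A u b / (1 + a * real (length u) * real M ^ m)
     \<le> alive_prob p A (u @ v) b"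
  using assms(5,6)
proof (induction u arbitrary: b)
  case Nil
  then show ?case using a by simp
next
  case (Cons \<theta> u)
  let ?x = "\<lambda>l. p * (if cell_step \<theta> b l \<in> A then alive_prob p A (u @ v) (cell_step \<theta> b l) else 0)"
  define c where "c = 1 + a * real (length u) * real M ^ m"
  define Y where "Y = a * p ^ length (\<theta> # u) * paths A (\<theta> # u) b"
  have c: "0 < c" unfolding c_def using a(1) by (intro add_pos_nonneg mult_nonneg_nonneg) auto
  have Y: "0 \<le> Y" unfolding Y_def using a(1) p(1) paths_nonneg by (intro mult_nonneg_nonneg) auto
  have "Y / c = (\<Sum>l<M. p * (if cell_step \<theta> b l \<in> A
      then a * p ^ length u * paths A u (cell_step \<theta> b l) / c else 0))"
    unfolding Y_def paths_Cons transfer_def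
    by (auto simp: sum_distrib_left sum_divide_distrib intro!: sum.cong)
  also have "\<dots> \<le> (\<Sum>l<M. ?x l)"
    using p Cons unfolding c_def by (intro sum_mono mult_left_mono) auto
  finally have "Y / c \<le> (\<Sum>l<M. ?x l)" .
  then have "(Y / c) / (1 + Y / c) \<le> 1 - (\<Prod>l<M. 1 - ?x l)"
    using p alive_prob_bounds Y c by (intro one_minus_prod_ge) (auto intro: mult_le_one)
  also have "(Y / c) / (1 + Y / c) = Y / (c + Y)"
    using c Y by (simp add: field_simps)
  finally have 1: "Y / (c + Y) \<le> alive_prob p A ((\<theta> # u) @ v) b"
    by (simp add: alive_prob_Cons[OF p])
  have "p ^ length (\<theta> # u) * paths A (\<theta> # u) b \<le> 1 * real M ^ m"
  proof (rule mult_mono)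
    have "paths A (\<theta> # u) b \<le> real M ^ length (\<theta> # u)" by (rule paths_le)
    also have "\<dots> \<le> real M ^ m" using Mpos Cons.prems by (intro power_increasing) (auto simp: Suc_le_eq)
    finally show "paths A (\<theta> # u) b \<le> real M ^ m" .
  qed (use p paths_nonneg in \<open>auto intro: power_le_one mult_le_one\<close>)
  then have "Y \<le> a * real M ^ m"
    unfolding Y_def using a(1) by (simp add: mult.assoc mult_left_mono)
  then have "c + Y \<le> 1 + a * real (length (\<theta> # u)) * real M ^ m"
    by (simp add: c_def algebra_simps)
  then have "Y / (1 + a * real (length (\<theta> # u)) * real M ^ m) \<le> Y / (c + Y)"
    using c Y by (intro divide_left_mono) (auto intro!: mult_pos_pos add_pos_nonneg mult_nonneg_nonneg simp: a(1))
  with 1 show ?case unfolding Y_def by linarith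
qed

end

context positive_ifs
begin

definition min_alive_prob :: "real \<Rightarrow> nat list \<Rightarrow> real" where
  "min_alive_prob p v = Min (alive_prob p A v ` A)"

lemma min_alive_prob_le: "b \<in> A \<Longrightarrow> min_alive_prob p v \<le> alive_prob p A v b"
  unfolding min_alive_prob_def using finite_A by (intro Min_le) auto

lemma min_alive_prob_greatest:
  "(\<And>b. b \<in> A \<Longrightarrow> c \<le> alive_prob p A v b) \<Longrightarrow> c \<le> min_alive_prob p v"
  unfolding min_alive_prob_def using finite_A A_ne by (subst Min_ge_iff) auto

text \<open>Taking reciprocals makes the bound of \<open>alive_prob_append_ge\<close> affine in \<open>1 / min_alive_prob p v\<close>.\<close>
lemma min_alive_prob_append:
  assumes p: "0 < p" "p \<le> 1" and "0 < min_alive_prob p v" "set u \<subseteq> {..<L}"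
  shows "0 < min_alive_prob p (u @ v)"
    and "1 / min_alive_prob p (u @ v) \<le> 1 / (p ^ length u * min_paths A u) * (1 / min_alive_prob p v)
      + real (length u) * real M ^ length u / p ^ length u"
proof -
  define a where "a = min_alive_prob p v"
  define n where "n = length u"
  define D where "D = real n * real M ^ n"
  define R where "R = min_paths A u"
  define B where "B = a * p ^ n * R / (1 + a * D)"
  have a: "0 < a" using assms by (simp add: a_def)
  have R: "1 \<le> R" unfolding R_def by (rule min_paths_ge_1[OF assms(4)])
  have D: "0 \<le> D" by (simp add: D_def)
  have "1 + a * D > 0" using a D by (simp add: add_pos_nonneg)
  note den = this
  have B: "0 < B" unfolding B_def using a R p den by (intro divide_pos_pos mult_pos_pos) auto
  have le: "B \<le> min_alive_prob p (u @ v)"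
  proof (rule min_alive_prob_greatest)
    fix b assume b: "b \<in> A"
    have "B \<le> a * p ^ n * paths A u b / (1 + a * real n * real M ^ n)"
      unfolding B_def D_def R_def using a p min_paths_le[OF b] den[unfolded D_def]
      by (simp add: mult.assoc divide_right_mono mult_left_mono)
    also have "\<dots> \<le> alive_prob p A (u @ v) b"
      unfolding n_def using p a b min_alive_prob_le
      by (intro alive_prob_append_ge) (auto simp: a_def)
    finally show "B \<le> alive_prob p A (u @ v) b" .
  qed
  with B show "0 < min_alive_prob p (u @ v)" by linarith
  have "1 / min_alive_prob p (u @ v) \<le> 1 / B"
    using le B by (intro divide_left_mono) auto
  also have "\<dots> = 1 / (p ^ n * R) * (1 / a) + D / (p ^ n * R)"
    unfolding B_def using a R p den by (simp add: field_simps)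
  also have "D / (p ^ n * R) \<le> D / p ^ n"
  proof -
    have "p ^ n * 1 \<le> p ^ n * R" using R p by (intro mult_left_mono) auto
    then show ?thesis using D R p by (intro divide_left_mono) auto
  qed
  finally show "1 / min_alive_prob p (u @ v) \<le>
     1 / (p ^ length u * min_paths A u) * (1 / min_alive_prob p v)
      + real (length u) * real M ^ length u / p ^ length u"
    by (simp add: D_def n_def a_def R_def)
qed

lemma min_alive_prob_Nil: "min_alive_prob p [] = 1"
proof -
  have "alive_prob p A [] ` A = {1}" using A_ne by auto
  then show ?thesis by (simp add: min_alive_prob_def)
qed

lemma min_alive_prob_pos:
  "0 < p \<Longrightarrow> p \<le> 1 \<Longrightarrow> v \<in> words L n \<Longrightarrow> 0 < min_alive_prob p v"
  using min_alive_prob_append(1)[of p "[]" v] by (simp add: min_alive_prob_Nil words_def)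

text \<open>Write the summands as \<open>exp (s * y u)\<close>. Their average is 1 at \<open>s = 0\<close>, and its derivative there is the average of \<open>y\<close>,
  which is negative.\<close>
lemma contracting_exponent:
  assumes "0 < p" "0 < real m * ln p + avg_min m"
  shows "\<exists>s. 0 < s \<and> s \<le> 1 \<and> word_avg L m (\<lambda>u. (1 / (p ^ m * min_paths A u)) powr s) < 1"
proof -
  define y where "y u = ln (1 / (p ^ m * min_paths A u))" for u
  define g where "g s = word_avg L m (\<lambda>u. exp (s * y u))" for s
  have y: "y u = - (real m * ln p) - ln (min_paths A u)" if "u \<in> words L m" for u
    using assms word_min_pos[OF that] by (simp add: y_def ln_div ln_mult_pos ln_realpow)
  have "(g has_real_derivative word_avg L m y) (at 0)"
    unfolding g_def[abs_def] word_avg_def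
  proof (intro DERIV_cdivide DERIV_sum)
    fix u
    show "((\<lambda>s. exp (s * y u)) has_real_derivative y u) (at 0)"
      by (auto intro!: derivative_eq_intros)
  qed
  moreover have "word_avg L m y = word_avg L m (\<lambda>u. - (real m * ln p) - ln (min_paths A u))"
    by (intro word_avg_cong y)
  then have "word_avg L m y = - (real m * ln p + avg_min m)"
    unfolding word_avg_diff avg_min_def using Lpos by (simp add: word_avg_const)
  ultimately obtain d where d: "0 < d" "\<And>h. 0 < h \<Longrightarrow> h < d \<Longrightarrow> g (0 + h) < g 0"
    using DERIV_neg_dec_right[of g "word_avg L m y" 0] assms by auto
  define s where "s = min 1 (d / 2)"
  have s: "0 < s" "s \<le> 1" "s < d" using d by (auto simp: s_def)
  have "g s < g 0" using d(2)[of s] s by simp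
  also have "g 0 = 1" using Lpos by (simp add: g_def word_avg_const)
  also have "g s = word_avg L m (\<lambda>u. (1 / (p ^ m * min_paths A u)) powr s)"
    unfolding g_def
  proof (rule word_avg_cong)
    fix u assume "u \<in> words L m"
    then have "1 / (p ^ m * min_paths A u) \<noteq> 0"
      using word_min_pos[of u m] assms by simp
    then show "exp (s * y u) = (1 / (p ^ m * min_paths A u)) powr s"
      by (simp add: powr_def y_def)
  qed
  finally show ?thesis using s by blast
qed

text \<open>By \<open>min_alive_prob_append\<close> and \<open>contracting_exponent\<close> the averages of \<open>z = (1 / Q)^s\<close>, with \<open>Q\<close> the minimal survival
  probability, satisfy \<open>E (n + 1) \<le> \<rho> * E n + K2\<close> with \<open>\<rho> < 1\<close>, so they are bounded by \<open>K\<close>.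
  A bounded negative moment keeps the mean of \<open>Q\<close> away from 0.\<close>
lemma mean_alive_prob_bounded_below:
  assumes p: "0 < p" "p \<le> 1" and supercritical: "0 < ln p + lyapunov"
  shows "\<exists>c m. 0 < c \<and> 1 \<le> m \<and> (\<forall>n. c \<le> word_avg L (n * m) (min_alive_prob p))"
proof -
  obtain C where C: "\<And>n. lyapunov * real n - C \<le> avg_min n" using avg_min_lower by blast
  obtain m :: nat where m: "C / (ln p + lyapunov) < real m" using reals_Archimedean2 by blast
  define m' where "m' = Suc m"
  have "C < real m' * (ln p + lyapunov)"
    using m supercritical by (simp add: m'_def field_simps)
  then have "0 < real m' * ln p + avg_min m'" using C[of m'] by (simp add: algebra_simps)
  from contracting_exponent[OF p(1) this] obtain s where
    s: "0 < s" "s \<le> 1" "word_avg L m' (\<lambda>u. (1 / (p ^ m' * min_paths A u)) powr s) < 1"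
    by blast
  define r where "r u = (1 / (p ^ m' * min_paths A u)) powr s" for u
  define \<rho> where "\<rho> = word_avg L m' r"
  have \<rho>: "\<rho> < 1" using s by (simp add: \<rho>_def r_def[abs_def])
  define K2 where "K2 = (real m' * real M ^ m' / p ^ m') powr s"
  have K2: "0 \<le> K2" by (simp add: K2_def)
  define z where "z v = (1 / min_alive_prob p v) powr s" for v
  define K where "K = 1 + K2 / (1 - \<rho>)"
  have K1: "1 \<le> K" using \<rho> K2 by (simp add: K_def)
  have \<rho>0: "0 \<le> \<rho>" unfolding \<rho>_def word_avg_def r_def by (intro divide_nonneg_nonneg sum_nonneg) auto
  have E: "word_avg L (n * m') z \<le> K" for n
  proof (induction n)
    case 0
    then show ?case using K1 by (simp add: word_avg_def words_0 z_def min_alive_prob_Nil)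
  next
    case (Suc n)
    have "word_avg L (Suc n * m') z = word_avg L m' (\<lambda>u. word_avg L (n * m') (\<lambda>v. z (u @ v)))"
      by (simp add: word_avg_append)
    also have "\<dots> \<le> word_avg L m' (\<lambda>u. word_avg L (n * m') (\<lambda>v. r u * z v + K2))"
    proof (intro word_avg_mono)
      fix u v assume uv: "u \<in> words L m'" "v \<in> words L (n * m')"
      have q: "0 < min_alive_prob p v" by (rule min_alive_prob_pos[OF p uv(2)])
      have lu: "length u = m'" using uv by (simp add: words_def)
      note app = min_alive_prob_append[OF p q word_set[OF uv(1)]]
      have pos: "0 < 1 / (p ^ m' * min_paths A u)"
        using p word_min_pos[OF uv(1)] by simp
      have "z (u @ v) \<le> (1 / (p ^ m' * min_paths A u) * (1 / min_alive_prob p v)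
          + real m' * real M ^ m' / p ^ m') powr s"
        unfolding z_def using app s lu by (intro powr_mono2) auto
      also have "\<dots> \<le> (1 / (p ^ m' * min_paths A u) * (1 / min_alive_prob p v)) powr s + K2"
        unfolding K2_def using pos q s p by (intro powr_add_le mult_pos_pos) auto
      also have "(1 / (p ^ m' * min_paths A u) * (1 / min_alive_prob p v)) powr s = r u * z v"
        unfolding r_def z_def by (rule powr_mult)
      finally show "z (u @ v) \<le> r u * z v + K2" .
    qed
    also have "\<dots> = word_avg L m' (\<lambda>u. word_avg L (n * m') z * r u + K2)"
      using Lpos by (simp add: word_avg_add word_avg_cmult word_avg_const mult.commute)
    also have "\<dots> = word_avg L (n * m') z * \<rho> + K2"
      using Lpos by (simp add: word_avg_add word_avg_cmult word_avg_const \<rho>_def)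
    also have "\<dots> \<le> K * \<rho> + K2" using Suc \<rho>0 by (simp add: mult_right_mono)
    also have "\<dots> \<le> K"
    proof -
      have "K * (1 - \<rho>) = (1 - \<rho>) + K2" using \<rho> by (simp add: K_def distrib_right)
      then show ?thesis using \<rho> by (simp add: right_diff_distrib)
    qed
    finally show ?case .
  qed
  \<comment> \<open>\<open>t\<close> makes the error term in \<open>Q \<ge> t - t * (t / Q)^s\<close> at most \<open>t / 2\<close> on average.\<close>
  define t where "t = (1 / (2 * K)) powr (1 / s)"
  have t: "0 < t" using K1 by (simp add: t_def)
  have ts: "t powr s = 1 / (2 * K)" using K1 s by (simp add: t_def powr_powr)
  have "t / 2 \<le> word_avg L (n * m') (min_alive_prob p)" for n
  proof -
    have "t / 2 \<le> t - t * t powr s * K" using ts K1 by simp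
    also have "\<dots> \<le> t - t * t powr s * word_avg L (n * m') z"
      using E[of n] t by (simp add: mult_left_mono)
    also have "\<dots> = word_avg L (n * m') (\<lambda>v. t - t * t powr s * z v)"
      using Lpos by (simp add: word_avg_diff word_avg_cmult word_avg_const)
    also have "\<dots> \<le> word_avg L (n * m') (min_alive_prob p)"
    proof (rule word_avg_mono)
      fix v assume v: "v \<in> words L (n * m')"
      have q: "0 < min_alive_prob p v" by (rule min_alive_prob_pos[OF p v])
      have eq: "t powr s * z v = (t / min_alive_prob p v) powr s"
        unfolding z_def using t q powr_mult[of t "1 / min_alive_prob p v" s] by simp
      show "t - t * t powr s * z v \<le> min_alive_prob p v"
      proof (cases "t \<le> min_alive_prob p v")
        case True
        have "0 \<le> t * t powr s * z v" using t by (simp add: z_def)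
        then show ?thesis using True by linarith
      next
        case False
        have "1 \<le> (t / min_alive_prob p v) powr s"
          using False q s by (intro ge_one_powr_ge_zero) auto
        then have "t * 1 \<le> t * (t powr s * z v)" unfolding eq using t by (intro mult_left_mono) auto
        then show ?thesis using q by (simp add: mult.assoc)
      qed
    qed
    finally show ?thesis .
  qed
  then show ?thesis using t
    by (intro exI[of _ "t / 2"] exI[of _ m']) (auto simp: m'_def)
qed

end

context integer_ifs
begin

section \<open>The coding map\<close>

lemma ifs_word_map_Cons: "ifs_word_map L ts (l # w) x = ifs_word_map L ts w x / real L + real (ts ! l)"
  by (simp add: ifs_word_map_def ifs_map_def)

lemma ifs_word_map_Nil: "ifs_word_map L ts [] x = x"
  by (simp add: ifs_word_map_def)

lemma ifs_word_map_snoc: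
  "ifs_word_map L ts (w @ [l]) x = ifs_word_map L ts w (x / real L + real (ts ! l))"
  by (induction w) (auto simp: ifs_word_map_Cons ifs_word_map_Nil)

lemma ifs_word_map_affine:
  "ifs_word_map L ts w x = ifs_word_map L ts w 0 + x / real L ^ length w"
proof (induction w)
  case (Cons l w)
  then show ?case by (simp add: ifs_word_map_Cons add_divide_distrib mult.commute)
qed (simp add: ifs_word_map_Nil)

lemma prefix_word_Suc: "prefix_word i (Suc n) = prefix_word i n @ [i n]"
  by (simp add: prefix_word_def)

lemma prefix_word_Suc': "prefix_word i (Suc n) = i 0 # prefix_word (\<lambda>k. i (Suc k)) n"
  by (simp add: prefix_word_def map_upt_Suc del: upt_Suc)

lemma length_prefix_word [simp]: "length (prefix_word i n) = n"
  by (simp add: prefix_word_def)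

text \<open>The bound \<open>r = 2 * last ts\<close> is preserved by every map, because \<open>r / L + last ts \<le> r\<close> for \<open>L \<ge> 2\<close>.\<close>
definition attractor_bound :: real where
  "attractor_bound = 2 * real (last ts)"

lemma translation_le: "l < M \<Longrightarrow> real (ts ! l) \<le> real (last ts)"
  using sys sorted_nth_mono[of ts l "M - 1"] by (simp add: issifs_def last_conv_nth)

lemma ifs_word_map_bounds:
  assumes "set w \<subseteq> {..<M}"
  shows "0 \<le> ifs_word_map L ts w 0" "ifs_word_map L ts w 0 \<le> attractor_bound"
proof -
  have "0 \<le> ifs_word_map L ts w 0 \<and> ifs_word_map L ts w 0 \<le> attractor_bound"
    using assms
  proof (induction w)
    case (Cons l w)
    let ?x = "ifs_word_map L ts w 0"
    have x: "0 \<le> ?x" "?x \<le> attractor_bound" and l: "l < M" using Cons by auto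
    have "?x / real L \<le> ?x / 2" using x L2 by (intro divide_left_mono) auto
    then have "?x / real L + real (ts ! l) \<le> attractor_bound"
      using x(2) translation_le[OF l] unfolding attractor_bound_def by linarith
    then show ?case using x by (simp add: ifs_word_map_Cons)
  qed (simp add: ifs_word_map_Nil attractor_bound_def)
  then show "0 \<le> ifs_word_map L ts w 0" "ifs_word_map L ts w 0 \<le> attractor_bound" by auto
qed

lemma set_prefix_word: "i \<in> symb_space M \<Longrightarrow> set (prefix_word i n) \<subseteq> {..<M}"
  by (auto simp: prefix_word_def symb_space_def)

lemma nat_proj_tendsto:
  assumes "i \<in> symb_space M"
  shows "(\<lambda>n. ifs_word_map L ts (prefix_word i n) 0) \<longlonglongrightarrow> nat_proj L ts i"
proof -
  let ?X = "\<lambda>n. ifs_word_map L ts (prefix_word i n) 0"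
  have "incseq ?X"
  proof (rule incseq_SucI)
    fix n
    show "?X n \<le> ?X (Suc n)"
      unfolding prefix_word_Suc ifs_word_map_snoc
      by (subst (2) ifs_word_map_affine) simp
  qed
  moreover have "\<And>n. ?X n \<le> attractor_bound"
    using ifs_word_map_bounds(2)[OF set_prefix_word[OF assms]] by blast
  ultimately have "convergent ?X"
    by (meson incseq_convergent convergent_def)
  then show ?thesis by (simp add: nat_proj_def convergent_LIMSEQ_iff)
qed

lemma nat_proj_bounds:
  assumes "i \<in> symb_space M"
  shows "0 \<le> nat_proj L ts i" "nat_proj L ts i \<le> attractor_bound"
  using ifs_word_map_bounds[OF set_prefix_word[OF assms]]
  by (auto intro: LIMSEQ_le_const[OF nat_proj_tendsto[OF assms]]
      LIMSEQ_le_const2[OF nat_proj_tendsto[OF assms]])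

lemma nat_proj_Suc:
  assumes "i \<in> symb_space M"
  shows "nat_proj L ts i = nat_proj L ts (\<lambda>k. i (Suc k)) / real L + real (ts ! i 0)"
proof -
  have "(\<lambda>k. i (Suc k)) \<in> symb_space M" using assms by (auto simp: symb_space_def)
  from tendsto_add[OF tendsto_divide[OF nat_proj_tendsto[OF this] tendsto_const[of "real L"]] tendsto_const[of "real (ts ! i 0)"]]
  have "(\<lambda>n. ifs_word_map L ts (prefix_word i (Suc n)) 0) \<longlonglongrightarrow>
      nat_proj L ts (\<lambda>k. i (Suc k)) / real L + real (ts ! i 0)"
    using L2 unfolding prefix_word_Suc' ifs_word_map_Cons by simp
  moreover have "(\<lambda>n. ifs_word_map L ts (prefix_word i (Suc n)) 0) \<longlonglongrightarrow> nat_proj L ts i"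
    using nat_proj_tendsto[OF assms] by (rule LIMSEQ_Suc)
  ultimately show ?thesis using LIMSEQ_unique by blast
qed

text \<open>Undoing the first \<open>n\<close> maps of the code \<open>i\<close> at \<open>x\<close>.\<close>
primrec zoom :: "(nat \<Rightarrow> nat) \<Rightarrow> real \<Rightarrow> nat \<Rightarrow> real" where
  "zoom i x 0 = x"
| "zoom i x (Suc n) = real L * (zoom i x n - real (ts ! i n))"

lemma ifs_word_map_zoom: "ifs_word_map L ts (prefix_word i n) (zoom i x n) = x"
  using L2 by (induction n) (auto simp: ifs_word_map_Nil prefix_word_def ifs_word_map_snoc
      prefix_word_Suc[unfolded prefix_word_def])

lemma zoom_nat_proj:
  assumes "i \<in> symb_space M"
  shows "zoom i (nat_proj L ts i) n = nat_proj L ts (\<lambda>k. i (n + k))"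
proof (induction n)
  case (Suc n)
  have "(\<lambda>k. i (n + k)) \<in> symb_space M" using assms by (auto simp: symb_space_def)
  from nat_proj_Suc[OF this] show ?case using Suc L2 by simp
qed simp

lemma power_L_tendsto_0: "(\<lambda>n. c / real L ^ n) \<longlonglongrightarrow> 0"
proof -
  have "(\<lambda>n. c * (1 / real L) ^ n) \<longlonglongrightarrow> c * 0"
    using L2 by (intro tendsto_mult tendsto_const LIMSEQ_realpow_zero) auto
  then show ?thesis by (simp add: power_one_over)
qed

text \<open>A point with a code along which the inverse orbit stays bounded is the point with that code, since
  the maps contract.\<close>
lemma nat_proj_eqI:
  assumes "\<And>n. \<bar>zoom i x n\<bar> \<le> c"
  shows "nat_proj L ts i = x"
proof -
  let ?X = "\<lambda>n. ifs_word_map L ts (prefix_word i n) 0"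
  have "\<bar>?X n - x\<bar> \<le> c / real L ^ n" for n
  proof -
    have "x = ?X n + zoom i x n / real L ^ n"
      using ifs_word_map_zoom[of i n x] ifs_word_map_affine[of "prefix_word i n" "zoom i x n"] by simp
    then have "?X n - x = - (zoom i x n / real L ^ n)" by linarith
    then have "\<bar>?X n - x\<bar> = \<bar>zoom i x n\<bar> / real L ^ n" by simp
    then show ?thesis using assms[of n] by (simp add: divide_right_mono)
  qed
  then have "(\<lambda>n. ?X n - x) \<longlonglongrightarrow> 0"
    by (intro Lim_null_comparison[OF _ power_L_tendsto_0[of c]]) auto
  then have "?X \<longlonglongrightarrow> x" by (simp add: LIM_zero_iff)
  then show ?thesis unfolding nat_proj_def by (rule limI)
qed

section \<open>Cells and digits\<close>

definition cell :: "real \<Rightarrow> int" where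
  "cell x = \<lfloor>x / real L\<rfloor>"

definition cell_rest :: "real \<Rightarrow> real" where
  "cell_rest x = x - real L * of_int (cell x)"

definition digit_shift :: "real \<Rightarrow> real" where
  "digit_shift y = real L * frac y"

definition digit_seq :: "real \<Rightarrow> nat \<Rightarrow> nat" where
  "digit_seq y n = nat \<lfloor>(digit_shift ^^ n) y\<rfloor>"

definition digits :: "nat \<Rightarrow> real \<Rightarrow> nat list" where
  "digits n y = map (digit_seq y) [0..<n]"

lemma cell_rest_eq: "cell_rest x = real L * frac (x / real L)"
  using L2 by (simp add: cell_rest_def cell_def frac_def algebra_simps)

lemma cell_rest_bounds: "0 \<le> cell_rest x" "cell_rest x < real L"
  using L2 frac_lt_1[of "x / real L"] by (auto simp: cell_rest_eq)

lemma digits_0 [simp]: "digits 0 y = []"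
  by (simp add: digits_def)

lemma digits_Suc: "digits (Suc n) y = nat \<lfloor>y\<rfloor> # digits n (digit_shift y)"
  by (auto simp: digits_def digit_seq_def map_upt_Suc funpow_swap1 simp del: upt_Suc)

lemma floor_cell_rest: "\<lfloor>cell_rest x\<rfloor> = \<lfloor>x\<rfloor> - int L * cell x"
proof -
  have "cell_rest x = x - of_int (int L * cell x)" by (simp add: cell_rest_def)
  then show ?thesis by (metis floor_diff_of_int)
qed

lemma cell_next: "cell (real L * (x - real (ts ! l))) = cell_step (nat \<lfloor>cell_rest x\<rfloor>) (cell x) l"
proof -
  have "cell (real L * (x - real (ts ! l))) = \<lfloor>x - of_int (int (ts ! l))\<rfloor>"
    using L2 by (simp add: cell_def)
  also have "\<dots> = \<lfloor>x\<rfloor> - int (ts ! l)" by (rule floor_diff_of_int)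
  moreover have "0 \<le> \<lfloor>cell_rest x\<rfloor>" using cell_rest_bounds by simp
  ultimately show ?thesis
    by (simp add: cell_step_def floor_cell_rest)
qed

lemma rest_next: "cell_rest (real L * (x - real (ts ! l))) = digit_shift (cell_rest x)"
proof -
  have "frac (x + of_int (- int (ts ! l))) = frac x"
    by (rule frac_add_of_int_right)
  then have "frac (x - real (ts ! l)) = frac x" by simp
  moreover have "cell_rest x = x + of_int (- (int L * cell x))" by (simp add: cell_rest_def)
  then have "frac (cell_rest x) = frac x"
    by (simp only: frac_add_of_int_right)
  ultimately show ?thesis
    using L2 by (simp add: cell_rest_eq[of "real L * (x - real (ts ! l))"] digit_shift_def)
qed

text \<open>Undoing a map shifts the digits whatever its translation, while the cells follow \<open>cell_step\<close>. These
  two lemmas translate between points and the branching process.\<close>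
lemma cell_rest_zoom: "cell_rest (zoom i x n) = (digit_shift ^^ n) (cell_rest x)"
  by (induction n) (auto simp: rest_next)

lemma cell_orbit_zoom: "cell_orbit (digit_seq (cell_rest x)) i (cell x) n = cell (zoom i x n)"
  by (induction n) (auto simp: cell_next digit_seq_def cell_rest_zoom)

lemma cell_bounds: "real L * of_int (cell x) \<le> x" "x < real L * of_int (cell x) + real L"
  using cell_rest_bounds[of x] by (auto simp: cell_rest_def)

text \<open>The points that some number of zooms takes to a boundary between two cells.\<close>
definition grid :: "real set" where
  "grid = {x. \<exists>n. real L ^ n * (x / real L) \<in> \<int>}"

lemma countable_grid: "countable grid"
proof -
  have "grid = (\<Union>n. {x. real L ^ n * (x / real L) \<in> \<int>})" by (auto simp: grid_def)
  also have "countable \<dots>"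
  proof (intro countable_UN countableI_type)
    fix n
    have "{x. real L ^ n * (x / real L) \<in> \<int>} \<subseteq> (\<lambda>k::int. of_int k * real L / real L ^ n) ` UNIV"
      using L2 by (auto simp: Ints_def field_simps image_iff)
    then show "countable {x. real L ^ n * (x / real L) \<in> \<int>}"
      by (rule countable_subset) auto
  qed
  finally show ?thesis .
qed

lemma zoom_div_L: "\<exists>k::int. zoom i x n / real L = real L ^ n * (x / real L) - of_int k"
proof (induction n)
  case 0
  show ?case by (intro exI[of _ 0]) simp
next
  case (Suc n)
  then obtain k where k: "zoom i x n / real L = real L ^ n * (x / real L) - of_int k" by blast
  have "zoom i x (Suc n) / real L = real L * (zoom i x n / real L) - real (ts ! i n)"
    using L2 by simp
  also have "\<dots> = real L ^ Suc n * (x / real L) - of_int (int L * k + int (ts ! i n))"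
    unfolding k by (simp add: algebra_simps)
  finally show ?case by blast
qed

lemma zoom_not_grid:
  assumes "x \<notin> grid"
  shows "zoom i x n / real L \<notin> \<int>"
proof
  assume a: "zoom i x n / real L \<in> \<int>"
  obtain k where "zoom i x n / real L = real L ^ n * (x / real L) - of_int k"
    using zoom_div_L by blast
  then have "real L ^ n * (x / real L) = zoom i x n / real L + of_int k" by simp
  then have "real L ^ n * (x / real L) \<in> \<int>" using a by (metis Ints_add Ints_of_int)
  then show False using assms by (auto simp: grid_def)
qed

section \<open>Basic intervals\<close>

lemma space_symb_measure: "space (uniform_symb_measure K) = symb_space K"
  by (auto simp: uniform_symb_measure_def space_PiM space_uniform_count_measure symb_space_def PiE_UNIV_domain)

lemma measurable_nat_proj: "nat_proj L ts \<in> borel_measurable (uniform_symb_measure M)"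
proof -
  have coord: "(\<lambda>i. real (ts ! i k)) \<in> borel_measurable (uniform_symb_measure M)" for k
  proof -
    have "(\<lambda>i. i k) \<in> uniform_symb_measure M \<rightarrow>\<^sub>M uniform_count_measure {..<M}"
      unfolding uniform_symb_measure_def by (rule measurable_component_singleton) simp
    moreover have "(\<lambda>l. real (ts ! l)) \<in> borel_measurable (uniform_count_measure {..<M})"
      by (auto simp: measurable_def sets_uniform_count_measure space_uniform_count_measure)
    ultimately show ?thesis by (rule measurable_compose)
  qed
  have "(\<lambda>i. ifs_word_map L ts (prefix_word i n) 0) \<in> borel_measurable (uniform_symb_measure M)" for n
  proof (induction n)
    case (Suc n)
    have eq: "ifs_word_map L ts (prefix_word i (Suc n)) 0 =
        ifs_word_map L ts (prefix_word i n) 0 + real (ts ! i n) / real L ^ n" for i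
      unfolding prefix_word_Suc ifs_word_map_snoc by (subst ifs_word_map_affine) simp
    show ?case unfolding eq using Suc coord[of n] by simp
  qed (simp add: prefix_word_def ifs_word_map_Nil)
  then show ?thesis
    unfolding nat_proj_def[abs_def] by (rule borel_measurable_lim_metric)
qed

lemma measure_cylinder_pos:
  assumes i: "i \<in> symb_space K" and "0 < K"
  shows "0 < measure (uniform_symb_measure K) {j\<in>symb_space K. \<forall>k<n. j k = i k}"
proof -
  have ps: "prob_space (uniform_count_measure {..<K})"
    using assms by (intro prob_space_uniform_count_measure) auto
  interpret P: product_prob_space "\<lambda>_::nat. uniform_count_measure {..<K}" UNIV
    using ps by (simp add: product_prob_space_def product_prob_space_axioms_def
        product_sigma_finite_def prob_space_imp_sigma_finite)
  let ?S = "{j\<in>symb_space K. \<forall>k\<in>{..<n}. j k \<in> {i k}}"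
  have s: "space (PiM UNIV (\<lambda>_::nat. uniform_count_measure {..<K})) = symb_space K"
    using space_symb_measure[of K] by (simp add: uniform_symb_measure_def)
  have ik: "{i k} \<in> sets (uniform_count_measure {..<K})" for k
    using i by (auto simp: sets_uniform_count_measure symb_space_def)
  have "emeasure (uniform_symb_measure K) ?S =
      (\<Prod>k\<in>{..<n}. emeasure (uniform_count_measure {..<K}) {i k})"
    unfolding uniform_symb_measure_def
    using P.emeasure_PiM_Collect[of "{..<n}" "\<lambda>k. {i k}"] ik by (simp add: s)
  also have "\<dots> = ennreal ((1 / real K) ^ n)"
    using i by (simp add: emeasure_uniform_count_measure symb_space_def Pi_def ennreal_power)
  finally have "measure (uniform_symb_measure K) ?S = (1 / real K) ^ n"
    by (simp add: measure_def)
  then show ?thesis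
    using assms by (simp add: Ball_def)
qed

lemma basic_index_meets:
  assumes "b \<in> basic_indices L ts"
  shows "\<exists>i\<in>symb_space M. nat_proj L ts i \<in> grid_interval L b"
proof (rule ccontr)
  assume "\<not> ?thesis"
  then have "nat_proj L ts -` grid_interval L b \<inter> space (uniform_symb_measure M) = {}"
    by (auto simp: space_symb_measure)
  moreover have "measure (nat_measure L ts) (grid_interval L b) =
      measure (uniform_symb_measure M) (nat_proj L ts -` grid_interval L b \<inter> space (uniform_symb_measure M))"
    unfolding nat_measure_def
    by (rule measure_distr[OF measurable_nat_proj]) (simp add: grid_interval_def)
  ultimately show False using assms by (simp add: basic_indices_def)
qed

lemma finite_basic_indices: "finite (basic_indices L ts)"
proof (rule finite_subset)
  show "basic_indices L ts \<subseteq> {-1..\<lceil>attractor_bound\<rceil>}"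
  proof
    fix b assume "b \<in> basic_indices L ts"
    then obtain i where i: "i \<in> symb_space M" "nat_proj L ts i \<in> grid_interval L b"
      using basic_index_meets by blast
    have "0 \<le> (of_int b + 1) * real L" "of_int b * real L \<le> attractor_bound"
      using i nat_proj_bounds[OF i(1)] by (auto simp: grid_interval_def)
    then have 1: "0 \<le> of_int b + (1::real)" "of_int b * real L \<le> attractor_bound"
      using L2 by (auto simp: zero_le_mult_iff)
    have "of_int b \<le> attractor_bound"
    proof (cases "0 \<le> b")
      case True
      then have "of_int b * 1 \<le> of_int b * real L" using L2 by (intro mult_left_mono) auto
      then show ?thesis using 1 by linarith
    next
      case False
      then show ?thesis by (auto simp: attractor_bound_def intro: order_trans[of _ 0])
    qed
    then have "b \<le> \<lceil>attractor_bound\<rceil>" by linarith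
    then show "b \<in> {-1..\<lceil>attractor_bound\<rceil>}" using 1(1) by auto
  qed
qed simp

text \<open>A whole cylinder around the code projects into the open cell, and cylinders have positive measure.\<close>
lemma basic_index_of_interior:
  assumes i: "i \<in> symb_space M" and int: "nat_proj L ts i / real L \<notin> \<int>"
  shows "cell (nat_proj L ts i) \<in> basic_indices L ts"
proof -
  let ?x = "nat_proj L ts i"
  define b where "b = cell ?x"
  have "?x \<noteq> real L * of_int b"
    using int L2 by (metis Ints_of_int nonzero_mult_div_cancel_left of_nat_eq_0_iff not_numeral_le_zero)
  then have x: "real L * of_int b < ?x" "?x < real L * of_int b + real L"
    using cell_bounds[of ?x] by (auto simp: b_def)
  define e where "e = min (?x - real L * of_int b) (real L * of_int b + real L - ?x)"
  have e: "0 < e" using x by (simp add: e_def)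
  have "\<forall>\<^sub>F n in sequentially. attractor_bound / real L ^ n < e"
    using power_L_tendsto_0 e by (rule order_tendstoD(2))
  then obtain n where n: "attractor_bound / real L ^ n < e"
    by (auto simp: eventually_sequentially)
  let ?S = "{j\<in>symb_space M. \<forall>k<n. j k = i k}"
  have "?S \<subseteq> nat_proj L ts -` grid_interval L b \<inter> space (uniform_symb_measure M)"
  proof
    fix j assume "j \<in> ?S"
    then have j: "j \<in> symb_space M" "prefix_word j n = prefix_word i n"
      by (auto simp: prefix_word_def)
    have shift: "(\<lambda>k. h (n + k)) \<in> symb_space M" if "h \<in> symb_space M" for h
      using that by (auto simp: symb_space_def)
    have eq: "nat_proj L ts h = ifs_word_map L ts (prefix_word h n) 0
        + nat_proj L ts (\<lambda>k. h (n + k)) / real L ^ n" if "h \<in> symb_space M" for h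
      using ifs_word_map_zoom[of h n "nat_proj L ts h"]
      unfolding zoom_nat_proj[OF that] by (subst (asm) ifs_word_map_affine) simp
    have "\<bar>nat_proj L ts j - ?x\<bar> =
       \<bar>nat_proj L ts (\<lambda>k. j (n + k)) - nat_proj L ts (\<lambda>k. i (n + k))\<bar> / real L ^ n"
      unfolding eq[OF j(1)] eq[OF i] j(2) by (simp add: diff_divide_distrib[symmetric])
    also have "\<dots> \<le> attractor_bound / real L ^ n"
      using nat_proj_bounds[OF shift[OF i]] nat_proj_bounds[OF shift[OF j(1)]]
      by (intro divide_right_mono) auto
    finally have "\<bar>nat_proj L ts j - ?x\<bar> < e" using n by linarith
    then have "nat_proj L ts j \<in> grid_interval L b"
      unfolding e_def grid_interval_def by (auto simp: algebra_simps abs_if split: if_splits)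
    then show "j \<in> nat_proj L ts -` grid_interval L b \<inter> space (uniform_symb_measure M)"
      using j by (simp add: space_symb_measure)
  qed
  note sub = this
  have ps: "prob_space (uniform_symb_measure M)"
    unfolding uniform_symb_measure_def using Mpos
    by (intro prob_space_PiM prob_space_uniform_count_measure) auto
  have "0 < measure (uniform_symb_measure M) ?S" by (rule measure_cylinder_pos[OF i Mpos])
  also have "\<dots> \<le> measure (uniform_symb_measure M)
      (nat_proj L ts -` grid_interval L b \<inter> space (uniform_symb_measure M))"
    using measurable_sets[OF measurable_nat_proj, of "grid_interval L b"]
    by (intro finite_measure.finite_measure_mono[OF prob_space.finite_measure[OF ps] sub])
      (simp add: grid_interval_def)
  also have "\<dots> = measure (nat_measure L ts) (grid_interval L b)"
    unfolding nat_measure_def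
    by (rule measure_distr[OF measurable_nat_proj, symmetric]) (simp add: grid_interval_def)
  finally show ?thesis by (simp add: basic_indices_def b_def)
qed

section \<open>The attractor up to grid points\<close>

text \<open>The points whose process of cells in \<open>A\<close> survives forever.\<close>
definition fibre_core :: "int set \<Rightarrow> (nat list \<Rightarrow> bool) \<Rightarrow> real set" where
  "fibre_core A \<omega> = {x. cell x \<in> A \<and> (\<forall>n. alive A (digits n (cell_rest x)) (cell x) \<omega>)}"

text \<open>An infinite path of the process stays in the finite set \<open>A\<close>, so its zooms are bounded.\<close>
lemma fibre_core_subset:
  assumes "finite A"
  shows "fibre_core A \<omega> \<subseteq> random_attractor L ts \<omega>"
proof
  fix x assume "x \<in> fibre_core A \<omega>"
  then have c: "cell x \<in> A" and "\<And>n. alive A (map (digit_seq (cell_rest x)) [0..<n]) (cell x) \<omega>"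
    by (auto simp: fibre_core_def digits_def)
  from path_if_alive[OF this(2)] obtain i where i: "i \<in> surviving M \<omega>"
    "\<And>n. cell_orbit (digit_seq (cell_rest x)) i (cell x) (Suc n) \<in> A" by blast
  have inA: "cell (zoom i x n) \<in> A" for n
    using c i(2) unfolding cell_orbit_zoom by (cases n) auto
  define B where "B = Max (abs ` A)"
  have "\<bar>zoom i x n\<bar> \<le> real L * of_int B + real L" for n
  proof -
    have "\<bar>cell (zoom i x n)\<bar> \<le> B"
      unfolding B_def using assms inA by (intro Max_ge) auto
    then have "\<bar>of_int (cell (zoom i x n))\<bar> \<le> (of_int B :: real)"
      by (metis of_int_abs of_int_le_iff)
    then have "\<bar>real L * of_int (cell (zoom i x n))\<bar> \<le> real L * of_int B"
      by (simp add: abs_mult mult_left_mono)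
    then show ?thesis using cell_bounds[of "zoom i x n"] by linarith
  qed
  then have "nat_proj L ts i = x" by (rule nat_proj_eqI)
  then show "x \<in> random_attractor L ts \<omega>" using i(1) by (auto simp: random_attractor_def)
qed

text \<open>Off the grid every zoom of an attractor point is an attractor point inside an open cell, so the cell
  is basic.\<close>
lemma random_attractor_subset:
  "random_attractor L ts \<omega> \<subseteq> fibre_core (basic_indices L ts) \<omega> \<union> grid"
proof
  fix x assume "x \<in> random_attractor L ts \<omega>"
  then obtain i where i: "i \<in> surviving M \<omega>" "x = nat_proj L ts i"
    by (auto simp: random_attractor_def)
  have iM: "i \<in> symb_space M" using i by (simp add: surviving_def)
  have shift: "(\<lambda>k. i (n + k)) \<in> symb_space M" for n
    using iM by (auto simp: symb_space_def)
  show "x \<in> fibre_core (basic_indices L ts) \<omega> \<union> grid"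
  proof (cases "x \<in> grid")
    case False
    have "cell (zoom i x n) \<in> basic_indices L ts" for n
      using basic_index_of_interior[OF shift[of n]] zoom_not_grid[OF False, of i n]
      unfolding i(2) zoom_nat_proj[OF iM] by blast
    note c = this
    have "alive (basic_indices L ts) (map (digit_seq (cell_rest x)) [0..<n]) (cell x) \<omega>" for n
      by (rule alive_if_path[OF i(1)]) (simp only: cell_orbit_zoom c)
    then show ?thesis using c[of 0] by (simp add: fibre_core_def digits_def)
  qed simp
qed

end

section \<open>Fixed points of the offspring generating function\<close>

text \<open>A strictly convex function that fixes 1 has at most one fixed point below 1. Here this is seen by
  comparing the slopes of the chords over \<open>[x, y]\<close> and \<open>[y, 1]\<close>, both equal to \<open>1 / p\<close>; since \<open>p < 1\<close>, such
  slopes force \<open>M \<ge> 2\<close>.\<close>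
lemma generating_function_fixed_points:
  fixes p e g :: real
  assumes p: "0 < p" "p < 1" and eg: "0 \<le> e" "e \<le> g" "g < 1"
    and e: "(1 - p * (1 - e)) ^ M = e" and g: "(1 - p * (1 - g)) ^ M = g"
  shows "e = g"
proof (rule ccontr)
  assume "e \<noteq> g"
  define x y where "x = 1 - p * (1 - e)" and "y = 1 - p * (1 - g)"
  have "p * (1 - e) < 1 * 1"
    using p eg by (intro mult_less_le_imp_less) auto
  moreover have "0 < p * (1 - g)" using p eg by simp
  ultimately have x: "0 < x" and y: "y < 1" by (auto simp: x_def y_def)
  have xy: "x < y" using p eg \<open>e \<noteq> g\<close> by (simp add: x_def y_def)
  have yx: "y - x = p * (g - e)" and y1: "1 - y = p * (1 - g)"
    by (simp_all add: x_def y_def algebra_simps)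
  have "y ^ M - x ^ M = (y - x) * (\<Sum>i<M. y ^ i * x ^ (M - Suc i))"
    using power_diff_sumr2[of y M x] by (simp add: mult.commute)
  then have "(y - x) * (\<Sum>i<M. y ^ i * x ^ (M - Suc i)) = g - e"
    using e g by (simp add: x_def y_def)
  then have s1: "p * (\<Sum>i<M. y ^ i * x ^ (M - Suc i)) = 1"
    using eg \<open>e \<noteq> g\<close> by (simp add: yx)
  have "(1 - y) * (\<Sum>i<M. y ^ i) = 1 - g"
    using g one_diff_power_eq[of y M] by (simp add: y_def)
  then have s2: "p * (\<Sum>i<M. y ^ i) = 1" using eg by (simp add: y1)
  have "M \<noteq> 0" using s2 by (intro notI) simp
  moreover have "M \<noteq> 1" using s2 p by (intro notI) simp
  ultimately have M: "2 \<le> M" by simp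
  have "(\<Sum>i<M. y ^ i * x ^ (M - Suc i)) < (\<Sum>i<M. y ^ i)"
  proof (rule sum_strict_mono_ex1)
    show "\<forall>i\<in>{..<M}. y ^ i * x ^ (M - Suc i) \<le> y ^ i"
      using x xy y by (auto intro!: mult_left_le power_le_one)
    obtain k where "M = Suc (Suc k)" using M by (metis Suc_le_D numeral_2_eq_2 Suc_le_mono)
    then have "x ^ (M - Suc 0) < 1" using x xy y power_Suc_less_one[of x k] by simp
    then show "\<exists>i\<in>{..<M}. y ^ i * x ^ (M - Suc i) < y ^ i"
      using M by (intro bexI[of _ 0]) auto
  qed simp
  then have "p * (\<Sum>i<M. y ^ i * x ^ (M - Suc i)) < p * (\<Sum>i<M. y ^ i)"
    using p by (intro mult_strict_left_mono)
  with s1 s2 show False by simp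
qed

context integer_ifs
begin

section \<open>Lebesgue measure\<close>

text \<open>The offset in its cell of the left end of the points whose digits start with the word.\<close>
primrec word_pos :: "nat list \<Rightarrow> real" where
  "word_pos [] = 0"
| "word_pos (\<theta> # v) = real \<theta> + word_pos v / real L"

lemma word_pos_bounds:
  assumes "set v \<subseteq> {..<L}"
  shows "0 \<le> word_pos v" "word_pos v + real L / real L ^ length v \<le> real L"
proof -
  have "0 \<le> word_pos v \<and> word_pos v + real L / real L ^ length v \<le> real L"
    using assms
  proof (induction v)
    case (Cons \<theta> v)
    then have *: "0 \<le> word_pos v" "word_pos v + real L / real L ^ length v \<le> real L"
      and \<theta>: "real \<theta> + 1 \<le> real L" by auto
    have "(word_pos v + real L / real L ^ length v) / real L \<le> 1"
      using *(2) L2 by (simp add: divide_le_eq_1)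
    then show ?case using \<theta> * L2 by (simp add: add_divide_distrib)
  qed (use L2 in simp)
  then show "0 \<le> word_pos v" "word_pos v + real L / real L ^ length v \<le> real L" by auto
qed

lemma digit_shift_bounds: "0 \<le> digit_shift y" "digit_shift y < real L"
  using L2 frac_lt_1[of y] by (auto simp: digit_shift_def)

lemma digits_in_words:
  assumes "0 \<le> y" "y < real L"
  shows "digits n y \<in> words L n"
  using assms
proof (induction n arbitrary: y)
  case (Suc n)
  have "nat \<lfloor>y\<rfloor> < L" using Suc.prems by linarith
  then show ?case using Suc.IH[OF digit_shift_bounds] by (simp add: digits_Suc words_def)
qed (simp add: words_def)

lemma digits_eq_iff:
  assumes "v \<in> words L n" "0 \<le> y" "y < real L"
  shows "digits n y = v \<longleftrightarrow> word_pos v \<le> y \<and> y < word_pos v + real L / real L ^ n"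
  using assms
proof (induction n arbitrary: v y)
  case (Suc n)
  then obtain \<theta> v' where v: "v = \<theta> # v'" "\<theta> < L" and v': "v' \<in> words L n"
    by (cases v) (auto simp: words_def)
  have pb: "0 \<le> word_pos v'" "word_pos v' + real L / real L ^ n \<le> real L"
    using word_pos_bounds[of v'] v' by (auto simp: words_def)
  have "nat \<lfloor>y\<rfloor> = \<theta> \<longleftrightarrow> real \<theta> \<le> y \<and> y < real \<theta> + 1"
    using Suc.prems by linarith
  moreover have "digit_shift y = real L * (y - real \<theta>)" if "real \<theta> \<le> y" "y < real \<theta> + 1"
  proof -
    have "\<lfloor>y\<rfloor> = int \<theta>" using that by linarith
    then show ?thesis by (simp add: digit_shift_def frac_def)
  qed
  moreover have "digits n (digit_shift y) = v' \<longleftrightarrow>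
      word_pos v' \<le> digit_shift y \<and> digit_shift y < word_pos v' + real L / real L ^ n"
    by (rule Suc.IH[OF v' digit_shift_bounds])
  ultimately have "digits (Suc n) y = v \<longleftrightarrow> real \<theta> \<le> y \<and> y < real \<theta> + 1 \<and>
      word_pos v' \<le> real L * (y - real \<theta>) \<and> real L * (y - real \<theta>) < word_pos v' + real L / real L ^ n"
    by (auto simp: digits_Suc v)
  also have "\<dots> \<longleftrightarrow> real \<theta> \<le> y \<and> y < real \<theta> + 1 \<and>
      word_pos v' / real L \<le> y - real \<theta> \<and> y - real \<theta> < (word_pos v' + real L / real L ^ n) / real L"
    using L2 by (simp add: pos_divide_le_eq pos_less_divide_eq mult.commute)
  also have "\<dots> \<longleftrightarrow> word_pos v' / real L \<le> y - real \<theta> \<and>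
      y - real \<theta> < (word_pos v' + real L / real L ^ n) / real L"
  proof -
    have "0 \<le> word_pos v' / real L" using pb by simp
    moreover have "(word_pos v' + real L / real L ^ n) / real L \<le> 1"
      using pb L2 by (simp add: divide_le_eq_1)
    ultimately show ?thesis by linarith
  qed
  also have "\<dots> \<longleftrightarrow> word_pos v \<le> y \<and> y < word_pos v + real L / real L ^ Suc n"
    using L2 by (auto simp: v add_divide_distrib)
  finally show ?case .
qed (auto simp: words_def)

lemma cell_eq_iff: "cell x = b \<longleftrightarrow> real L * of_int b \<le> x \<and> x < real L * of_int b + real L"
proof -
  have "cell x = b \<longleftrightarrow> of_int b \<le> x / real L \<and> x / real L < of_int b + 1"
    unfolding cell_def by (rule floor_eq_iff)
  then show ?thesis using L2 by (simp add: field_simps)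
qed

definition word_interval :: "int \<Rightarrow> nat list \<Rightarrow> real set" where
  "word_interval b v = {real L * of_int b + word_pos v ..<
     real L * of_int b + word_pos v + real L / real L ^ length v}"

lemma word_interval_iff:
  assumes "v \<in> words L n"
  shows "x \<in> word_interval b v \<longleftrightarrow> cell x = b \<and> digits n (cell_rest x) = v"
proof -
  have v: "set v \<subseteq> {..<L}" "length v = n" using assms by (auto simp: words_def)
  have "x \<in> word_interval b v \<Longrightarrow> cell x = b"
    using word_pos_bounds[OF v(1)] by (auto simp: cell_eq_iff word_interval_def)
  moreover have "digits n (cell_rest x) = v \<longleftrightarrow> x \<in> word_interval (cell x) v"
    unfolding digits_eq_iff[OF assms cell_rest_bounds]
    by (auto simp: word_interval_def cell_rest_def v)
  ultimately show ?thesis by auto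
qed

text \<open>The points that survive \<open>n\<close> generations: a finite union of intervals of length \<open>L / L^n\<close> that
  decreases to \<open>fibre_core\<close>. This gives measurability in \<open>\<omega>\<close> and turns expected Lebesgue measure into
  an average of survival probabilities.\<close>
definition level_core :: "int set \<Rightarrow> (nat list \<Rightarrow> bool) \<Rightarrow> nat \<Rightarrow> real set" where
  "level_core A \<omega> n = {x. cell x \<in> A \<and> alive A (digits n (cell_rest x)) (cell x) \<omega>}"

definition core_measure :: "int set \<Rightarrow> (nat list \<Rightarrow> bool) \<Rightarrow> real" where
  "core_measure A \<omega> = measure lborel (fibre_core A \<omega>)"

lemma level_core_eq:
  "level_core A \<omega> n =
     (\<Union>(b, v)\<in>{(b, v). b \<in> A \<and> v \<in> words L n \<and> alive A v b \<omega>}. word_interval b v)"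
proof (intro equalityI subsetI)
  fix x assume x: "x \<in> level_core A \<omega> n"
  have w: "digits n (cell_rest x) \<in> words L n" by (rule digits_in_words[OF cell_rest_bounds])
  then have "x \<in> word_interval (cell x) (digits n (cell_rest x))" by (simp add: word_interval_iff)
  then show "x \<in> (\<Union>(b, v)\<in>{(b, v). b \<in> A \<and> v \<in> words L n \<and> alive A v b \<omega>}. word_interval b v)"
    using x w by (auto simp: level_core_def)
qed (auto simp: level_core_def word_interval_iff)

lemma measure_level_core:
  assumes "finite A"
  shows "level_core A \<omega> n \<in> fmeasurable lborel"
    and "measure lborel (level_core A \<omega> n) =
      (\<Sum>b\<in>A. \<Sum>v\<in>words L n. of_bool (alive A v b \<omega>) * (real L / real L ^ n))"
proof -
  let ?I = "{(b, v). b \<in> A \<and> v \<in> words L n \<and> alive A v b \<omega>}"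
  have I: "?I \<subseteq> A \<times> words L n" by auto
  have fin: "finite ?I" using assms finite_words by (intro finite_subset[OF I]) auto
  have fm: "word_interval b v \<in> fmeasurable lborel" for b v
    unfolding word_interval_def by (intro fmeasurableI) auto
  have fin_em: "emeasure lborel (word_interval b v) \<noteq> \<infinity>" for b v
    using fm[of b v] by (auto simp: fmeasurable_def)
  show "level_core A \<omega> n \<in> fmeasurable lborel"
    unfolding level_core_eq using fin fm by (intro fmeasurable.finite_UN) auto
  have disj: "disjoint_family_on (\<lambda>(b, v). word_interval b v) ?I"
    by (auto simp: disjoint_family_on_def word_interval_iff)
  have "measure lborel (level_core A \<omega> n) = (\<Sum>i\<in>?I. measure lborel (case i of (b, v) \<Rightarrow> word_interval b v))"
    unfolding level_core_eq using fin disj fm fin_em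
    by (intro measure_finite_Union) (auto simp: fmeasurable_def image_subset_iff)
  also have "\<dots> = (\<Sum>i\<in>?I. real L / real L ^ n)"
    by (intro sum.cong) (auto simp: word_interval_def words_def)
  also have "\<dots> = (\<Sum>(b, v)\<in>A \<times> words L n. of_bool (alive A v b \<omega>) * (real L / real L ^ n))"
    using assms finite_words by (intro sum.mono_neutral_cong_left) auto
  finally show "measure lborel (level_core A \<omega> n) =
      (\<Sum>b\<in>A. \<Sum>v\<in>words L n. of_bool (alive A v b \<omega>) * (real L / real L ^ n))"
    by (simp add: sum.cartesian_product)
qed

lemma level_core_antimono: "decseq (level_core A \<omega>)"
proof (rule decseq_SucI)
  fix n
  show "level_core A \<omega> (Suc n) \<subseteq> level_core A \<omega> n"
    by (auto simp: level_core_def digits_def dest: alive_append)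
qed

lemma fibre_core_eq: "fibre_core A \<omega> = (\<Inter>n. level_core A \<omega> n)"
  by (auto simp: fibre_core_def level_core_def)

lemma fibre_core_fmeasurable:
  assumes "finite A"
  shows "fibre_core A \<omega> \<in> fmeasurable lborel"
proof (rule fmeasurableI2)
  show "level_core A \<omega> 0 \<in> fmeasurable lborel" by (rule measure_level_core(1)[OF assms])
  show "fibre_core A \<omega> \<subseteq> level_core A \<omega> 0" unfolding fibre_core_eq by blast
  have "level_core A \<omega> n \<in> sets lborel" for n
    using measure_level_core(1)[OF assms] by (rule fmeasurableD)
  then show "fibre_core A \<omega> \<in> sets lborel"
    unfolding fibre_core_eq by (intro sets.countable_INT) auto
qed

lemma core_measure_tendsto:
  assumes "finite A"
  shows "(\<lambda>n. measure lborel (level_core A \<omega> n)) \<longlonglongrightarrow> core_measure A \<omega>"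
  unfolding core_measure_def fibre_core_eq
  using measure_level_core(1)[OF assms, of \<omega>]
  by (intro Lim_measure_decseq level_core_antimono) (auto simp: fmeasurable_def image_subset_iff less_top)

lemma measurable_alive:
  "(\<lambda>\<omega>. of_bool (alive A v b \<omega>) :: real) \<in> borel_measurable (coin_space M p)"
proof -
  have "Measurable.pred (coin_space M p) (\<lambda>\<omega>. alive A v b \<omega>)"
    using sets_alive[of p A v b] by (simp add: pred_def)
  then show ?thesis by measurable
qed

lemma integral_alive:
  "integral\<^sup>L (coin_space M p) (\<lambda>\<omega>. of_bool (alive A v b \<omega>)) = alive_prob p A v b"
  "integrable (coin_space M p) (\<lambda>\<omega>. of_bool (alive A v b \<omega>) :: real)"
proof -
  interpret P: prob_space "coin_space M p" by (rule prob_space_coin)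
  let ?S = "{\<omega>\<in>space (coin_space M p). alive A v b \<omega>}"
  have "integral\<^sup>L (coin_space M p) (\<lambda>\<omega>. of_bool (alive A v b \<omega>)) =
      integral\<^sup>L (coin_space M p) (indicator ?S :: _ \<Rightarrow> real)"
    by (intro Bochner_Integration.integral_cong) (auto simp: indicator_def)
  then show "integral\<^sup>L (coin_space M p) (\<lambda>\<omega>. of_bool (alive A v b \<omega>)) = alive_prob p A v b"
    using sets_alive[of p A v b] by (simp add: alive_prob_def)
  show "integrable (coin_space M p) (\<lambda>\<omega>. of_bool (alive A v b \<omega>) :: real)"
    using measurable_alive by (intro P.integrable_const_bound[of _ 1]) auto
qed

lemma measurable_core_measure:
  assumes "finite A"
  shows "core_measure A \<in> borel_measurable (coin_space M p)"
proof (rule borel_measurable_LIMSEQ_real)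
  show "(\<lambda>n. measure lborel (level_core A \<omega> n)) \<longlonglongrightarrow> core_measure A \<omega>" for \<omega>
    by (rule core_measure_tendsto[OF assms])
  show "(\<lambda>\<omega>. measure lborel (level_core A \<omega> n)) \<in> borel_measurable (coin_space M p)" for n
    unfolding measure_level_core(2)[OF assms] using measurable_alive by measurable
qed

lemma integral_level_core:
  assumes "finite A"
  shows "integral\<^sup>L (coin_space M p) (\<lambda>\<omega>. measure lborel (level_core A \<omega> n)) =
    real L * (\<Sum>b\<in>A. word_avg L n (\<lambda>v. alive_prob p A v b))"
  unfolding measure_level_core(2)[OF assms]
  by (simp add: integral_alive word_avg_def sum_distrib_left sum_distrib_right mult.commute sum_divide_distrib)

lemma integral_core_measure:
  assumes A: "finite A"
  shows "(\<lambda>n. integral\<^sup>L (coin_space M p) (\<lambda>\<omega>. measure lborel (level_core A \<omega> n)))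
    \<longlonglongrightarrow> integral\<^sup>L (coin_space M p) (core_measure A)"
proof (rule integral_dominated_convergence[where w = "\<lambda>_. real (card A) * real L"])
  interpret P: prob_space "coin_space M p" by (rule prob_space_coin)
  show "core_measure A \<in> borel_measurable (coin_space M p)"
    by (rule measurable_core_measure[OF A])
  show "(\<lambda>\<omega>. measure lborel (level_core A \<omega> n)) \<in> borel_measurable (coin_space M p)" for n
    unfolding measure_level_core(2)[OF A] using measurable_alive by measurable
  show "integrable (coin_space M p) (\<lambda>_. real (card A) * real L)" by simp
  show "AE \<omega> in coin_space M p. (\<lambda>n. measure lborel (level_core A \<omega> n)) \<longlonglongrightarrow> core_measure A \<omega>"
    using core_measure_tendsto[OF A] by simp
  show "AE \<omega> in coin_space M p. norm (measure lborel (level_core A \<omega> n)) \<le> real (card A) * real L" for n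
  proof (rule AE_I2)
    fix \<omega>
    have "measure lborel (level_core A \<omega> n) \<le> (\<Sum>b\<in>A. \<Sum>v\<in>words L n. real L / real L ^ n)"
      unfolding measure_level_core(2)[OF A] by (intro sum_mono) auto
    also have "\<dots> = real (card A) * real L" using L2 by (simp add: card_words)
    finally show "norm (measure lborel (level_core A \<omega> n)) \<le> real (card A) * real L" by simp
  qed
qed

text \<open>The attractor differs from \<open>fibre_core\<close> by a subset of the countable grid.\<close>
lemma random_attractor_lebesgue:
  shows "random_attractor L ts \<omega> \<in> sets lebesgue"
    and "emeasure lebesgue (random_attractor L ts \<omega>) = ennreal (core_measure (basic_indices L ts) \<omega>)"
proof -
  let ?A = "basic_indices L ts" and ?Lam = "random_attractor L ts \<omega>"
  let ?N = "?Lam - fibre_core ?A \<omega>"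
  have c: "fibre_core ?A \<omega> \<in> fmeasurable lborel"
    by (rule fibre_core_fmeasurable[OF finite_basic_indices])
  have N: "?N \<in> null_sets lebesgue"
    using random_attractor_subset[of \<omega>] countable_imp_null_set_lborel[OF countable_grid]
    by (intro null_sets_completion_subset[of ?N grid]) (auto intro: null_sets_completionI)
  have eq: "?Lam = fibre_core ?A \<omega> \<union> ?N"
    using fibre_core_subset[OF finite_basic_indices] by blast
  have cs: "fibre_core ?A \<omega> \<in> sets lebesgue" using c by (auto simp: fmeasurable_def)
  show "?Lam \<in> sets lebesgue" using sets.Un[OF cs null_setsD2[OF N]] by (simp only: eq[symmetric])
  have "emeasure lebesgue ?Lam = emeasure lebesgue (fibre_core ?A \<omega>)"
    using emeasure_Un_null_set[OF cs N] by (simp only: eq[symmetric])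
  also have "\<dots> = emeasure lborel (fibre_core ?A \<omega>)"
    using c by (simp add: fmeasurable_def)
  finally show "emeasure lebesgue ?Lam = ennreal (core_measure ?A \<omega>)"
    using c by (simp add: core_measure_def emeasure_eq_measure2)
qed

lemma negligible_attractor_iff:
  "negligible (random_attractor L ts \<omega>) \<longleftrightarrow> core_measure (basic_indices L ts) \<omega> = 0"
proof -
  have "negligible (random_attractor L ts \<omega>) \<longleftrightarrow>
      emeasure lebesgue (random_attractor L ts \<omega>) = 0"
    using random_attractor_lebesgue(1)[of \<omega>]
    by (simp only: negligible_iff_null_sets null_sets_def mem_Collect_eq simp_thms)
  also have "\<dots> \<longleftrightarrow> core_measure (basic_indices L ts) \<omega> = 0"
    unfolding random_attractor_lebesgue(2) by (simp add: core_measure_def)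
  finally show ?thesis .
qed

section \<open>The zero-one law\<close>

lemma random_attractor_branch:
  "random_attractor L ts \<omega> =
     (\<Union>l\<in>{l. l < M \<and> \<omega> [l]}. (\<lambda>x. x / real L + real (ts ! l)) ` random_attractor L ts (subtree M l \<omega>))"
proof -
  have "nat_proj L ts (case_nat l j) = nat_proj L ts j / real L + real (ts ! l)"
    if "l < M" "j \<in> surviving M (subtree M l \<omega>)" for l j
  proof -
    have "case_nat l j \<in> symb_space M"
      using that by (auto simp: surviving_def symb_space_def Pi_iff split: nat.split)
    from nat_proj_Suc[OF this] show ?thesis by simp
  qed
  then show ?thesis
    unfolding random_attractor_def by (subst surviving_branch) (simp add: image_UN image_image)
qed

lemma negligible_affine_image:
  assumes "negligible S"
  shows "negligible ((\<lambda>x::real. c * x + d) ` S)"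
proof (rule negligible_differentiable_image_negligible[OF order_refl assms])
  show "(\<lambda>x::real. c * x + d) differentiable_on S"
    by (intro differentiable_on_add differentiable_on_mult differentiable_on_const differentiable_on_ident)
qed

lemma negligible_attractor_branch:
  "negligible (random_attractor L ts \<omega>) \<longleftrightarrow>
     (\<forall>l<M. \<omega> [l] \<longrightarrow> negligible (random_attractor L ts (subtree M l \<omega>)))"
proof -
  have aff: "negligible ((\<lambda>x. x / real L + real (ts ! l)) ` S) \<longleftrightarrow> negligible S" for l S
  proof
    assume "negligible S"
    from negligible_affine_image[OF this, of "1 / real L" "real (ts ! l)"]
    show "negligible ((\<lambda>x. x / real L + real (ts ! l)) ` S)" by simp
  next
    assume "negligible ((\<lambda>x. x / real L + real (ts ! l)) ` S)"
    from negligible_affine_image[OF this, of "real L" "- real L * real (ts ! l)"]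
    show "negligible S" using L2 by (simp add: image_image algebra_simps)
  qed
  show ?thesis
  proof
    assume a: "negligible (random_attractor L ts \<omega>)"
    show "\<forall>l<M. \<omega> [l] \<longrightarrow> negligible (random_attractor L ts (subtree M l \<omega>))"
    proof (intro allI impI)
      fix l assume "l < M" "\<omega> [l]"
      then have "(\<lambda>x. x / real L + real (ts ! l)) ` random_attractor L ts (subtree M l \<omega>)
          \<subseteq> random_attractor L ts \<omega>"
        by (subst random_attractor_branch[of \<omega>]) blast
      then show "negligible (random_attractor L ts (subtree M l \<omega>))"
        using negligible_subset[OF a] aff by blast
    qed
  next
    assume "\<forall>l<M. \<omega> [l] \<longrightarrow> negligible (random_attractor L ts (subtree M l \<omega>))"
    then show "negligible (random_attractor L ts \<omega>)"
      by (subst random_attractor_branch) (auto intro!: negligible_Union simp: aff)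
  qed
qed

lemma surviving_empty_branch:
  "surviving M \<omega> = {} \<longleftrightarrow> (\<forall>l<M. \<omega> [l] \<longrightarrow> surviving M (subtree M l \<omega>) = {})"
  by (subst surviving_branch) auto

text \<open>A property that holds for a tree iff it holds for all surviving subtrees of the first level has a
  probability fixed by the offspring generating function \<open>s \<mapsto> (1 - p * (1 - s)) ^ M\<close>.\<close>
lemma inherited_fixed_point:
  assumes p: "0 \<le> p" "p \<le> 1"
    and meas: "{\<omega>\<in>space (coin_space M p). E \<omega>} \<in> sets (coin_space M p)"
    and branch: "\<And>\<omega>. E \<omega> \<longleftrightarrow> (\<forall>l<M. \<omega> [l] \<longrightarrow> E (subtree M l \<omega>))"
  defines "e \<equiv> measure (coin_space M p) {\<omega>\<in>space (coin_space M p). E \<omega>}"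
  shows "(1 - p * (1 - e)) ^ M = e"
proof -
  let ?C = "coin_space M p"
  interpret P: prob_space ?C by (rule prob_space_coin)
  let ?N = "space ?C - {\<omega>\<in>space ?C. E \<omega>}"
  have eq: "{\<omega>\<in>space ?C. E \<omega>} = {\<omega>\<in>space ?C. \<forall>l<M. \<omega> [l] \<longrightarrow> subtree M l \<omega> \<notin> ?N}"
  proof (rule Collect_cong)
    fix \<omega>
    show "\<omega> \<in> space ?C \<and> E \<omega> \<longleftrightarrow>
        \<omega> \<in> space ?C \<and> (\<forall>l<M. \<omega> [l] \<longrightarrow> subtree M l \<omega> \<notin> ?N)"
      using branch[of \<omega>] subtree_in_space[of \<omega> p] by (cases "\<omega> \<in> space ?C") simp_all
  qed
  have "?N \<in> sets ?C" using meas by (rule sets.compl_sets)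
  then have "P.prob {\<omega>\<in>space ?C. \<forall>l<M. \<omega> [l] \<longrightarrow> subtree M l \<omega> \<notin> ?N} = (\<Prod>l<M. 1 - p * P.prob ?N)"
    by (intro coin_branching[OF p Mpos])
  then have "e = (\<Prod>l<M. 1 - p * P.prob ?N)"
    unfolding e_def by (simp only: eq[symmetric])
  also have "P.prob ?N = 1 - e" using P.prob_compl[OF meas] by (simp add: e_def)
  finally show ?thesis by simp
qed

text \<open>Extinction and negligibility of the attractor are both inherited. Extinction implies negligibility,
  and the probabilities agree as soon as the latter is below 1.\<close>
lemma zero_one_law:
  assumes p: "0 < p" "p < 1"
    and pos: "\<not> (AE \<omega> in coin_space M p. core_measure (basic_indices L ts) \<omega> = 0)"
  shows "almost_surely_given (coin_space M p)
      (\<lambda>\<omega>. emeasure lebesgue (random_attractor L ts \<omega>) > 0) (\<lambda>\<omega>. surviving M \<omega> \<noteq> {})"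
proof -
  let ?C = "coin_space M p" and ?A = "basic_indices L ts"
  interpret P: prob_space ?C by (rule prob_space_coin)
  define Z where "Z = {\<omega>\<in>space ?C. negligible (random_attractor L ts \<omega>)}"
  define E where "E = {\<omega>\<in>space ?C. surviving M \<omega> = {}}"
  have Z: "Z \<in> sets ?C"
    unfolding Z_def negligible_attractor_iff
    using measurable_core_measure[OF finite_basic_indices, of p] by measurable
  have Eeq: "E = space ?C - {\<omega>\<in>space ?C. surviving M \<omega> \<noteq> {}}" by (auto simp: E_def)
  have E: "E \<in> sets ?C" unfolding Eeq using sets_surviving by blast
  have sub: "E \<subseteq> Z" by (auto simp: E_def Z_def random_attractor_def)
  have "P.prob Z \<noteq> 1"
  proof
    assume "P.prob Z = 1"
    then have "AE \<omega> in ?C. \<omega> \<in> Z" using P.prob_eq_1[OF Z] by blast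
    then show False using pos by (auto simp: Z_def negligible_attractor_iff elim: eventually_mono)
  qed
  then have Z1: "P.prob Z < 1" using P.prob_le_1[of Z] by linarith
  have "(1 - p * (1 - P.prob E)) ^ M = P.prob E"
    unfolding E_def using p
    by (intro inherited_fixed_point[OF _ _ E[unfolded E_def] surviving_empty_branch]) auto
  moreover have "(1 - p * (1 - P.prob Z)) ^ M = P.prob Z"
    unfolding Z_def using p
    by (intro inherited_fixed_point[OF _ _ Z[unfolded Z_def] negligible_attractor_branch]) auto
  moreover have "P.prob E \<le> P.prob Z" using sub Z by (rule P.finite_measure_mono)
  ultimately have EZ: "P.prob E = P.prob Z"
    using generating_function_fixed_points[OF p measure_nonneg _ Z1] by blast
  have "P.prob (Z - E) = 0" using P.finite_measure_Diff[OF Z E sub] EZ by simp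
  then have "AE \<omega> in ?C. \<omega> \<notin> Z - E" using Z E by (subst (asm) P.prob_eq_0) auto
  then have "AE \<omega> in ?C. surviving M \<omega> \<noteq> {} \<longrightarrow> emeasure lebesgue (random_attractor L ts \<omega>) > 0"
  proof (rule AE_mp, intro AE_I2 impI)
    fix \<omega> assume "\<omega> \<in> space ?C" "\<omega> \<notin> Z - E" "surviving M \<omega> \<noteq> {}"
    then have "core_measure ?A \<omega> \<noteq> 0" by (auto simp: Z_def E_def negligible_attractor_iff)
    then have "0 < core_measure ?A \<omega>"
      using measure_nonneg[of lborel "fibre_core ?A \<omega>"] unfolding core_measure_def by linarith
    then show "emeasure lebesgue (random_attractor L ts \<omega>) > 0"
      by (simp add: random_attractor_lebesgue)
  qed
  moreover have "P.prob {\<omega>\<in>space ?C. surviving M \<omega> \<noteq> {}} = 1 - P.prob E"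
    unfolding Eeq using P.prob_compl[OF sets_surviving] by simp
  ultimately show ?thesis
    unfolding almost_surely_given_def using EZ Z1 by simp
qed

end

context positive_ifs
begin

text \<open>The level sets decrease, and their expected measures stay above a positive constant along a
  subsequence; dominated convergence passes this to the limit.\<close>
lemma core_measure_positive:
  assumes p: "0 < p" "p \<le> 1" "0 < ln p + lyapunov"
  shows "\<not> (AE \<omega> in coin_space M p. core_measure A \<omega> = 0)"
proof
  assume "AE \<omega> in coin_space M p. core_measure A \<omega> = 0"
  then have "integral\<^sup>L (coin_space M p) (core_measure A) = integral\<^sup>L (coin_space M p) (\<lambda>_. 0)"
    by (intro integral_cong_AE measurable_core_measure finite_A) auto
  then have lim: "(\<lambda>n. integral\<^sup>L (coin_space M p) (\<lambda>\<omega>. measure lborel (level_core A \<omega> n))) \<longlonglongrightarrow> 0"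
    using integral_core_measure[OF finite_A, of p] by simp
  obtain c m where c: "0 < c" "1 \<le> m" "\<And>n. c \<le> word_avg L (n * m) (min_alive_prob p)"
    using mean_alive_prob_bounded_below[OF p] by blast
  obtain b where b: "b \<in> A" using A_ne by blast
  have "c \<le> integral\<^sup>L (coin_space M p) (\<lambda>\<omega>. measure lborel (level_core A \<omega> (n * m)))" for n
  proof -
    have "c \<le> word_avg L (n * m) (\<lambda>v. alive_prob p A v b)"
      using c(3)[of n] word_avg_mono[of L "n * m" "min_alive_prob p" "\<lambda>v. alive_prob p A v b"]
        min_alive_prob_le[OF b] by (meson order_trans)
    also have "\<dots> \<le> (\<Sum>b\<in>A. word_avg L (n * m) (\<lambda>v. alive_prob p A v b))"
      using b finite_A alive_prob_bounds
      by (intro member_le_sum) (auto simp: word_avg_def intro!: divide_nonneg_nonneg sum_nonneg)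
    also have "\<dots> \<le> real L * (\<Sum>b\<in>A. word_avg L (n * m) (\<lambda>v. alive_prob p A v b))"
    proof -
      have "0 \<le> (\<Sum>b\<in>A. word_avg L (n * m) (\<lambda>v. alive_prob p A v b))"
        using alive_prob_bounds
        by (auto simp: word_avg_def intro!: divide_nonneg_nonneg sum_nonneg)
      then show ?thesis using L2 mult_right_mono[of 1 "real L"] by fastforce
    qed
    finally show ?thesis unfolding integral_level_core[OF finite_A] .
  qed
  moreover have "(\<lambda>n. integral\<^sup>L (coin_space M p) (\<lambda>\<omega>. measure lborel (level_core A \<omega> (n * m)))) \<longlonglongrightarrow> 0"
    using LIMSEQ_subseq_LIMSEQ[OF lim, of "\<lambda>n. n * m"] c(2)
    by (auto simp: o_def strict_mono_def)
  ultimately have "c \<le> 0" by (intro LIMSEQ_le_const) auto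
  with c(1) show False by simp
qed

end

context integer_ifs
begin

section \<open>Periodic digit expansions\<close>

lemma word_pos_append: "word_pos (u @ v) = word_pos u + word_pos v / real L ^ length u"
  by (induction u) (auto simp: add_divide_distrib mult.commute)

lemma word_pos_integer: "real L ^ length v * (word_pos v / real L) \<in> \<int>"
proof (induction v)
  case (Cons \<theta> v)
  have "real L ^ length (\<theta> # v) * (word_pos (\<theta> # v) / real L) =
      real L ^ length v * real \<theta> + real L ^ length v * (word_pos v / real L)"
    using L2 by (simp add: field_simps)
  moreover have "real L ^ length v * real \<theta> \<in> \<int>" by (intro Ints_mult Ints_power) auto
  then have "real L ^ length v * real \<theta> + real L ^ length v * (word_pos v / real L) \<in> \<int>"
    using Cons by (rule Ints_add)
  ultimately show ?case by simp
qed simp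

lemma frac_mult_nat: "frac (real L * frac u) = frac (real L * u)"
proof -
  have "real L * frac u = real L * u + of_int (- int L * \<lfloor>u\<rfloor>)"
    by (simp add: frac_def algebra_simps)
  then show ?thesis by (simp only: frac_add_of_int_right)
qed

lemma digit_shift_funpow: "(digit_shift ^^ n) (cell_rest x) = real L * frac (real L ^ n * (x / real L))"
  by (induction n) (auto simp: cell_rest_eq digit_shift_def frac_mult_nat mult.assoc)

lemma digits_add: "digits (m + n) y = digits m y @ digits n ((digit_shift ^^ m) y)"
  by (induction m arbitrary: y) (auto simp: digits_Suc funpow_swap1)

lemma cell_rest_id: "0 \<le> z \<Longrightarrow> z < real L \<Longrightarrow> cell_rest z = z"
  using cell_eq_iff[of z 0] by (simp add: cell_rest_def)

text \<open>The solution of \<open>z = word_pos w + z / L ^ length w\<close>, whose digits repeat \<open>w\<close>.\<close>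
definition periodic_point :: "nat list \<Rightarrow> real" where
  "periodic_point w = word_pos w / (1 - 1 / real L ^ length w)"

text \<open>The ending \<open>[0, 1]\<close> excludes the two constant expansions: the digit 1 makes \<open>z\<close> positive and
  the digit 0, smaller than \<open>L - 1\<close>, keeps \<open>z\<close> below \<open>L\<close>.\<close>
lemma periodic_point:
  assumes w: "w = u @ [0, 1]" and u: "set u \<subseteq> {..<L}"
  defines "z \<equiv> periodic_point w"
  shows "0 < z" "z < real L" "digits (length w) z = w" "frac (real L ^ length w * (z / real L)) = z / real L"
proof -
  define q where "q = 1 / real L ^ length w"
  have "1 < real L ^ length w" using L2 w by (intro one_less_power) auto
  then have q: "0 < q" "q < 1" using L2 by (auto simp: q_def divide_less_eq_1)
  have z: "z * (1 - q) = word_pos w" using q by (simp add: z_def periodic_point_def q_def)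
  have wL: "w \<in> words L (length w)" using u w L2 by (auto simp: words_def)
  have pos: "word_pos w = word_pos u + 1 / (real L * real L ^ length u)"
    using w by (simp add: word_pos_append)
  have "0 < 1 / (real L * real L ^ length u)" using L2 by simp
  then have "0 < word_pos w" using word_pos_bounds(1)[OF u] unfolding pos by linarith
  then show z0: "0 < z" using q z by (metis diff_gt_0_iff_gt zero_less_mult_pos2)
  have "real L * q = 1 / (real L * real L ^ length u)"
    using L2 by (simp add: q_def w power_add)
  then have "word_pos w + real L * q = word_pos u + 2 / (real L * real L ^ length u)"
    unfolding pos by simp
  also have "2 / (real L * real L ^ length u) < real L / real L ^ length u"
  proof -
    have "2 < real L * real L" using L2 mult_mono[of 2 "real L" 2 "real L"] by simp
    then have "2 / real L < real L" using L2 by (simp add: divide_less_eq)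
    then have "2 / real L / real L ^ length u < real L / real L ^ length u"
      using L2 by (intro divide_strict_right_mono) auto
    then show ?thesis by simp
  qed
  also have "word_pos u + real L / real L ^ length u \<le> real L" by (rule word_pos_bounds(2)[OF u])
  finally have "z * (1 - q) < real L * (1 - q)" unfolding z by (simp add: algebra_simps)
  then show zL: "z < real L" using q by simp
  have zeq: "z = word_pos w + z * q" using z by (simp add: algebra_simps)
  have "word_pos w \<le> z \<and> z < word_pos w + real L / real L ^ length w"
  proof -
    have "z * q < real L * q" "0 \<le> z * q" using q zL z0 by auto
    then show ?thesis using zeq unfolding q_def by simp
  qed
  then show "digits (length w) z = w"
    using digits_eq_iff[OF wL] z0 zL by simp
  have "real L ^ length w * (z / real L) = z / real L + real L ^ length w * (word_pos w / real L)"
  proof -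
    have "real L ^ length w * (word_pos w + z * q) = real L ^ length w * word_pos w + z"
      using L2 by (simp add: q_def distrib_left)
    then have "real L ^ length w * z = real L ^ length w * word_pos w + z"
      by (simp only: zeq[symmetric])
    then have "real L ^ length w * z / real L = (real L ^ length w * word_pos w + z) / real L"
      by simp
    then show ?thesis by (simp add: add_divide_distrib)
  qed
  then have "frac (real L ^ length w * (z / real L)) = frac (z / real L)"
    using word_pos_integer[of w] by (simp add: frac_add_int_right)
  also have "\<dots> = z / real L" using z0 zL by (simp add: frac_eq)
  finally show "frac (real L ^ length w * (z / real L)) = z / real L" .
qed

lemma periodic_digits:
  assumes z: "0 \<le> z" "z < real L" "digits r z = w" "frac (real L ^ r * (z / real L)) = z / real L"
  shows "digits (j * r) z = concat (replicate j w)"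
proof (induction j)
  case (Suc j)
  have "(digit_shift ^^ r) z = z"
    using digit_shift_funpow[of r z] z L2 by (simp add: cell_rest_id)
  then show ?case using Suc z(3) digits_add[of r "j * r" z] by simp
qed simp

lemma periodic_not_integer:
  assumes z: "0 < z" "z < real L" "frac (real L ^ r * (z / real L)) = z / real L" "0 < r"
  shows "real L ^ m * (z / real L) \<notin> \<int>"
proof
  assume a: "real L ^ m * (z / real L) \<in> \<int>"
  have fr: "frac (real L ^ n * frac u) = frac (real L ^ n * u)" for n u
  proof -
    have "real L ^ n * frac u = real L ^ n * u + of_int (- (int L ^ n) * \<lfloor>u\<rfloor>)"
      by (simp add: frac_def algebra_simps)
    then show ?thesis by (simp only: frac_add_of_int_right)
  qed
  have per: "frac (real L ^ (j * r) * (z / real L)) = z / real L" for j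
  proof (induction j)
    case 0
    show ?case using z by (simp add: frac_eq)
  next
    case (Suc j)
    have "frac (real L ^ (Suc j * r) * (z / real L)) = frac (real L ^ r * (real L ^ (j * r) * (z / real L)))"
      by (simp only: mult_Suc power_add mult.assoc)
    also have "\<dots> = frac (real L ^ r * frac (real L ^ (j * r) * (z / real L)))" by (simp only: fr)
    also have "\<dots> = z / real L" using Suc z by simp
    finally show ?case .
  qed
  have "m \<le> m * r" using z by simp
  then obtain d where d: "m * r = d + m" by (metis le_Suc_ex add.commute)
  have "real L ^ (m * r) * (z / real L) = real L ^ d * (real L ^ m * (z / real L))"
    unfolding d by (simp only: power_add mult.assoc)
  also have "\<dots> \<in> \<int>" by (rule Ints_mult[OF _ a]) (intro Ints_power Ints_of_nat)
  finally have "z / real L = 0" using per[of m] by (metis frac_eq_0_iff)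
  then show False using z by simp
qed

end

context positive_ifs
begin

section \<open>Empty interior\<close>

lemma total_concat_replicate:
  "total_paths A (concat (replicate j w)) \<le> real (card A) * total_paths A w ^ j"
proof (induction j)
  case 0
  show ?case by (simp add: total_paths_def)
next
  case (Suc j)
  have "total_paths A (concat (replicate (Suc j) w)) \<le>
      total_paths A w * total_paths A (concat (replicate j w))"
    using total_append by simp
  also have "\<dots> \<le> total_paths A w * (real (card A) * total_paths A w ^ j)"
    using Suc by (intro mult_left_mono) (auto simp: total_paths_def intro: sum_nonneg paths_nonneg)
  finally show ?case by (simp add: algebra_simps)
qed

lemma total_nonneg: "0 \<le> total_paths A v"
  by (auto simp: total_paths_def intro: sum_nonneg paths_nonneg)

text \<open>Repeating \<open>w\<close> often enough absorbs the cost of appending \<open>[0, 1]\<close>.\<close>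
lemma subcritical_word_ending:
  assumes p: "0 \<le> p" "p \<le> 1" and w: "set w \<subseteq> {..<L}" "p ^ length w * total_paths A w < 1"
  shows "\<exists>u. set u \<subseteq> {..<L} \<and>
    p ^ length (u @ [0, 1]) * total_paths A (u @ [0, 1]) < 1"
proof -
  define x where "x = p ^ length w * total_paths A w"
  define c where "c = real (card A) * total_paths A [0, 1]"
  have x: "0 \<le> x" "x < 1" using p w total_nonneg by (auto simp: x_def)
  have c: "0 \<le> c" using total_nonneg by (simp add: c_def)
  have "(\<lambda>k. x ^ k * c) \<longlonglongrightarrow> 0 * c" using x by (intro tendsto_mult LIMSEQ_realpow_zero tendsto_const)
  then have "\<forall>\<^sub>F k in sequentially. x ^ k * c < 1" by (intro order_tendstoD(2)[where y = "0 * c"]) auto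
  then obtain k where k: "x ^ k * c < 1" by (auto simp: eventually_sequentially)
  define u where "u = concat (replicate k w)"
  have lu: "length u = k * length w" by (simp add: u_def length_concat sum_list_replicate)
  have "total_paths A (u @ [0, 1]) \<le> total_paths A u * total_paths A [0, 1]" by (rule total_append)
  also have "\<dots> \<le> real (card A) * total_paths A w ^ k * total_paths A [0, 1]"
    unfolding u_def by (intro mult_right_mono total_concat_replicate total_nonneg)
  finally have "p ^ length (u @ [0, 1]) * total_paths A (u @ [0, 1]) \<le>
      p ^ length u * (real (card A) * total_paths A w ^ k * total_paths A [0, 1])"
    using p total_nonneg by (intro mult_mono power_decreasing) auto
  also have "\<dots> = x ^ k * c"
    unfolding lu by (simp add: x_def c_def power_mult power_mult_distrib mult.commute[of k])
  finally show ?thesis using k w(1) by (intro exI[of _ u]) (auto simp: u_def)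
qed

text \<open>Each further repetition of \<open>w\<close> multiplies the first moment bound by a factor below 1.\<close>
lemma AE_not_in_fibre_core:
  assumes p: "0 \<le> p" "p \<le> 1" and sub: "p ^ length w * total_paths A w < 1"
    and dig: "\<And>j. digits (n + j * length w) (cell_rest x) = v @ concat (replicate j w)"
  shows "AE \<omega> in coin_space M p. x \<notin> fibre_core A \<omega>"
proof (cases "cell x \<in> A")
  case True
  let ?C = "coin_space M p"
  interpret P: prob_space ?C by (rule prob_space_coin)
  let ?S = "{\<omega>\<in>space ?C. x \<in> fibre_core A \<omega>}"
  have S_eq: "?S = (\<Inter>n. {\<omega>\<in>space ?C. alive A (digits n (cell_rest x)) (cell x) \<omega>})"
    using True by (auto simp: fibre_core_def)
  have S: "?S \<in> sets ?C" unfolding S_eq using sets_alive by (intro sets.countable_INT) auto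
  define \<rho> where "\<rho> = p ^ length w * total_paths A w"
  define c where "c = p ^ length v * paths A v (cell x) * real (card A)"
  have \<rho>: "0 \<le> \<rho>" "\<rho> < 1" using sub p total_nonneg by (auto simp: \<rho>_def)
  have "P.prob ?S \<le> c * \<rho> ^ j" for j
  proof -
    let ?u = "v @ concat (replicate j w)"
    have lu: "length ?u = length v + j * length w" by (simp add: length_concat sum_list_replicate)
    have "?S \<subseteq> {\<omega>\<in>space ?C. alive A ?u (cell x) \<omega>}"
      unfolding dig[of j, symmetric] by (auto simp: fibre_core_def)
    then have "P.prob ?S \<le> alive_prob p A ?u (cell x)"
      unfolding alive_prob_def by (intro P.finite_measure_mono sets_alive)
    also have "\<dots> \<le> p ^ length ?u * paths A ?u (cell x)" by (rule alive_prob_le[OF p])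
    also have "\<dots> \<le> p ^ length ?u * (total_paths A (concat (replicate j w)) * paths A v (cell x))"
      using p True by (intro mult_left_mono paths_append_le paths_le_total) auto
    also have "\<dots> \<le> p ^ length ?u * (real (card A) * total_paths A w ^ j * paths A v (cell x))"
      using p paths_nonneg by (intro mult_left_mono mult_right_mono total_concat_replicate) auto
    also have "\<dots> = c * \<rho> ^ j"
      unfolding lu by (simp add: c_def \<rho>_def power_add power_mult power_mult_distrib mult.commute[of j])
    finally show ?thesis .
  qed
  moreover have "(\<lambda>j. c * \<rho> ^ j) \<longlonglongrightarrow> c * 0"
    using \<rho> by (intro tendsto_mult LIMSEQ_realpow_zero tendsto_const)
  ultimately have "P.prob ?S \<le> 0" using LIMSEQ_le_const[of "\<lambda>j. c * \<rho> ^ j" "c * 0"] by auto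
  then have "P.prob ?S = 0" using measure_nonneg[of ?C ?S] by linarith
  then have "AE \<omega> in ?C. \<omega> \<notin> ?S" using P.prob_eq_0[OF S] by blast
  then show ?thesis by (rule AE_mp) (auto intro!: AE_I2)
qed (auto simp: fibre_core_def)

text \<open>The points \<open>x n k\<close> are dense, and after \<open>n\<close> digits their expansion is that of the periodic point \<open>z\<close>.\<close>
lemma AE_interior_empty:
  assumes A: "A = basic_indices L ts"
    and p: "0 \<le> p" "p \<le> 1" and w: "set w \<subseteq> {..<L}" "p ^ length w * total_paths A w < 1"
  shows "AE \<omega> in coin_space M p. interior (random_attractor L ts \<omega>) = {}"
proof -
  obtain u where u: "set u \<subseteq> {..<L}" "p ^ length (u @ [0, 1]) * total_paths A (u @ [0, 1]) < 1"
    using subcritical_word_ending[OF p w] by blast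
  define w' where "w' = u @ [0, 1]"
  define z where "z = periodic_point w'"
  note z = periodic_point[OF w'_def u(1), folded z_def]
  define x where "x n k = real L * (of_int k + z / real L) / real L ^ n" for n :: nat and k :: int
  have zfrac: "frac (of_int k + z / real L) = z / real L" for k
    using z(1,2) by (simp add: frac_eq)
  have shift: "real L ^ n * (x n k / real L) = of_int k + z / real L" for n k
    using L2 by (simp add: x_def)
  have notgrid: "x n k \<notin> grid" for n k
  proof
    assume "x n k \<in> grid"
    then obtain m where m: "real L ^ m * (x n k / real L) \<in> \<int>" by (auto simp: grid_def)
    have "real L ^ m * (z / real L) =
        real L ^ n * (real L ^ m * (x n k / real L)) - real L ^ m * of_int k"
      using shift[of n k] by (metis add_diff_cancel_left' distrib_left mult.left_commute)
    also have "\<dots> \<in> \<int>"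
      by (intro Ints_diff Ints_mult[OF _ m] Ints_mult Ints_power Ints_of_nat Ints_of_int)
    finally show False using periodic_not_integer[OF z(1,2,4)] by (auto simp: w'_def)
  qed
  have "AE \<omega> in coin_space M p. x n k \<notin> fibre_core A \<omega>" for n k
  proof (rule AE_not_in_fibre_core[OF p])
    show "p ^ length w' * total_paths A w' < 1" using u(2) by (simp add: w'_def)
    fix j
    have "(digit_shift ^^ n) (cell_rest (x n k)) = z"
      unfolding digit_shift_funpow shift zfrac using L2 by simp
    then show "digits (n + j * length w') (cell_rest (x n k)) =
        digits n (cell_rest (x n k)) @ concat (replicate j w')"
      using periodic_digits[OF less_imp_le[OF z(1)] z(2,3,4)] by (simp add: digits_add)
  qed
  then have "AE \<omega> in coin_space M p. \<forall>n k. x n k \<notin> fibre_core A \<omega>"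
    by (simp add: AE_all_countable)
  then show ?thesis
  proof (rule AE_mp, intro AE_I2 impI)
    fix \<omega> assume *: "\<forall>n k. x n k \<notin> fibre_core A \<omega>"
    show "interior (random_attractor L ts \<omega>) = {}"
    proof (rule ccontr)
      assume "interior (random_attractor L ts \<omega>) \<noteq> {}"
      then obtain y e where e: "0 < e" "ball y e \<subseteq> random_attractor L ts \<omega>"
        by (metis ex_in_conv mem_interior)
      have "\<forall>\<^sub>F n in sequentially. real L / real L ^ n < e"
        using power_L_tendsto_0 e(1) by (rule order_tendstoD(2))
      then obtain n where n: "real L / real L ^ n < e" by (auto simp: eventually_sequentially)
      define s where "s = real L ^ n * (y / real L)"
      have y: "y = real L * s / real L ^ n" using L2 by (simp add: s_def)
      define k where "k = \<lfloor>s\<rfloor>"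
      have "\<bar>of_int k + z / real L - s\<bar> < 1"
      proof -
        have "0 \<le> z / real L" "z / real L < 1" using z(1,2) by auto
        moreover have "of_int k \<le> s" "s < of_int k + 1" by (auto simp: k_def)
        ultimately show ?thesis by linarith
      qed
      moreover have "x n k - y = real L / real L ^ n * (of_int k + z / real L - s)"
        unfolding x_def y by (simp add: diff_divide_distrib[symmetric] right_diff_distrib)
      moreover have "0 < real L / real L ^ n" using L2 by simp
      ultimately have "\<bar>x n k - y\<bar> < real L / real L ^ n * 1"
        using mult_strict_left_mono[of "\<bar>of_int k + z / real L - s\<bar>" 1 "real L / real L ^ n"]
        by (simp only: abs_mult abs_of_pos)
      then have "x n k \<in> ball y e" using n by (simp add: dist_real_def abs_minus_commute)
      then have "x n k \<in> fibre_core A \<omega> \<union> grid"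
        using e(2) random_attractor_subset[of \<omega>] unfolding A by blast
      then show False using * notgrid by blast
    qed
  qed
qed

end

section \<open>Equivalence of matrix norms\<close>

definition unit_mat :: "nat \<Rightarrow> nat \<Rightarrow> nat \<Rightarrow> real mat" where
  "unit_mat N i k = Matrix.mat N N (\<lambda>p. if p = (i, k) then 1 else 0)"

lemma unit_mat_carrier [simp]: "unit_mat N i k \<in> carrier_mat N N"
  by (simp add: unit_mat_def)

text \<open>Matrix units isolate an entry by multiplication, so a submultiplicative norm controls each entry.\<close>
lemma unit_mat_sandwich:
  assumes C: "C \<in> carrier_mat N N" and "a < N" "i < N" "k < N"
  shows "unit_mat N a i * (C * unit_mat N k a) = C $$ (i, k) \<cdot>\<^sub>m unit_mat N a a"
proof (rule eq_matI)
  fix r c assume rc: "r < dim_row (C $$ (i, k) \<cdot>\<^sub>m unit_mat N a a)" "c < dim_col (C $$ (i, k) \<cdot>\<^sub>m unit_mat N a a)"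
  then have rc: "r < N" "c < N" by (auto simp: unit_mat_def)
  have 1: "(C * unit_mat N k a) $$ (j, c) = (if c = a then C $$ (j, k) else 0)" if "j < N" for j
  proof -
    have "(C * unit_mat N k a) $$ (j, c) = (\<Sum>s\<in>{0..<N}. C $$ (j, s) * (if s = k \<and> c = a then 1 else 0))"
      using C rc that by (auto simp: scalar_prod_def unit_mat_def intro!: sum.cong)
    also have "\<dots> = (\<Sum>s\<in>{0..<N}. if s = k then (if c = a then C $$ (j, k) else 0) else 0)"
      by (intro sum.cong) auto
    finally show ?thesis using assms by simp
  qed
  have "(unit_mat N a i * (C * unit_mat N k a)) $$ (r, c) =
      (\<Sum>s\<in>{0..<N}. (if r = a \<and> s = i then 1 else 0) * (C * unit_mat N k a) $$ (s, c))"
    using C rc by (auto simp: scalar_prod_def unit_mat_def intro!: sum.cong)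
  also have "\<dots> = (\<Sum>s\<in>{0..<N}. if s = i then (if r = a \<and> c = a then C $$ (i, k) else 0) else 0)"
    using 1 by (intro sum.cong) auto
  also have "\<dots> = (C $$ (i, k) \<cdot>\<^sub>m unit_mat N a a) $$ (r, c)"
    using assms rc by (auto simp: unit_mat_def)
  finally show "(unit_mat N a i * (C * unit_mat N k a)) $$ (r, c) =
      (C $$ (i, k) \<cdot>\<^sub>m unit_mat N a a) $$ (r, c)" .
qed (use C in \<open>auto simp: unit_mat_def\<close>)

lemma submult_mat_normD:
  assumes "submult_mat_norm N nrm"
  shows "nrm (0\<^sub>m N N) = 0"
    and "C \<in> carrier_mat N N \<Longrightarrow> 0 \<le> nrm C"
    and "C \<in> carrier_mat N N \<Longrightarrow> nrm C = 0 \<Longrightarrow> C = 0\<^sub>m N N"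
    and "C \<in> carrier_mat N N \<Longrightarrow> nrm (c \<cdot>\<^sub>m C) = \<bar>c\<bar> * nrm C"
    and "C \<in> carrier_mat N N \<Longrightarrow> D \<in> carrier_mat N N \<Longrightarrow> nrm (C + D) \<le> nrm C + nrm D"
    and "C \<in> carrier_mat N N \<Longrightarrow> D \<in> carrier_mat N N \<Longrightarrow> nrm (C * D) \<le> nrm C * nrm D"
  using assms zero_carrier_mat[of N N] unfolding submult_mat_norm_def by blast+

text \<open>The matrix is built up one entry at a time with the triangle inequality.\<close>
lemma norm_le_entry_sum:
  assumes nrm: "submult_mat_norm N nrm" and C: "C \<in> carrier_mat N N"
    and nonneg: "\<And>i k. i < N \<Longrightarrow> k < N \<Longrightarrow> 0 \<le> C $$ (i, k)"
  shows "nrm C \<le> (\<Sum>i<N. \<Sum>k<N. C $$ (i, k) * nrm (unit_mat N i k))"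
proof -
  define R where "R S = Matrix.mat N N (\<lambda>p. if p \<in> S then C $$ p else 0)" for S
  have "nrm (R S) \<le> (\<Sum>(i, k)\<in>S. C $$ (i, k) * nrm (unit_mat N i k))"
    if "finite S" "S \<subseteq> {..<N} \<times> {..<N}" for S
    using that
  proof (induction S)
    case empty
    have "R {} = 0\<^sub>m N N" by (rule eq_matI) (auto simp: R_def)
    then show ?case using submult_mat_normD(1)[OF nrm] by simp
  next
    case (insert s S)
    obtain i k where s: "s = (i, k)" "i < N" "k < N" using insert.prems by auto
    have "R (insert s S) = R S + C $$ (i, k) \<cdot>\<^sub>m unit_mat N i k"
      using s insert.hyps by (intro eq_matI) (auto simp: R_def unit_mat_def)
    then have "nrm (R (insert s S)) \<le> nrm (R S) + nrm (C $$ (i, k) \<cdot>\<^sub>m unit_mat N i k)"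
      using submult_mat_normD(5)[OF nrm] by (simp add: R_def)
    also have "nrm (C $$ (i, k) \<cdot>\<^sub>m unit_mat N i k) = C $$ (i, k) * nrm (unit_mat N i k)"
      using submult_mat_normD(4)[OF nrm] nonneg[OF s(2,3)] by simp
    finally show ?case using insert s by simp
  qed
  from this[of "{..<N} \<times> {..<N}"] have "nrm (R ({..<N} \<times> {..<N})) \<le>
      (\<Sum>i<N. \<Sum>k<N. C $$ (i, k) * nrm (unit_mat N i k))"
    by (simp add: sum.cartesian_product)
  moreover have "R ({..<N} \<times> {..<N}) = C" using C by (intro eq_matI) (auto simp: R_def)
  ultimately show ?thesis by simp
qed

lemma norm_equivalent_entry_sum:
  assumes nrm: "submult_mat_norm N nrm" and N: "0 < N"
  shows "\<exists>c1 c2. 0 < c1 \<and> 0 < c2 \<and> (\<forall>C\<in>carrier_mat N N. nonneg_mat C \<longrightarrow>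
     c1 * (\<Sum>i<N. \<Sum>k<N. C $$ (i, k)) \<le> nrm C \<and> nrm C \<le> c2 * (\<Sum>i<N. \<Sum>k<N. C $$ (i, k)))"
proof -
  let ?E = "unit_mat N"
  have ge0: "0 \<le> nrm C" if "C \<in> carrier_mat N N" for C
    using submult_mat_normD(2)[OF nrm that] .
  have pos: "0 < nrm (?E i k)" if "i < N" "k < N" for i k
  proof -
    have "?E i k $$ (i, k) = 1" using that by (simp add: unit_mat_def)
    then have "?E i k \<noteq> 0\<^sub>m N N" using that by (metis index_zero_mat(1) zero_neq_one)
    then have "nrm (?E i k) \<noteq> 0" using submult_mat_normD(3)[OF nrm] by auto
    then show ?thesis using ge0[of "?E i k"] by simp
  qed
  define K where "K = (\<Sum>i<N. \<Sum>k<N. nrm (?E 0 i) * nrm (?E k 0) / nrm (?E 0 0))"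
  have K: "0 < K"
    unfolding K_def using N pos by (intro sum_pos divide_pos_pos mult_pos_pos) auto
  define D where "D = (\<Sum>i<N. \<Sum>k<N. nrm (?E i k))"
  have D: "0 < D" unfolding D_def using N pos by (intro sum_pos) auto
  have "1 / K * (\<Sum>i<N. \<Sum>k<N. C $$ (i, k)) \<le> nrm C \<and> nrm C \<le> D * (\<Sum>i<N. \<Sum>k<N. C $$ (i, k))"
    if C: "C \<in> carrier_mat N N" "nonneg_mat C" for C
  proof
    have C0: "0 \<le> C $$ (i, k)" if "i < N" "k < N" for i k
      using C that by (auto simp: nonneg_mat_def)
    have "C $$ (i, k) \<le> nrm C * (nrm (?E 0 i) * nrm (?E k 0) / nrm (?E 0 0))" if "i < N" "k < N" for i k
    proof -
      have "C $$ (i, k) * nrm (?E 0 0) = nrm (?E 0 i * (C * ?E k 0))"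
        using submult_mat_normD(4)[OF nrm] C0[OF that] unit_mat_sandwich[OF C(1) N that] by simp
      also have "\<dots> \<le> nrm (?E 0 i) * nrm (C * ?E k 0)"
        using C(1) by (intro submult_mat_normD(6)[OF nrm]) auto
      also have "\<dots> \<le> nrm (?E 0 i) * (nrm C * nrm (?E k 0))"
        using C(1) by (intro mult_left_mono submult_mat_normD(6)[OF nrm] ge0) auto
      finally show ?thesis using pos[OF N N] by (simp add: field_simps)
    qed
    then have "(\<Sum>i<N. \<Sum>k<N. C $$ (i, k)) \<le>
        (\<Sum>i<N. \<Sum>k<N. nrm C * (nrm (?E 0 i) * nrm (?E k 0) / nrm (?E 0 0)))"
      by (intro sum_mono) auto
    also have "\<dots> = nrm C * K" by (simp add: K_def sum_distrib_left)
    finally show "1 / K * (\<Sum>i<N. \<Sum>k<N. C $$ (i, k)) \<le> nrm C" using K by (simp add: field_simps)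
    have "nrm C \<le> (\<Sum>i<N. \<Sum>k<N. C $$ (i, k) * nrm (?E i k))"
      by (rule norm_le_entry_sum[OF nrm C(1) C0])
    also have "\<dots> \<le> (\<Sum>i<N. \<Sum>k<N. C $$ (i, k) * D)"
    proof (intro sum_mono mult_left_mono)
      fix i k assume ik: "i \<in> {..<N}" "k \<in> {..<N}"
      have "nrm (?E i k) \<le> (\<Sum>k<N. nrm (?E i k))"
        using ik ge0 by (intro member_le_sum) auto
      also have "\<dots> \<le> D" unfolding D_def using ik ge0 by (intro member_le_sum sum_nonneg) auto
      finally show "nrm (?E i k) \<le> D" .
    qed (use C0 in auto)
    also have "\<dots> = D * (\<Sum>i<N. \<Sum>k<N. C $$ (i, k))"
      by (simp add: sum_distrib_left sum_distrib_right mult.commute)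
    finally show "nrm C \<le> D * (\<Sum>i<N. \<Sum>k<N. C $$ (i, k))" .
  qed
  then show ?thesis using K D by (intro exI[of _ "1 / K"] exI[of _ D]) auto
qed

context integer_ifs
begin

section \<open>Transfer operators as matrices\<close>

abbreviation "cells \<equiv> basic_indices L ts"
abbreviation "N \<equiv> num_basic L ts"
abbreviation "word_mat \<equiv> mat_word_prod N (assoc_mat L ts)"

lemma basic_index_bij: "bij_betw (basic_index L ts) {..<N} cells"
proof -
  have "set (sorted_list_of_set cells) = cells" "distinct (sorted_list_of_set cells)"
    "length (sorted_list_of_set cells) = N"
    using finite_basic_indices by (auto simp: num_basic_def)
  then show ?thesis
    unfolding basic_index_def[abs_def] using bij_betw_nth[of "sorted_list_of_set cells" "{..<N}" cells] by simp
qed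

lemma sum_basic_index: "(\<Sum>k<N. f (basic_index L ts k)) = sum f cells"
  by (rule sum.reindex_bij_betw[OF basic_index_bij])

lemma ifs_map_interval_iff:
  "ifs_map L ts l ` basic_interval L ts k = basic_subinterval L ts i \<theta> \<longleftrightarrow>
     cell_step \<theta> (basic_index L ts i) l = basic_index L ts k"
proof -
  let ?b = "basic_index L ts i" and ?c = "basic_index L ts k"
  have "ifs_map L ts l ` {x..y} = {x / real L + real (ts ! l)..y / real L + real (ts ! l)}" if "x \<le> y" for x y
    using L2 that image_affinity_atLeastAtMost_div[of "real L" "real (ts ! l)" x y]
    by (simp add: ifs_map_def[abs_def])
  moreover have "of_int ?c * real L \<le> (of_int ?c + 1) * real L" by (simp add: mult_right_mono)
  ultimately have "ifs_map L ts l ` basic_interval L ts k =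
      {of_int ?c + real (ts ! l)..of_int ?c + 1 + real (ts ! l)}"
    using L2 by (simp add: basic_interval_def grid_interval_def)
  also have "\<dots> = basic_subinterval L ts i \<theta> \<longleftrightarrow>
      (of_int ?c + real (ts ! l) :: real) = of_int ?b * real L + real \<theta>"
    unfolding basic_subinterval_def Icc_eq_Icc by auto
  also have "\<dots> \<longleftrightarrow> (of_int (?c + int (ts ! l)) :: real) = of_int (?b * int L + int \<theta>)"
    by simp
  also have "\<dots> \<longleftrightarrow> cell_step \<theta> ?b l = ?c"
    unfolding of_int_eq_iff cell_step_def by linarith
  finally show ?thesis .
qed

lemma assoc_mat_entry:
  assumes "i < N" "k < N"
  shows "assoc_mat L ts \<theta> $$ (i, k) =
    (\<Sum>l<M. of_bool (cell_step \<theta> (basic_index L ts i) l = basic_index L ts k))"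
proof -
  have "(\<Sum>l<M. of_bool (cell_step \<theta> (basic_index L ts i) l = basic_index L ts k) :: real) =
      real (card {l\<in>{..<M}. cell_step \<theta> (basic_index L ts i) l = basic_index L ts k})"
    by (simp add: of_bool_def sum.If_cases Int_def)
  then show ?thesis
    using assms by (simp add: assoc_mat_def ifs_map_interval_iff)
qed

lemma assoc_mat_transfer:
  assumes i: "i < N"
  shows "(\<Sum>k<N. assoc_mat L ts \<theta> $$ (i, k) * f (basic_index L ts k)) =
    transfer cells \<theta> f (basic_index L ts i)"
proof -
  let ?s = "\<lambda>l. cell_step \<theta> (basic_index L ts i) l"
  have "(\<Sum>k<N. assoc_mat L ts \<theta> $$ (i, k) * f (basic_index L ts k)) =
      (\<Sum>k<N. \<Sum>l<M. of_bool (?s l = basic_index L ts k) * f (basic_index L ts k))"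
    using i by (intro sum.cong) (auto simp: assoc_mat_entry sum_distrib_right)
  also have "\<dots> = (\<Sum>l<M. \<Sum>k<N. of_bool (?s l = basic_index L ts k) * f (basic_index L ts k))"
    by (rule sum.swap)
  also have "\<dots> = (\<Sum>l<M. \<Sum>c\<in>cells. of_bool (?s l = c) * f c)"
    by (simp only: sum_basic_index[of "\<lambda>c. of_bool (?s l = c) * f c" for l])
  also have "\<dots> = (\<Sum>l<M. if ?s l \<in> cells then f (?s l) else 0)"
  proof (rule sum.cong[OF refl])
    fix l
    have "(\<Sum>c\<in>cells. of_bool (?s l = c) * f c) = (\<Sum>c\<in>cells. if c = ?s l then f c else 0)"
      by (intro sum.cong) auto
    then show "(\<Sum>c\<in>cells. of_bool (?s l = c) * f c) = (if ?s l \<in> cells then f (?s l) else 0)"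
      using finite_basic_indices by (simp add: sum.delta)
  qed
  finally show ?thesis by (simp add: transfer_def)
qed

lemma assoc_mat_carrier: "assoc_mat L ts \<theta> \<in> carrier_mat N N"
  by (simp add: assoc_mat_def)

lemma word_mat_Cons: "word_mat (\<theta> # w) = assoc_mat L ts \<theta> * word_mat w"
  by (simp add: mat_word_prod_def)

lemma word_mat_carrier: "word_mat w \<in> carrier_mat N N"
proof (induction w)
  case (Cons \<theta> w)
  then show ?case unfolding word_mat_Cons by (rule mult_carrier_mat[OF assoc_mat_carrier])
qed (simp add: mat_word_prod_def)

text \<open>The matrices act on functions of the basic cells as the transfer operators do.\<close>
lemma word_mat_transfers:
  "i < N \<Longrightarrow> (\<Sum>k<N. word_mat w $$ (i, k) * f (basic_index L ts k)) =
     transfers cells w f (basic_index L ts i)"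
proof (induction w arbitrary: i)
  case Nil
  have "(\<Sum>k<N. word_mat [] $$ (i, k) * f (basic_index L ts k)) =
      (\<Sum>k<N. if k = i then f (basic_index L ts k) else 0)"
    using Nil by (intro sum.cong) (auto simp: mat_word_prod_def)
  then show ?case using Nil by simp
next
  case (Cons \<theta> w)
  have "word_mat (\<theta> # w) $$ (i, k) = (\<Sum>j<N. assoc_mat L ts \<theta> $$ (i, j) * word_mat w $$ (j, k))"
    if "k < N" for k
    unfolding word_mat_Cons
    using Cons.prems that assoc_mat_carrier[of \<theta>] word_mat_carrier[of w]
    by (auto simp: scalar_prod_def atLeast0LessThan intro!: sum.cong)
  then have "(\<Sum>k<N. word_mat (\<theta> # w) $$ (i, k) * f (basic_index L ts k)) =
      (\<Sum>k<N. \<Sum>j<N. assoc_mat L ts \<theta> $$ (i, j) * (word_mat w $$ (j, k) * f (basic_index L ts k)))"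
    by (intro sum.cong) (auto simp: sum_distrib_right mult.assoc)
  also have "\<dots> = (\<Sum>j<N. assoc_mat L ts \<theta> $$ (i, j) * (\<Sum>k<N. word_mat w $$ (j, k) * f (basic_index L ts k)))"
    by (subst sum.swap) (simp add: sum_distrib_left)
  also have "\<dots> = (\<Sum>j<N. assoc_mat L ts \<theta> $$ (i, j) * transfers cells w f (basic_index L ts j))"
    using Cons.IH by (intro sum.cong) auto
  also have "\<dots> = transfers cells (\<theta> # w) f (basic_index L ts i)"
    using assoc_mat_transfer[OF Cons.prems, of \<theta> "transfers cells w f"] by simp
  finally show ?case .
qed

lemma transfers_Nats:
  assumes "\<And>k. f k \<in> \<nat>"
  shows "transfers A w f b \<in> \<nat>"
proof (induction w arbitrary: b)
  case (Cons \<theta> w)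
  have "(\<Sum>l<m. if cell_step \<theta> b l \<in> A then transfers A w f (cell_step \<theta> b l) else 0) \<in> \<nat>" for m
    by (induction m) (auto intro!: Nats_add Cons.IH)
  then show ?case by (simp add: transfer_def)
qed (simp add: assms)

lemma word_mat_entry:
  assumes "i < N" "k < N"
  shows "word_mat w $$ (i, k) = transfers cells w (\<lambda>c. of_bool (c = basic_index L ts k)) (basic_index L ts i)"
proof -
  have inj: "basic_index L ts j = basic_index L ts k \<longleftrightarrow> j = k" if "j < N" for j
    using basic_index_bij that assms(2) by (auto simp: bij_betw_def inj_on_def)
  have "(\<Sum>j<N. word_mat w $$ (i, j) * of_bool (basic_index L ts j = basic_index L ts k)) =
      (\<Sum>j<N. if j = k then word_mat w $$ (i, j) else 0)"
    using inj by (intro sum.cong) auto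
  also have "\<dots> = word_mat w $$ (i, k)" using assms by simp
  finally show ?thesis using word_mat_transfers[OF assms(1), of w "\<lambda>c. of_bool (c = basic_index L ts k)"]
    by simp
qed

lemma word_mat_entry_Nats: "i < N \<Longrightarrow> k < N \<Longrightarrow> word_mat w $$ (i, k) \<in> \<nat>"
  by (auto simp: word_mat_entry intro: transfers_Nats)

lemma Nats_pos_ge_1: "(x::real) \<in> \<nat> \<Longrightarrow> 0 < x \<Longrightarrow> 1 \<le> x"
  by (auto elim!: Nats_cases)

lemma Nats_ge_0: "(x::real) \<in> \<nat> \<Longrightarrow> 0 \<le> x"
  by (auto elim!: Nats_cases)

lemma nonneg_word_mat: "nonneg_mat (word_mat w)"
  using word_mat_entry_Nats word_mat_carrier[of w] by (auto simp: nonneg_mat_def intro: Nats_ge_0)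

lemma total_paths_word_mat: "total_paths cells w = (\<Sum>i<N. \<Sum>k<N. word_mat w $$ (i, k))"
proof -
  have "total_paths cells w = (\<Sum>i<N. paths cells w (basic_index L ts i))"
    unfolding total_paths_def by (rule sum_basic_index[symmetric])
  also have "\<dots> = (\<Sum>i<N. \<Sum>k<N. word_mat w $$ (i, k))"
    using word_mat_transfers[of _ w "\<lambda>_. 1"] by (intro sum.cong) (auto simp: paths_def)
  finally show ?thesis .
qed

text \<open>Entries are natural numbers, so positive ones are at least 1.\<close>
lemma positive_ifs_cells:
  assumes good: "good_family \<nu> N L (assoc_mat L ts)" and N: "0 < N"
  shows "\<exists>w0. positive_ifs L ts cells w0"
proof -
  obtain n w0 where w0: "1 \<le> n" "w0 \<in> words L n" "strictly_pos_mat (word_mat w0)"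
    using good by (auto simp: good_family_def)
  have idx: "\<exists>i<N. b = basic_index L ts i" if "b \<in> cells" for b
    using basic_index_bij that by (auto simp: bij_betw_def)
  have "positive_ifs L ts cells w0"
  proof unfold_locales
    show "finite cells" by (rule finite_basic_indices)
    show "cells \<noteq> {}" using N by (auto simp: num_basic_def)
    show "set w0 \<subseteq> {..<L}" "w0 \<noteq> []" using w0 by (auto simp: words_def)
  next
    fix \<theta> b assume \<theta>: "\<theta> < L" and "b \<in> cells"
    then obtain i where i: "i < N" "b = basic_index L ts i" using idx by blast
    have "word_mat [\<theta>] = assoc_mat L ts \<theta>"
      using right_mult_one_mat[OF assoc_mat_carrier] by (simp add: mat_word_prod_def)
    moreover obtain k where k: "k < N" "0 < assoc_mat L ts \<theta> $$ (i, k)"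
    proof -
      have "allowable_mat (assoc_mat L ts \<theta>)" using good \<theta> by (simp add: good_family_def)
      moreover have "dim_row (assoc_mat L ts \<theta>) = N" "dim_col (assoc_mat L ts \<theta>) = N"
        using assoc_mat_carrier[of \<theta>] by auto
      ultimately have "\<exists>k<N. 0 < assoc_mat L ts \<theta> $$ (i, k)"
        using i by (simp add: allowable_mat_def)
      then show thesis using that by blast
    qed
    ultimately have "1 \<le> word_mat [\<theta>] $$ (i, k)"
      using word_mat_entry_Nats[OF i(1) k(1), of "[\<theta>]"] by (auto intro: Nats_pos_ge_1)
    also have "\<dots> \<le> (\<Sum>k<N. word_mat [\<theta>] $$ (i, k))"
      using k i word_mat_entry_Nats by (intro member_le_sum) (auto intro: Nats_ge_0)
    also have "\<dots> = paths cells [\<theta>] b"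
      using word_mat_transfers[OF i(1), of "[\<theta>]" "\<lambda>_. 1"] by (simp add: paths_def i)
    finally show "1 \<le> paths cells [\<theta>] b" .
  next
    fix f :: "int \<Rightarrow> real" and b assume b: "b \<in> cells" and f: "\<And>k. k \<in> cells \<Longrightarrow> 0 \<le> f k"
    obtain i where i: "i < N" "b = basic_index L ts i" using idx b by blast
    have "sum f cells = (\<Sum>k<N. 1 * f (basic_index L ts k))" unfolding mult_1 by (rule sum_basic_index[symmetric])
    also have "\<dots> \<le> (\<Sum>k<N. word_mat w0 $$ (i, k) * f (basic_index L ts k))"
    proof (intro sum_mono mult_right_mono)
      fix k assume k: "k \<in> {..<N}"
      have "0 < word_mat w0 $$ (i, k)"
        using w0(3) i k word_mat_carrier[of w0] by (auto simp: strictly_pos_mat_def)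
      then show "1 \<le> word_mat w0 $$ (i, k)"
        using word_mat_entry_Nats i k by (auto intro: Nats_pos_ge_1)
      show "0 \<le> f (basic_index L ts k)"
        using f k basic_index_bij by (auto simp: bij_betw_def)
    qed
    also have "\<dots> = transfers cells w0 f b" using word_mat_transfers[OF i(1)] i by simp
    finally show "sum f cells \<le> transfers cells w0 f b" .
  qed
  then show ?thesis by blast
qed

end

context positive_ifs
begin

section \<open>The pressure function\<close>

text \<open>The upper bound is the assumed lower bound on \<open>total_paths\<close> raised to the power \<open>q \<le> 0\<close>. The
  lower bound is Jensen's inequality for \<open>exp\<close> together with \<open>avg_total n \<le> lyapunov * n + C\<close>.\<close>
lemma pressure_line:
  assumes c: "0 < c1" "0 < c2"
    and g: "\<And>n w. w \<in> words L n \<Longrightarrow> c1 * total_paths A w \<le> g w \<and> g w \<le> c2 * total_paths A w"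
    and low: "\<And>n w. w \<in> words L n \<Longrightarrow> exp (lyapunov * real n) \<le> total_paths A w"
    and q: "q \<le> 0"
  shows "lim (\<lambda>n. 1 / real n * ln (\<Sum>w\<in>words L n. g w powr q)) = lyapunov * q + ln (real L)"
proof (rule limI)
  obtain C where C: "\<And>n. 1 \<le> n \<Longrightarrow> avg_total n \<le> lyapunov * real n + C"
    using avg_total_upper by blast
  let ?F = "\<lambda>n. 1 / real n * ln (\<Sum>w\<in>words L n. g w powr q)"
  let ?l = "lyapunov * q + ln (real L)"
  have gpos: "0 < g w" if "w \<in> words L n" for w n
    using g[OF that] c word_total_pos[OF that] mult_pos_pos[of c1 "total_paths A w"] by linarith
  have ne: "words L n \<noteq> {}" for n
    using card_words[of L n] Lpos by (metis card.empty power_not_zero not_gr_zero)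
  have spos: "0 < (\<Sum>w\<in>words L n. g w powr q)" for n
  proof (intro sum_pos finite_words ne)
    fix w assume w: "w \<in> words L n"
    show "0 < g w powr q" using gpos[OF w] by simp
  qed
  have upper: "?F n \<le> ?l + q * ln c1 / real n" if n: "1 \<le> n" for n
  proof -
    have "(\<Sum>w\<in>words L n. g w powr q) \<le> (\<Sum>w\<in>words L n. (c1 * exp (lyapunov * real n)) powr q)"
    proof (intro sum_mono powr_mono2')
      fix w assume w: "w \<in> words L n"
      have "c1 * exp (lyapunov * real n) \<le> c1 * total_paths A w"
        using low[OF w] c by (intro mult_left_mono) auto
      then show "c1 * exp (lyapunov * real n) \<le> g w" using g[OF w] by linarith
    qed (use q c in auto)
    also have "\<dots> = real L ^ n * (c1 * exp (lyapunov * real n)) powr q" by (simp add: card_words)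
    finally have "ln (\<Sum>w\<in>words L n. g w powr q) \<le> ln (real L ^ n * (c1 * exp (lyapunov * real n)) powr q)"
      using spos by (intro ln_mono) auto
    also have "\<dots> = real n * ln (real L) + q * (ln c1 + lyapunov * real n)"
      using Lpos c by (simp add: ln_mult_pos ln_realpow ln_powr)
    finally show ?thesis using n by (simp add: field_simps)
  qed
  have lower: "?l + q * (ln c2 + C) / real n \<le> ?F n" if n: "1 \<le> n" for n
  proof -
    define y where "y w = q * ln (g w)" for w
    let ?W = "words L n"
    have "exp (\<Sum>w\<in>?W. (1 / real L ^ n) *\<^sub>R y w) \<le> (\<Sum>w\<in>?W. 1 / real L ^ n * exp (y w))"
      using finite_words ne Lpos
      by (intro convex_on_sum[of _ UNIV exp]) (auto simp: card_words exp_convex)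
    moreover have "(\<Sum>w\<in>?W. (1 / real L ^ n) *\<^sub>R y w) = word_avg L n y"
      by (simp add: word_avg_def sum_divide_distrib)
    moreover have "(\<Sum>w\<in>?W. 1 / real L ^ n * exp (y w)) = (\<Sum>w\<in>?W. g w powr q) / real L ^ n"
      unfolding sum_divide_distrib
    proof (rule sum.cong[OF refl])
      fix w assume "w \<in> ?W"
      then have "g w \<noteq> 0" using gpos[of w n] by simp
      then show "1 / real L ^ n * exp (y w) = g w powr q / real L ^ n" by (simp add: y_def powr_def)
    qed
    ultimately have "exp (word_avg L n y) \<le> (\<Sum>w\<in>?W. g w powr q) / real L ^ n" by simp
    then have "real L ^ n * exp (word_avg L n y) \<le> (\<Sum>w\<in>?W. g w powr q)"
      using Lpos by (simp add: field_simps)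
    then have "ln (real L ^ n * exp (word_avg L n y)) \<le> ln (\<Sum>w\<in>?W. g w powr q)"
      using Lpos by (intro ln_mono) auto
    then have 1: "real n * ln (real L) + word_avg L n y \<le> ln (\<Sum>w\<in>?W. g w powr q)"
      using Lpos by (simp add: ln_mult_pos ln_realpow)
    have "word_avg L n (\<lambda>w. ln (g w)) \<le> word_avg L n (\<lambda>w. ln c2 + ln (total_paths A w))"
    proof (rule word_avg_mono)
      fix w assume w: "w \<in> ?W"
      have "ln (g w) \<le> ln (c2 * total_paths A w)"
        using g[OF w] gpos[OF w] by (intro ln_mono) auto
      then show "ln (g w) \<le> ln c2 + ln (total_paths A w)"
        using c word_total_pos[OF w] by (simp add: ln_mult_pos)
    qed
    also have "\<dots> = ln c2 + avg_total n"
      using Lpos by (simp add: word_avg_add word_avg_const avg_total_def)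
    also have "\<dots> \<le> ln c2 + (lyapunov * real n + C)" using C[OF n] by simp
    finally have "q * (ln c2 + (lyapunov * real n + C)) \<le> q * word_avg L n (\<lambda>w. ln (g w))"
      using q by (intro mult_left_mono_neg)
    then have "real n * ln (real L) + q * (ln c2 + (lyapunov * real n + C)) \<le> ln (\<Sum>w\<in>?W. g w powr q)"
      using 1 by (simp add: y_def[abs_def] word_avg_cmult)
    then have "1 / real n * (real n * ln (real L) + q * (ln c2 + (lyapunov * real n + C))) \<le> ?F n"
      by (intro mult_left_mono) auto
    moreover have "1 / real n * (real n * ln (real L) + q * (ln c2 + (lyapunov * real n + C))) =
        ?l + q * (ln c2 + C) / real n"
      using n by (simp add: field_simps)
    ultimately show ?thesis by simp
  qed
  have lim0: "(\<lambda>n. ?l + d / real n) \<longlonglongrightarrow> ?l" for d :: real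
    using tendsto_add[OF tendsto_const lim_const_over_n] by fastforce
  show "?F \<longlonglongrightarrow> ?l"
  proof (rule tendsto_sandwich[OF _ _ lim0 lim0])
    show "\<forall>\<^sub>F n in sequentially. ?l + q * (ln c2 + C) / real n \<le> ?F n"
      using lower by (auto simp: eventually_sequentially)
    show "\<forall>\<^sub>F n in sequentially. ?F n \<le> ?l + q * ln c1 / real n"
      using upper by (auto simp: eventually_sequentially)
  qed
qed

text \<open>Above \<open>exp (- lyapunov)\<close> almost every fibre is supercritical, and below \<open>p1\<close> the fibres that repeat
  \<open>w\<close> are subcritical.\<close>
lemma parameter_interval:
  assumes A: "A = basic_indices L ts"
    and w: "w \<in> words L n" "total_paths A w < exp (lyapunov * real n)"
  shows "\<exists>p0 p1 :: real. 0 \<le> p0 \<and> p0 < p1 \<and> p1 \<le> 1 \<and>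
    (\<forall>p. p0 < p \<and> p < p1 \<longrightarrow>
      almost_surely_given (coin_space M p)
        (\<lambda>\<omega>. emeasure lebesgue (random_attractor L ts \<omega>) > 0) (\<lambda>\<omega>. surviving M \<omega> \<noteq> {}) \<and>
      (AE \<omega> in coin_space M p. interior (random_attractor L ts \<omega>) = {}))"
proof -
  have T: "1 \<le> total_paths A w" by (rule total_ge_1[OF word_set[OF w(1)]])
  have "1 < exp (lyapunov * real n)" using T w(2) by linarith
  then have pos: "0 < lyapunov * real n" by simp
  then have n: "0 < n" by (cases n) auto
  then have lyap: "0 < lyapunov" using pos by (simp add: zero_less_mult_iff)
  define p1 where "p1 = min 1 (exp (- ln (total_paths A w) / real n))"
  have "ln (total_paths A w) < ln (exp (lyapunov * real n))"
    using w(2) T by (subst ln_less_cancel_iff) auto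
  then have "ln (total_paths A w) < lyapunov * real n" by simp
  then have "- lyapunov < - ln (total_paths A w) / real n" using n by (simp add: field_simps)
  then have p01: "exp (- lyapunov) < p1" using lyap by (simp add: p1_def)
  have "almost_surely_given (coin_space M p)
        (\<lambda>\<omega>. emeasure lebesgue (random_attractor L ts \<omega>) > 0) (\<lambda>\<omega>. surviving M \<omega> \<noteq> {}) \<and>
      (AE \<omega> in coin_space M p. interior (random_attractor L ts \<omega>) = {})"
    if p: "exp (- lyapunov) < p" "p < p1" for p
  proof
    have p': "0 < p" "p < 1" using p by (auto simp: p1_def intro: less_trans[OF exp_gt_zero])
    have "ln (exp (- lyapunov)) < ln p" using p p' by (subst ln_less_cancel_iff) auto
    then have "0 < ln p + lyapunov" by simp
    then show "almost_surely_given (coin_space M p)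
        (\<lambda>\<omega>. emeasure lebesgue (random_attractor L ts \<omega>) > 0) (\<lambda>\<omega>. surviving M \<omega> \<noteq> {})"
      using p' core_measure_positive[of p] A by (intro zero_one_law) auto
    have "p < exp (- ln (total_paths A w) / real n)" using p(2) by (simp add: p1_def)
    then have "ln p < ln (exp (- ln (total_paths A w) / real n))"
      using p' by (subst ln_less_cancel_iff) auto
    then have "ln p < - ln (total_paths A w) / real n" by simp
    then have "real n * ln p + ln (total_paths A w) < 0" using n by (simp add: field_simps)
    then have "exp (real n * ln p + ln (total_paths A w)) < 1" by simp
    then have "p ^ length w * total_paths A w < 1"
      using p' T w(1) by (simp add: exp_add exp_of_nat_mult words_def)
    then show "AE \<omega> in coin_space M p. interior (random_attractor L ts \<omega>) = {}"
      using p' A word_set[OF w(1)] by (intro AE_interior_empty) auto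
  qed
  then show ?thesis using p01 by (intro exI[of _ "exp (- lyapunov)"] exI[of _ p1]) (auto simp: p1_def)
qed

end

section \<open>Positive measure without interior points\<close>
theorem lemma6p3:
  fixes L :: nat and ts :: "nat list" and nrm :: "real mat \<Rightarrow> real"
  assumes "issifs L ts"
    and "good_family (uniform_symb_measure L) (num_basic L ts) L (assoc_mat L ts)"
    and "submult_mat_norm (num_basic L ts) nrm"
    and "\<not> (\<exists>a c. \<forall>q\<le>0. pressure nrm (num_basic L ts) L (assoc_mat L ts) q = a * q + c)"
  shows "\<exists>p0 p1 :: real. 0 \<le> p0 \<and> p0 < p1 \<and> p1 \<le> 1 \<and>
    (\<forall>p. p0 < p \<and> p < p1 \<longrightarrow>
      almost_surely_given (coin_space (length ts) p)
        (\<lambda>\<omega>. emeasure lebesgue (random_attractor L ts \<omega>) > 0)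
        (\<lambda>\<omega>. surviving (length ts) \<omega> \<noteq> {}) \<and>
      (AE \<omega> in coin_space (length ts) p. interior (random_attractor L ts \<omega>) = {}))"
proof -
  interpret integer_ifs L ts by unfold_locales (rule assms(1))
  \<comment> \<open>For \<open>N = 0\<close> every norm and every power \<open>0 powr q\<close> is 0, so the pressure is constant.\<close>
  have N: "0 < N"
  proof (rule ccontr)
    assume "\<not> 0 < N"
    then have N0: "N = 0" by simp
    have "nrm (word_mat w) = 0" for w
    proof -
      have c: "word_mat w \<in> carrier_mat N N" by (rule word_mat_carrier)
      then have "word_mat w = 0\<^sub>m N N" using N0 by (intro eq_matI) auto
      then show ?thesis using assms(3) c unfolding submult_mat_norm_def by blast
    qed
    then have "pressure nrm N L (assoc_mat L ts) q = 0 * q + 0" for q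
      by (simp add: pressure_def)
    then show False using assms(4) by blast
  qed
  obtain w0 where "positive_ifs L ts cells w0" using positive_ifs_cells[OF assms(2) N] by blast
  then interpret positive_ifs L ts cells w0 .
  obtain c1 c2 where c: "0 < c1" "0 < c2" "\<And>C. C \<in> carrier_mat N N \<Longrightarrow> nonneg_mat C \<Longrightarrow>
      c1 * (\<Sum>i<N. \<Sum>k<N. C $$ (i, k)) \<le> nrm C \<and> nrm C \<le> c2 * (\<Sum>i<N. \<Sum>k<N. C $$ (i, k))"
    using norm_equivalent_entry_sum[OF assms(3) N] by blast
  have "\<exists>n. \<exists>w\<in>words L n. total_paths cells w < exp (lyapunov * real n)"
  proof (rule ccontr)
    assume "\<not> ?thesis"
    then have low: "\<And>n w. w \<in> words L n \<Longrightarrow> exp (lyapunov * real n) \<le> total_paths cells w"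
      by (meson not_less)
    have "pressure nrm N L (assoc_mat L ts) q = lyapunov * q + ln (real L)" if "q \<le> 0" for q
      unfolding pressure_def
      using c(3)[OF word_mat_carrier nonneg_word_mat] low that
      by (intro pressure_line[OF c(1,2)]) (auto simp: total_paths_word_mat)
    then show False using assms(4) by blast
  qed
  then show ?thesis using parameter_interval[OF refl] by blast
qed

end
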